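(* Let $g\ge2$ and let $K=(k_1,\dots,k_{g-1})$ be a one-layer exponent tuple of nonzero integers such that $G(K)=\langle a_1,\dots,a_g\mid Y_1,\dots,Y_g\rangle$ is the trivial group. Then the ordered tuple $(Y_1,\dots,Y_g)$ is Andrews–Curtis equivalent to a free basis of $F(a_1,\dots,a_g)$, and hence to $(a_1,\dots,a_g)$.
   Context: The one-layer words $Y_i\in F(a_1,\dots,a_g)$ are defined recursively: $\Theta_1=a_1$, and for $1\le i<g$, $P_i=\Theta_i^{-1}a_i\Theta_i$, $Y_i=\Theta_i(P_ia_{i+1})^{k_i}$, $\Theta_{i+1}=a_{i+1}(a_{i+1}P_i)^{k_i}$, and $Y_g=\Theta_g$. Two $m$-tuples of elements of a free group $F_n$ are Andrews–Curtis equivalent if one is obtained from the other by a finite sequence of the following moves and their inverses on a tuple $(r_1,\dots,r_m)$: (1) $r_i\mapsto r_i^{-1}$; (2) $r_i\mapsto r_ir_j$ or $r_i\mapsto r_jr_i$ with $i\ne j$; (3) $r_i\mapsto wr_iw^{-1}$ for $w\in F_n$; (4) $(r_1,\dots,r_m)\mapsto(\alpha(r_1),\dots,\alpha(r_m))$ for $\alpha\in\operatorname{Aut}(F_n)$. Permutations of the tuple are also allowed. *)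

theory Defs
  imports "HOL-Algebra.Algebra"
begin

section \<open>Free groups as groups of reduced words\<close>

text \<open>The letter \<open>(x, True)\<close> stands for the generator \<open>x\<close> and \<open>(x, False)\<close> for its
  inverse.\<close>

type_synonym 'a word = "('a \<times> bool) list"

definition inv_letter :: "'a \<times> bool \<Rightarrow> 'a \<times> bool" where
  "inv_letter l = (fst l, \<not> snd l)"

fun reduced :: "'a word \<Rightarrow> bool" where
  "reduced [] \<longleftrightarrow> True"
| "reduced [l] \<longleftrightarrow> True"
| "reduced (l # m # w) \<longleftrightarrow> m \<noteq> inv_letter l \<and> reduced (m # w)"

fun cons_reduce :: "'a \<times> bool \<Rightarrow> 'a word \<Rightarrow> 'a word" where
  "cons_reduce l [] = [l]"
| "cons_reduce l (m # w) = (if m = inv_letter l then w else l # m # w)"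

definition free_group :: "'a set \<Rightarrow> 'a word monoid" where
  "free_group A =
    \<lparr>carrier = {w. reduced w \<and> fst ` set w \<subseteq> A}, monoid.mult = foldr cons_reduce, one = []\<rparr>"

definition gen :: "'a \<Rightarrow> 'a word" where
  "gen x = [(x, True)]"

lemma inv_letter_simps [simp]:
  "inv_letter (inv_letter l) = l" "inv_letter l \<noteq> l" "l \<noteq> inv_letter l"
  "fst (inv_letter l) = fst l"
  by (auto simp: inv_letter_def prod_eq_iff)

lemma reduced_Cons: "reduced (l # w) \<Longrightarrow> reduced w"
  by (cases w) auto

lemma reduced_cons_reduce: "reduced w \<Longrightarrow> reduced (cons_reduce l w)"
  by (cases w) (auto dest: reduced_Cons)

lemma reduced_foldr: "reduced v \<Longrightarrow> reduced (foldr cons_reduce u v)"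
  by (induction u) (auto intro: reduced_cons_reduce)

lemma cons_reduce_Cons: "reduced (l # w) \<Longrightarrow> cons_reduce l w = l # w"
  by (cases w) auto

lemma cons_reduce_cancel: "reduced w \<Longrightarrow> cons_reduce l (cons_reduce (inv_letter l) w) = w"
  by (cases w) (auto simp: cons_reduce_Cons)

lemma foldr_cons_reduce:
  assumes "reduced w"
  shows "foldr cons_reduce (cons_reduce l u) w = cons_reduce l (foldr cons_reduce u w)"
proof (cases u)
  case (Cons m u')
  show ?thesis
  proof (cases "m = inv_letter l")
    case True
    then show ?thesis using Cons cons_reduce_cancel[OF reduced_foldr[OF assms], of l] by simp
  qed (use Cons in auto)
qed auto

lemma set_cons_reduce: "set (cons_reduce l w) \<subseteq> insert l (set w)"
  by (cases w) auto

lemma set_foldr_cons_reduce: "set (foldr cons_reduce u v) \<subseteq> set u \<union> set v"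
proof (induction u)
  case (Cons l u)
  then show ?case using set_cons_reduce[of l "foldr cons_reduce u v"] by auto
qed auto

lemma reduced_append_Cons:
  "reduced (u @ [l]) \<Longrightarrow> m \<noteq> inv_letter l \<Longrightarrow> reduced (u @ [l, m])"
proof (induction u)
  case (Cons a u)
  then show ?case by (cases u) auto
qed auto

lemma reduced_rev_inv: "reduced w \<Longrightarrow> reduced (rev (map inv_letter w))"
proof (induction w rule: reduced.induct)
  case (3 l m w)
  have "inv_letter l \<noteq> inv_letter (inv_letter m)"
    using 3(2) by (metis inv_letter_simps(1) reduced.simps(3))
  then show ?case
    using 3 by (auto intro!: reduced_append_Cons)
qed auto

lemma foldr_rev_inv: "reduced v \<Longrightarrow> foldr cons_reduce (rev (map inv_letter w)) (foldr cons_reduce w v) = v"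
proof (induction w)
  case (Cons l w)
  have "cons_reduce (inv_letter l) (cons_reduce l (foldr cons_reduce w v)) = foldr cons_reduce w v"
    using cons_reduce_cancel[of _ "inv_letter l"] reduced_foldr[OF Cons(2)] by simp
  then show ?case using Cons by simp
qed auto

lemma foldr_cons_reduce_Nil: "reduced w \<Longrightarrow> foldr cons_reduce w [] = w"
proof (induction w)
  case (Cons l w)
  then show ?case using cons_reduce_Cons[of l w] reduced_Cons[of l w] by simp
qed auto

lemma group_free_group: "group (free_group A)"
proof (rule groupI, goal_cases)
  case (1 x y)
  have "fst ` set (foldr cons_reduce x y) \<subseteq> fst ` set x \<union> fst ` set y"
    using image_mono[OF set_foldr_cons_reduce[of x y], of fst] by (simp add: image_Un)
  also have "\<dots> \<subseteq> A" using 1 by (simp add: free_group_def)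
  finally show ?case using 1 by (simp add: free_group_def reduced_foldr)
next
  case 2
  then show ?case by (simp add: free_group_def)
next
  case (3 x y z)
  then have "reduced z" "reduced y" by (auto simp: free_group_def)
  then have "foldr cons_reduce (foldr cons_reduce x y) z = foldr cons_reduce x (foldr cons_reduce y z)"
    by (induction x) (auto simp: foldr_cons_reduce)
  then show ?case by (simp add: free_group_def)
next
  case (4 x)
  then show ?case by (simp add: free_group_def)
next
  case (5 x)
  then have "reduced x" "fst ` set x \<subseteq> A" by (auto simp: free_group_def)
  moreover have "foldr cons_reduce (rev (map inv_letter x)) x = []"
    using foldr_rev_inv[of "[]" x] foldr_cons_reduce_Nil[OF \<open>reduced x\<close>] by simp
  ultimately show ?case
    by (intro bexI[of _ "rev (map inv_letter x)"]) (auto simp: free_group_def reduced_rev_inv)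
qed

lemma gen_in_free_group: "x \<in> A \<Longrightarrow> gen x \<in> carrier (free_group A)"
  by (simp add: gen_def free_group_def)

definition word_eval :: "('b, 'c) monoid_scheme \<Rightarrow> ('a \<Rightarrow> 'b) \<Rightarrow> 'a word \<Rightarrow> 'b" where
  "word_eval G f w =
    foldr (\<lambda>l y. (if snd l then f (fst l) else inv\<^bsub>G\<^esub> f (fst l)) \<otimes>\<^bsub>G\<^esub> y) w \<one>\<^bsub>G\<^esub>"

lemma (in group) word_eval_closed:
  "\<lbrakk>\<And>x. x \<in> A \<Longrightarrow> f x \<in> carrier G; fst ` set w \<subseteq> A\<rbrakk> \<Longrightarrow> word_eval G f w \<in> carrier G"
  by (induction w) (auto simp: word_eval_def)

lemma (in group) word_eval_cons_reduce:
  assumes "\<And>x. x \<in> A \<Longrightarrow> f x \<in> carrier G" "fst ` set w \<subseteq> A" "fst l \<in> A"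
  shows "word_eval G f (cons_reduce l w) = word_eval G f (l # w)"
proof (cases w)
  case (Cons m w')
  have "fst ` set w' \<subseteq> A" using assms Cons by auto
  then have "foldr (\<lambda>l y. (if snd l then f (fst l) else inv f (fst l)) \<otimes> y) w' \<one> \<in> carrier G"
    using word_eval_closed[of A f w'] assms(1) by (simp add: word_eval_def)
  then show ?thesis
    using assms Cons by (auto simp: word_eval_def inv_letter_def m_assoc[symmetric])
qed auto

text \<open>The universal property of the free group.\<close>

lemma (in group) word_eval_hom:
  assumes f: "\<And>x. x \<in> A \<Longrightarrow> f x \<in> carrier G"
  shows "word_eval G f \<in> hom (free_group A) G"
proof (rule homI)
  fix u assume "u \<in> carrier (free_group A)"
  then show "word_eval G f u \<in> carrier G"
    using f by (intro word_eval_closed[of A]) (auto simp: free_group_def)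
next
  fix u v assume "u \<in> carrier (free_group A)" "v \<in> carrier (free_group A)"
  then have u: "fst ` set u \<subseteq> A" and v: "fst ` set v \<subseteq> A" by (auto simp: free_group_def)
  from u have "word_eval G f (foldr cons_reduce u v) = word_eval G f u \<otimes> word_eval G f v"
  proof (induction u)
    case Nil
    then show ?case using f v word_eval_closed[of A f v] by (simp add: word_eval_def)
  next
    case (Cons l u)
    have uv: "fst ` set (foldr cons_reduce u v) \<subseteq> A"
      using Cons(2) v set_foldr_cons_reduce[of u v] by force
    have l: "fst l \<in> A" and uA: "fst ` set u \<subseteq> A" using Cons(2) by auto
    let ?c = "if snd l then f (fst l) else inv f (fst l)"
    have step: "word_eval G f (l # w) = ?c \<otimes> word_eval G f w" for w
      by (simp add: word_eval_def)
    have c: "?c \<in> carrier G" using f[OF l] by auto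
    have "word_eval G f (foldr cons_reduce (l # u) v) = ?c \<otimes> word_eval G f (foldr cons_reduce u v)"
      using word_eval_cons_reduce[of A f, OF f uv l] step by simp
    also have "\<dots> = ?c \<otimes> (word_eval G f u \<otimes> word_eval G f v)"
      using Cons.IH[OF uA] by simp
    also have "\<dots> = word_eval G f (l # u) \<otimes> word_eval G f v"
      using c word_eval_closed[of A f, OF f uA] word_eval_closed[of A f, OF f v]
      by (simp only: step m_assoc)
    finally show ?case .
  qed
  then show "word_eval G f (u \<otimes>\<^bsub>free_group A\<^esub> v) = word_eval G f u \<otimes> word_eval G f v"
    by (simp add: free_group_def)
qed

lemma (in group) word_eval_gen: "f x \<in> carrier G \<Longrightarrow> word_eval G f (gen x) = f x"
  by (simp add: word_eval_def gen_def)

lemma inv_gen: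
  assumes "x \<in> A"
  shows "inv\<^bsub>free_group A\<^esub> gen x = [(x, False)]"
proof -
  interpret F: group "free_group A" by (rule group_free_group)
  show ?thesis
    using assms by (intro F.inv_equality) (auto simp: gen_def free_group_def inv_letter_def)
qed

lemma (in group) hom_free_group_unique:
  assumes h: "h \<in> hom (free_group A) G" and "w \<in> carrier (free_group A)"
  shows "h w = word_eval G (\<lambda>x. h (gen x)) w"
proof -
  interpret F: group "free_group A" by (rule group_free_group)
  interpret h: group_hom "free_group A" G h
    by (intro group_hom.intro group_hom_axioms.intro h is_group group_free_group)
  have "reduced w" "fst ` set w \<subseteq> A" using assms(2) by (auto simp: free_group_def)
  then show ?thesis
  proof (induction w)
    case Nil
    then show ?case using h.hom_one by (simp add: word_eval_def free_group_def)
  next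
    case (Cons l w)
    have w: "w \<in> carrier (free_group A)"
      using Cons.prems by (auto simp: free_group_def dest: reduced_Cons)
    have x: "fst l \<in> A" using Cons.prems by simp
    have l: "[l] \<in> carrier (free_group A)" using x by (simp add: free_group_def)
    have "l # w = [l] \<otimes>\<^bsub>free_group A\<^esub> w"
      using Cons.prems by (simp add: free_group_def cons_reduce_Cons)
    then have "h (l # w) = h [l] \<otimes> h w" using l w by simp
    also have "h [l] = (if snd l then h (gen (fst l)) else inv h (gen (fst l)))"
      using h.hom_inv[OF gen_in_free_group[OF x]] inv_gen[OF x]
      by (cases l) (auto simp: gen_def)
    also have "h w = word_eval G (\<lambda>x. h (gen x)) w"
      using Cons by (auto dest: reduced_Cons)
    finally show ?case by (simp add: word_eval_def)
  qed
qed

text \<open>An ordered tuple \<open>B\<close> freely generates \<open>G\<close> if the homomorphism from the free group on the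
  index set of \<open>B\<close> that extends the assignment of \<open>B ! i\<close> to \<open>i\<close> is an isomorphism.\<close>

definition free_basis :: "('b, 'c) monoid_scheme \<Rightarrow> 'b list \<Rightarrow> bool" where
  "free_basis G B \<longleftrightarrow>
    set B \<subseteq> carrier G \<and> word_eval G (\<lambda>i. B ! i) \<in> iso (free_group {..<length B}) G"


section \<open>Group presentations\<close>

definition normal_closure :: "('b, 'c) monoid_scheme \<Rightarrow> 'b set \<Rightarrow> 'b set" where
  "normal_closure G R = \<Inter>{N. N \<lhd> G \<and> R \<subseteq> N}"

definition presented_group :: "'a set \<Rightarrow> 'a word set \<Rightarrow> 'a word set monoid" where
  "presented_group A R = free_group A Mod normal_closure (free_group A) R"


section \<open>Andrews-Curtis equivalence\<close>

text \<open>Since the equivalence below also uses moves backwards, the source of every move is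
  required to be a tuple in \<open>carrier G\<close>; the target then is one as well.\<close>

inductive AC_move :: "('b, 'c) monoid_scheme \<Rightarrow> 'b list \<Rightarrow> 'b list \<Rightarrow> bool"
  for G (structure) where
  invert: "\<lbrakk>set r \<subseteq> carrier G; i < length r\<rbrakk>
    \<Longrightarrow> AC_move G r (r[i := inv (r ! i)])"
| mult_right: "\<lbrakk>set r \<subseteq> carrier G; i < length r; j < length r; i \<noteq> j\<rbrakk>
    \<Longrightarrow> AC_move G r (r[i := r ! i \<otimes> r ! j])"
| mult_left: "\<lbrakk>set r \<subseteq> carrier G; i < length r; j < length r; i \<noteq> j\<rbrakk>
    \<Longrightarrow> AC_move G r (r[i := r ! j \<otimes> r ! i])"
| conjugate: "\<lbrakk>set r \<subseteq> carrier G; i < length r; w \<in> carrier G\<rbrakk>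
    \<Longrightarrow> AC_move G r (r[i := w \<otimes> r ! i \<otimes> inv w])"
| automorphism: "\<lbrakk>set r \<subseteq> carrier G; \<alpha> \<in> auto G\<rbrakk>
    \<Longrightarrow> AC_move G r (map \<alpha> r)"
| permute: "\<lbrakk>set r \<subseteq> carrier G; mset s = mset r\<rbrakk>
    \<Longrightarrow> AC_move G r s"

definition AC_equivalent :: "('b, 'c) monoid_scheme \<Rightarrow> 'b list \<Rightarrow> 'b list \<Rightarrow> bool" where
  "AC_equivalent G = equivclp (AC_move G)"


section \<open>One-layer words\<close>

text \<open>The free group \<open>F(a\<^sub>1, \<dots>, a\<^sub>g)\<close> is \<open>free_group {1..g}\<close> with \<open>a\<^sub>i = gen i\<close>.
  Of the exponents \<open>k\<close> only \<open>k 1, \<dots>, k (g - 1)\<close> are used; \<open>\<Theta>\<close> at index \<open>0\<close> is a dummy value.\<close>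

definition conj_by :: "('b, 'c) monoid_scheme \<Rightarrow> 'b \<Rightarrow> 'b \<Rightarrow> 'b" where
  "conj_by G t x = inv\<^bsub>G\<^esub> t \<otimes>\<^bsub>G\<^esub> x \<otimes>\<^bsub>G\<^esub> t"

fun Theta :: "nat \<Rightarrow> (nat \<Rightarrow> int) \<Rightarrow> nat \<Rightarrow> nat word" where
  "Theta g k 0 = \<one>\<^bsub>free_group {1..g}\<^esub>"
| "Theta g k (Suc 0) = gen 1"
| "Theta g k (Suc (Suc n)) =
    (let F = free_group {1..g}; i = Suc n; P = conj_by F (Theta g k i) (gen i)
     in gen (i + 1) \<otimes>\<^bsub>F\<^esub> (gen (i + 1) \<otimes>\<^bsub>F\<^esub> P) [^]\<^bsub>F\<^esub> k i)"

definition P_word :: "nat \<Rightarrow> (nat \<Rightarrow> int) \<Rightarrow> nat \<Rightarrow> nat word" where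
  "P_word g k i = conj_by (free_group {1..g}) (Theta g k i) (gen i)"

lemma Theta_Suc:
  "1 \<le> i \<Longrightarrow> Theta g k (i + 1) = gen (i + 1) \<otimes>\<^bsub>free_group {1..g}\<^esub>
    (gen (i + 1) \<otimes>\<^bsub>free_group {1..g}\<^esub> P_word g k i) [^]\<^bsub>free_group {1..g}\<^esub> k i"
  by (cases i) (auto simp: P_word_def Let_def)

definition Y_word :: "nat \<Rightarrow> (nat \<Rightarrow> int) \<Rightarrow> nat \<Rightarrow> nat word" where
  "Y_word g k i =
    (let F = free_group {1..g}
     in if i = g then Theta g k g
        else Theta g k i \<otimes>\<^bsub>F\<^esub> (P_word g k i \<otimes>\<^bsub>F\<^esub> gen (i + 1)) [^]\<^bsub>F\<^esub> k i)"

end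

theory Submission
  imports Defs
begin

text \<open>
  Put \<open>z\<^sub>i = (a\<^sub>i a\<^bsub>i+1\<^esub>)^k\<^sub>i\<close>. Modulo \<open>Y\<^sub>1, \<dots>, Y\<^bsub>i-1\<^esub>\<close> the recursion collapses: \<open>P\<^sub>i = a\<^sub>i\<close> and
  \<open>\<Theta>\<^sub>i = a\<^sub>i z\<^bsub>i-1\<^esub>\<close>, where \<open>z\<^bsub>i-1\<^esub>\<close> commutes with \<open>a\<^sub>i\<close>. Andrews-Curtis moves may replace a relator
  by any element that agrees with it modulo the normal closure of the others, so the tuple of
  the \<open>Y\<^sub>i\<close> is equivalent to the ``chain''
  \<open>S\<^sub>j = c\<^bsub>j-1\<^esub>^p\<^bsub>j-1\<^esub> \<cdot> c\<^sub>j^q\<^sub>j \<cdot> c\<^bsub>j+1\<^esub>^p\<^bsub>j+1\<^esub>\<close> in the free basis \<open>c\<^sub>1 = a\<^sub>1\<close>, \<open>c\<^bsub>j+1\<^esub> = a\<^sub>j a\<^bsub>j+1\<^esub>\<close>,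
  with \<open>p\<^sub>j = k\<^bsub>j-1\<^esub>\<close> and \<open>q\<^sub>j = 1 + 2 k\<^bsub>j-1\<^esub>\<close> for \<open>j \<ge> 2\<close> (\<open>AC_mset_layer_words\<close>).

  A chain presents the fundamental group of a graph manifold glued from Seifert pieces along a
  line, and the proof imitates cutting that manifold along its tori. The relators
  \<open>S\<^sub>1, \<dots>, S\<^bsub>i-1\<^esub>\<close> form a half chain. It interacts with the rest only through the peripheral
  pair \<open>z = c\<^sub>i^p\<^sub>i\<close>, \<open>y = c\<^bsub>i-1\<^esub>^p\<^bsub>i-1\<^esub> c\<^sub>i^q\<^sub>i\<close>. There are three kinds of half chains
  (\<open>half_trichotomy\<close>). A solid one behaves like a solid torus: the half chain collapses onto a
  cyclic group \<open>\<langle>b\<rangle>\<close> with \<open>z = b^\<alpha>\<close>, \<open>y = b^\<beta>\<close>. In an incompressible one, \<open>z\<close> and \<open>y\<close> generate a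
  free abelian group of rank two, even in a suitable permutation representation. A degenerate
  one has a non-trivial cyclic quotient that kills \<open>z\<close> and \<open>y\<close>.

  Now let the group be trivial. A degenerate half chain would extend to a non-trivial
  representation of the whole. Two complementary incompressible halves could be glued as in an
  amalgamated product: any two free actions of the rank two lattice on countable sets, with
  infinitely many orbits, are conjugate, so the two permutation representations can be made to agree on the torus. Two
  solid halves separated by one piece, with all three orders \<open>|\<beta>|\<close>, \<open>|p|\<close>, \<open>|\<delta>|\<close> at least two,
  would map onto a triangle group, which is not trivial. Hence the whole chain is solid or it
  is cut into two solid halves (\<open>rigid_chain_splits\<close>). In the second case the relators reduce to
  two words \<open>b^\<beta> d^-\<gamma>\<close> and \<open>b^\<alpha> d^-\<delta>\<close>. Their exponent matrix has determinant \<open>\<plusminus>1\<close>, again because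
  the group is trivial, and Euclid's algorithm on its rows consists of Andrews-Curtis moves
  (\<open>AC_mset_unimodular\<close>). Unravelling the collapse of the two halves then yields the \<open>c\<^sub>j\<close>, and
  these yield the \<open>a\<^sub>j\<close>.
\<close>

section \<open>Relators modulo the other relators\<close>

definition coset_map :: "('b, 'c) monoid_scheme \<Rightarrow> 'b set \<Rightarrow> 'b \<Rightarrow> 'b set" where
  "coset_map F R x = normal_closure F R #>\<^bsub>F\<^esub> x"

text \<open>Multisets, because the order of the relators is immaterial and because further relators can
  then be carried along by adding them to both sides. Automorphisms are not among the rules: an
  automorphism acts on all relators at once, whereas these rules keep the set of homomorphisms
  that kill the relators (lemma \<open>AC_mset_hom_trivial\<close> below).\<close>

inductive AC_mset :: "('b, 'c) monoid_scheme \<Rightarrow> 'b multiset \<Rightarrow> 'b multiset \<Rightarrow> bool"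
  for F where
  AC_mset_refl: "AC_mset F M M"
| AC_mset_sym: "AC_mset F M N \<Longrightarrow> AC_mset F N M"
| AC_mset_trans: "AC_mset F L M \<Longrightarrow> AC_mset F M N \<Longrightarrow> AC_mset F L N"
| AC_mset_invert: "\<lbrakk>x \<in> carrier F; set_mset M \<subseteq> carrier F\<rbrakk> \<Longrightarrow> AC_mset F (add_mset x M) (add_mset (inv\<^bsub>F\<^esub> x) M)"
| AC_mset_multiply: "\<lbrakk>x \<in> carrier F; w \<in> normal_closure F (set_mset M); set_mset M \<subseteq> carrier F\<rbrakk>
    \<Longrightarrow> AC_mset F (add_mset x M) (add_mset (w \<otimes>\<^bsub>F\<^esub> x) M)"

context group begin

lemma normal_closure_least: "\<lbrakk>N \<lhd> G; R \<subseteq> N\<rbrakk> \<Longrightarrow> normal_closure G R \<subseteq> N"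
  by (auto simp: normal_closure_def)

lemma carrier_normal: "carrier G \<lhd> G"
  by (simp add: normal_inv_iff subgroup_self)

lemma normal_closure_normal:
  assumes "R \<subseteq> carrier G"
  shows "normal_closure G R \<lhd> G"
proof -
  let ?S = "{N. N \<lhd> G \<and> R \<subseteq> N}"
  have C: "carrier G \<in> ?S" using assms carrier_normal by simp
  have "subgroup (\<Inter>?S) G"
    using C by (intro subgroups_Inter) (auto dest: normal_imp_subgroup)
  moreover have "x \<otimes> h \<otimes> inv x \<in> \<Inter>?S" if "x \<in> carrier G" "h \<in> \<Inter>?S" for x h
    using that by (auto intro: normal.inv_op_closed2)
  ultimately show ?thesis
    unfolding normal_closure_def by (simp add: normal_inv_iff)
qed

lemma normal_closure_subset: "R \<subseteq> carrier G \<Longrightarrow> normal_closure G R \<subseteq> carrier G"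
  using carrier_normal by (auto simp: normal_closure_def)

lemma normal_closure_mono: "R \<subseteq> R' \<Longrightarrow> normal_closure G R \<subseteq> normal_closure G R'"
  by (auto simp: normal_closure_def)

lemma normal_closure_superset: "R \<subseteq> normal_closure G R"
  by (auto simp: normal_closure_def)

lemma coset_map_hom:
  assumes R: "R \<subseteq> carrier G"
  shows "group_hom G (G Mod normal_closure G R) (coset_map G R)"
    and "r \<in> R \<Longrightarrow> coset_map G R r = \<one>\<^bsub>G Mod normal_closure G R\<^esub>"
    and "\<lbrakk>x \<in> carrier G; y \<in> carrier G; coset_map G R x = coset_map G R y\<rbrakk>
      \<Longrightarrow> x \<otimes> inv y \<in> normal_closure G R"
proof -
  let ?N = "normal_closure G R"
  interpret N: normal ?N G using normal_closure_normal[OF R] .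
  show "group_hom G (G Mod ?N) (coset_map G R)"
    using N.r_coset_hom_Mod N.factorgroup_is_group is_group
    unfolding group_hom_def group_hom_axioms_def coset_map_def[abs_def] by simp
  show "coset_map G R r = \<one>\<^bsub>G Mod ?N\<^esub>" if "r \<in> R"
    using that normal_closure_superset[of R] N.subgroup_axioms
    by (auto simp: coset_map_def FactGroup_def intro!: coset_join2[OF _ N.subgroup_axioms] subsetD[OF R])
  show "x \<otimes> inv y \<in> ?N" if "x \<in> carrier G" "y \<in> carrier G" "coset_map G R x = coset_map G R y"
  proof -
    have "x \<in> ?N #> y" using that rcos_self[OF that(1) N.subgroup_axioms] by (simp add: coset_map_def)
    then obtain h where "h \<in> ?N" "x = h \<otimes> y" by (auto simp: r_coset_def)
    moreover have "h \<in> carrier G" using \<open>h \<in> ?N\<close> N.subset by auto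
    ultimately show ?thesis using that by (simp add: m_assoc)
  qed
qed

text \<open>The working form of the multiplication rule: to exchange \<open>x\<close> for \<open>y\<close> it suffices that the
  relators in \<open>M\<close> imply \<open>x = y\<close>. Equations are thus derived in an arbitrary group \<open>K\<close>; its type is
  that of the quotient of \<open>G\<close> by the normal closure, where the hypothesis gets applied.\<close>

lemma AC_mset_replace:
  fixes M :: "'a multiset"
  assumes x: "x \<in> carrier G" and y: "y \<in> carrier G" and M: "set_mset M \<subseteq> carrier G"
    and eq: "\<And>(K :: 'a set monoid) \<phi>. \<lbrakk>group_hom G K \<phi>; \<And>r. r \<in># M \<Longrightarrow> \<phi> r = \<one>\<^bsub>K\<^esub>\<rbrakk> \<Longrightarrow> \<phi> x = \<phi> y"
  shows "AC_mset G (add_mset x M) (add_mset y M)"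
proof -
  have "coset_map G (set_mset M) y = coset_map G (set_mset M) x"
    using eq[OF coset_map_hom(1)[OF M]] coset_map_hom(2)[OF M] by metis
  then have w: "y \<otimes> inv x \<in> normal_closure G (set_mset M)" by (rule coset_map_hom(3)[OF M y x])
  have "y \<otimes> inv x \<otimes> x = y" using x y by (simp add: m_assoc)
  then show ?thesis using AC_mset.AC_mset_multiply[OF x w M] by simp
qed

lemma AC_mset_carrier: "AC_mset G M N \<Longrightarrow> set_mset M \<subseteq> carrier G \<longleftrightarrow> set_mset N \<subseteq> carrier G"
proof (induction rule: AC_mset.induct)
  case (AC_mset_multiply x w M)
  then show ?case using normal_closure_subset by auto
qed auto

lemma AC_mset_add:
  assumes "AC_mset G M N" "set_mset L \<subseteq> carrier G"
  shows "AC_mset G (M + L) (N + L)"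
  using assms
proof (induction rule: AC_mset.induct)
  case (AC_mset_invert x M)
  then show ?case using AC_mset.AC_mset_invert[of x G "M + L"] by simp
next
  case (AC_mset_multiply x w M)
  then have "w \<in> normal_closure G (set_mset (M + L))"
    using normal_closure_mono[of "set_mset M" "set_mset (M + L)"] by auto
  then show ?case using AC_mset.AC_mset_multiply[of x G w "M + L"] AC_mset_multiply by simp
qed (auto intro: AC_mset.intros)

lemma AC_mset_add_mset:
  "\<lbrakk>AC_mset G M N; x \<in> carrier G\<rbrakk> \<Longrightarrow> AC_mset G (add_mset x M) (add_mset x N)"
  using AC_mset_add[of M N "{#x#}"] by simp

lemma AC_mset_hom_trivial:
  assumes "AC_mset G M N" "group_hom G K \<phi>" "set_mset M \<subseteq> carrier G"
  shows "(\<forall>r \<in># M. \<phi> r = \<one>\<^bsub>K\<^esub>) \<longleftrightarrow> (\<forall>r \<in># N. \<phi> r = \<one>\<^bsub>K\<^esub>)"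
proof -
  interpret h: group_hom G K \<phi> using assms by simp
  show ?thesis
    using assms(1,3)
  proof (induction rule: AC_mset.induct)
    case (AC_mset_sym M N)
    then show ?case using AC_mset_carrier by blast
  next
    case (AC_mset_trans L M N)
    then show ?case using AC_mset_carrier by blast
  next
    case (AC_mset_invert x M)
    then show ?case by (metis h.hom_inv h.H.inv_one inv_closed inv_inv insert_iff set_mset_add_mset_insert)
  next
    case (AC_mset_multiply x w M)
    have "\<phi> w = \<one>\<^bsub>K\<^esub>" if "\<forall>r \<in># M. \<phi> r = \<one>\<^bsub>K\<^esub>"
    proof -
      have "normal_closure G (set_mset M) \<subseteq> kernel G K \<phi>"
        using that AC_mset_multiply(3) by (intro normal_closure_least h.normal_kernel) (auto simp: kernel_def)
      then show ?thesis using AC_mset_multiply(2) by (auto simp: kernel_def)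
    qed
    moreover have "w \<in> carrier G" using AC_mset_multiply normal_closure_subset by auto
    ultimately show ?case using AC_mset_multiply(1) by auto
  qed auto
qed

lemma AC_equivalent_refl: "AC_equivalent G r r"
  by (simp add: AC_equivalent_def)

lemma AC_equivalent_sym: "AC_equivalent G r s \<Longrightarrow> AC_equivalent G s r"
  by (simp add: AC_equivalent_def equivclp_sym)

lemma AC_equivalent_trans: "AC_equivalent G r s \<Longrightarrow> AC_equivalent G s t \<Longrightarrow> AC_equivalent G r t"
  unfolding AC_equivalent_def by (rule equivclp_trans)

lemma AC_equivalent_move: "AC_move G r s \<Longrightarrow> AC_equivalent G r s"
  unfolding AC_equivalent_def by (rule r_into_equivclp)

lemma AC_equivalent_Cons_conj:
  assumes "x \<in> carrier G" "set r \<subseteq> carrier G" "g \<in> carrier G"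
  shows "AC_equivalent G (x # r) ((g \<otimes> x \<otimes> inv g) # r)"
  using AC_move.conjugate[of "x # r" G 0 g] assms by (auto intro: AC_equivalent_move)

text \<open>The elements \<open>w\<close> by which the first entry may be multiplied, whatever that entry is, form a
  normal subgroup: conjugate the entry, multiply, conjugate back. It contains the other entries.\<close>

lemma AC_equivalent_Cons_closure:
  assumes "x \<in> carrier G" "set r \<subseteq> carrier G" "w \<in> normal_closure G (set r)"
  shows "AC_equivalent G (x # r) ((w \<otimes> x) # r)"
proof -
  let ?N = "{w \<in> carrier G. \<forall>x \<in> carrier G. AC_equivalent G (x # r) ((w \<otimes> x) # r)}"
  have "subgroup ?N G"
  proof (rule subgroupI)
    show "?N \<noteq> {}" by (auto intro!: exI[of _ \<one>] AC_equivalent_refl)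
    show "inv a \<in> ?N" if "a \<in> ?N" for a
    proof -
      have "AC_equivalent G (x # r) ((inv a \<otimes> x) # r)" if x: "x \<in> carrier G" for x
      proof -
        have "AC_equivalent G ((inv a \<otimes> x) # r) ((a \<otimes> (inv a \<otimes> x)) # r)"
          using \<open>a \<in> ?N\<close> x by auto
        moreover have "a \<otimes> (inv a \<otimes> x) = x"
          using \<open>a \<in> ?N\<close> x by (simp add: m_assoc[symmetric])
        ultimately show ?thesis using AC_equivalent_sym by simp
      qed
      then show ?thesis using that by auto
    qed
    show "a \<otimes> b \<in> ?N" if "a \<in> ?N" "b \<in> ?N" for a b
    proof -
      have "AC_equivalent G (x # r) ((a \<otimes> b \<otimes> x) # r)" if x: "x \<in> carrier G" for x
      proof -
        have "AC_equivalent G (x # r) ((b \<otimes> x) # r)" using \<open>b \<in> ?N\<close> x by auto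
        moreover have "AC_equivalent G ((b \<otimes> x) # r) ((a \<otimes> (b \<otimes> x)) # r)"
          using \<open>a \<in> ?N\<close> \<open>b \<in> ?N\<close> x by auto
        ultimately show ?thesis using that \<open>a \<in> ?N\<close> \<open>b \<in> ?N\<close> AC_equivalent_trans by (auto simp: m_assoc)
      qed
      then show ?thesis using that by auto
    qed
  qed auto
  moreover have "g \<otimes> h \<otimes> inv g \<in> ?N" if g: "g \<in> carrier G" and h: "h \<in> ?N" for g h
  proof -
    have "AC_equivalent G (x # r) ((g \<otimes> h \<otimes> inv g \<otimes> x) # r)" if x: "x \<in> carrier G" for x
    proof -
      let ?x = "inv g \<otimes> x \<otimes> g"
      have "AC_equivalent G (x # r) (?x # r)"
        using AC_equivalent_Cons_conj[of x r "inv g"] g x assms by simp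
      moreover have "AC_equivalent G (?x # r) ((h \<otimes> ?x) # r)" using h g x by auto
      moreover have "AC_equivalent G ((h \<otimes> ?x) # r) ((g \<otimes> (h \<otimes> ?x) \<otimes> inv g) # r)"
        using AC_equivalent_Cons_conj[of "h \<otimes> ?x" r g] g h x assms by simp
      moreover have "g \<otimes> (h \<otimes> ?x) \<otimes> inv g = g \<otimes> h \<otimes> inv g \<otimes> x"
        using g h x by (simp add: m_assoc)
      ultimately show ?thesis by (metis AC_equivalent_trans)
    qed
    then show ?thesis using g h by auto
  qed
  ultimately have "?N \<lhd> G" by (simp add: normal_inv_iff)
  moreover have "set r \<subseteq> ?N"
  proof
    fix y assume y: "y \<in> set r"
    then obtain j where j: "j < length r" "y = r ! j" by (metis in_set_conv_nth)
    have "AC_equivalent G (x # r) ((y \<otimes> x) # r)" if "x \<in> carrier G" for x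
      using AC_move.mult_left[of "x # r" G 0 "Suc j"] that assms(2) j by (auto intro: AC_equivalent_move)
    then show "y \<in> ?N" using y assms(2) by auto
  qed
  ultimately have "normal_closure G (set r) \<subseteq> ?N" by (rule normal_closure_least)
  then show ?thesis using assms by auto
qed

lemma AC_equivalent_perm: "\<lbrakk>mset r = mset s; set r \<subseteq> carrier G\<rbrakk> \<Longrightarrow> AC_equivalent G r s"
  by (rule AC_equivalent_move, rule AC_move.permute) auto

lemma AC_mset_imp_AC_equivalent:
  assumes "AC_mset G M N" "set_mset M \<subseteq> carrier G" "mset r = M" "mset s = N"
  shows "AC_equivalent G r s"
  using assms
proof (induction arbitrary: r s rule: AC_mset.induct)
  case (AC_mset_refl M)
  then show ?case using AC_equivalent_perm[of r s] set_mset_mset[of r] by simp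
next
  case (AC_mset_sym M N)
  then show ?case using AC_mset_carrier AC_equivalent_sym by blast
next
  case (AC_mset_trans L M N)
  obtain t where "mset t = M" using ex_mset by blast
  then show ?case using AC_mset_trans AC_mset_carrier AC_equivalent_trans by blast
next
  case (AC_mset_invert x M)
  obtain t where t: "mset t = M" using ex_mset by blast
  have tc: "set t \<subseteq> carrier G" using AC_mset_invert t set_mset_mset[of t] by simp
  have "AC_equivalent G r (x # t)" using AC_mset_invert t tc set_mset_mset[of r] by (intro AC_equivalent_perm) auto
  moreover have "AC_equivalent G (x # t) (inv x # t)"
    using AC_move.invert[of "x # t" G 0] AC_mset_invert tc by (auto intro: AC_equivalent_move)
  moreover have "AC_equivalent G (inv x # t) s" using AC_mset_invert t tc by (intro AC_equivalent_perm) auto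
  ultimately show ?case by (metis AC_equivalent_trans)
next
  case (AC_mset_multiply x w M)
  obtain t where t: "mset t = M" using ex_mset by blast
  have tc: "set t \<subseteq> carrier G" and st: "set t = set_mset M" using AC_mset_multiply t set_mset_mset[of t] by simp_all
  have w: "w \<in> carrier G" using AC_mset_multiply normal_closure_subset by auto
  have "AC_equivalent G r (x # t)" using AC_mset_multiply t tc set_mset_mset[of r] by (intro AC_equivalent_perm) auto
  moreover have "AC_equivalent G (x # t) ((w \<otimes> x) # t)"
    using AC_mset_multiply tc st by (intro AC_equivalent_Cons_closure) auto
  moreover have "AC_equivalent G ((w \<otimes> x) # t) s" using AC_mset_multiply t tc w by (intro AC_equivalent_perm) auto
  ultimately show ?case by (metis AC_equivalent_trans)
qed

end

section \<open>Chains of relators and solid half chains\<close>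

text \<open>A chain has the relators with indices \<open>1, \<dots>, n\<close> and is used with \<open>p 0 = 0 = p (n + 1)\<close>, so that
  the two outer relators lose a factor and \<open>c 0\<close>, \<open>c (n + 1)\<close> are dummies.\<close>

definition chain_rel ::
    "('b, 'c) monoid_scheme \<Rightarrow> (nat \<Rightarrow> int) \<Rightarrow> (nat \<Rightarrow> int) \<Rightarrow> (nat \<Rightarrow> 'b) \<Rightarrow> nat \<Rightarrow> 'b" where
  "chain_rel K p q c j = c (j - 1) [^]\<^bsub>K\<^esub> p (j - 1) \<otimes>\<^bsub>K\<^esub> c j [^]\<^bsub>K\<^esub> q j \<otimes>\<^bsub>K\<^esub> c (j + 1) [^]\<^bsub>K\<^esub> p (j + 1)"

text \<open>The pair \<open>(z, y)\<close> is the peripheral pair of the first \<open>i\<close> generators: relator \<open>i\<close> is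
  \<open>y \<cdot> c (i + 1)^p (i + 1)\<close>, and relator \<open>i + 1\<close> starts with \<open>z\<close>. No other relator mentions both
  these generators and the later ones.\<close>

definition half_chain ::
    "('b, 'c) monoid_scheme \<Rightarrow> (nat \<Rightarrow> int) \<Rightarrow> (nat \<Rightarrow> int) \<Rightarrow> nat \<Rightarrow> (nat \<Rightarrow> 'b) \<Rightarrow> 'b \<Rightarrow> 'b \<Rightarrow> bool" where
  "half_chain K p q i c z y \<longleftrightarrow> range c \<subseteq> carrier K \<and> (\<forall>j. 1 \<le> j \<longrightarrow> j < i \<longrightarrow> chain_rel K p q c j = \<one>\<^bsub>K\<^esub>) \<and>
    z = c i [^]\<^bsub>K\<^esub> p i \<and> y = c (i - 1) [^]\<^bsub>K\<^esub> p (i - 1) \<otimes>\<^bsub>K\<^esub> c i [^]\<^bsub>K\<^esub> q i"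

text \<open>Reading a chain from its right end. The words get reversed as well, hence generator \<open>j\<close> of the
  flipped chain is the inverse of generator \<open>n + 1 - j\<close>.\<close>

definition flip :: "nat \<Rightarrow> (nat \<Rightarrow> 'z) \<Rightarrow> nat \<Rightarrow> 'z" where
  "flip n f j = f (n + 1 - j)"

text \<open>The exponents of \<open>z = b^\<alpha>\<close> and \<open>y = b^\<beta>\<close> in a half chain that collapses onto a cyclic group
  \<open>\<langle>b\<rangle>\<close>. The next relator is \<open>b^\<beta> \<cdot> c^p\<close> with the new generator \<open>c\<close>. If \<open>\<beta> = \<plusminus>1\<close> it eliminates \<open>b\<close>, and
  \<open>c\<close> becomes the new core; topologically, a solid torus is filled in without a new exceptional
  fibre. If \<open>p = \<plusminus>1\<close> it eliminates \<open>c\<close>; the new piece is then a regular fibration.\<close>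

inductive solid :: "(nat \<Rightarrow> int) \<Rightarrow> (nat \<Rightarrow> int) \<Rightarrow> nat \<Rightarrow> int \<Rightarrow> int \<Rightarrow> bool" for p q where
  solid_1: "solid p q 1 (p 1) (q 1)"
| solid_fill: "\<lbrakk>solid p q i \<alpha> \<beta>; \<bar>\<beta>\<bar> = 1\<rbrakk>
    \<Longrightarrow> solid p q (Suc i) (p (Suc i)) (q (Suc i) - \<beta> * p (Suc i) * \<alpha>)"
| solid_regular: "\<lbrakk>solid p q i \<alpha> \<beta>; \<bar>p (Suc i)\<bar> = 1\<rbrakk>
    \<Longrightarrow> solid p q (Suc i) (- \<beta>) (\<alpha> - \<beta> * q (Suc i) * p (Suc i))"

lemma solid_pos: "solid p q i \<alpha> \<beta> \<Longrightarrow> 1 \<le> i"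
  by (induction rule: solid.induct) auto

lemma abs_eq_1_square: "\<bar>x :: int\<bar> = 1 \<Longrightarrow> x * x = 1"
  by (auto simp: abs_if split: if_splits)

lemma coprime_minus_mult:
  fixes a b t :: int
  assumes "coprime a b"
  shows "coprime a (b - t * a)"
  using assms by (metis coprime_iff_gcd_eq_1 diff_conv_add_uminus gcd_add_mult mult_minus_left add.commute)

lemma solid_coprime:
  assumes "solid p q i \<alpha> \<beta>" "\<And>j. \<lbrakk>1 \<le> j; j \<le> i\<rbrakk> \<Longrightarrow> coprime (p j) (q j)"
  shows "coprime \<alpha> \<beta>"
  using assms
proof (induction rule: solid.induct)
  case (solid_fill i \<alpha> \<beta>)
  then have "coprime (p (Suc i)) (q (Suc i))" by simp
  then show ?case using coprime_minus_mult[of "p (Suc i)" "q (Suc i)" "\<beta> * \<alpha>"] by (simp add: mult_ac)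
next
  case (solid_regular i \<alpha> \<beta>)
  then have "coprime \<beta> \<alpha>" by (simp add: coprime_commute)
  then show ?case using coprime_minus_mult[of \<beta> \<alpha> "q (Suc i) * p (Suc i)"] by (simp add: mult_ac)
qed auto

lemma half_chain_map:
  assumes "group_hom K L \<phi>" "half_chain K p q i c z y"
  shows "half_chain L p q i (\<phi> \<circ> c) (\<phi> z) (\<phi> y)"
proof -
  interpret group_hom K L \<phi> by fact
  have c: "c j \<in> carrier K" for j using assms(2) by (auto simp: half_chain_def)
  have "chain_rel L p q (\<phi> \<circ> c) j = \<phi> (chain_rel K p q c j)" for j
    using c by (simp add: chain_rel_def hom_int_pow)
  then show ?thesis using assms(2) c by (auto simp: half_chain_def hom_int_pow)
qed

context group begin

lemma half_chain_extend:
  assumes h: "half_chain G p q i c z y" and d: "d \<in> carrier G" and eq: "y \<otimes> d [^] p (Suc i) = \<one>" and i: "1 \<le> i"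
  shows "half_chain G p q (Suc i) (\<lambda>j. if j \<le> i then c j else d) (d [^] p (Suc i)) (z \<otimes> d [^] q (Suc i))"
proof -
  let ?c = "\<lambda>j. if j \<le> i then c j else d"
  have "chain_rel G p q ?c j = \<one>" if "1 \<le> j" "j < Suc i" for j
  proof (cases "j = i")
    case True
    then show ?thesis using h eq i by (auto simp: half_chain_def chain_rel_def)
  next
    case False
    then have "j < i" using that by simp
    then have "chain_rel G p q ?c j = chain_rel G p q c j" by (simp add: chain_rel_def less_imp_diff_less less_imp_le)
    then show ?thesis using h that False by (auto simp: half_chain_def)
  qed
  then show ?thesis using h d i by (auto simp: half_chain_def)
qed

lemma chain_rel_of_flipped:
  assumes "range c \<subseteq> carrier G" "1 \<le> j" "j \<le> n"
  shows "chain_rel G p q (\<lambda>j. inv (flip n c j)) j = inv (chain_rel G (flip n p) (flip n q) c (n + 1 - j))"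
proof -
  have c: "c j \<in> carrier G" for j using assms by auto
  have "n + 1 - (j - 1) = n + 1 - j + 1" "n + 1 - (j + 1) = n + 1 - j - 1" using assms by auto
  moreover have "n + 1 - (n + 1 - j) = j" "n + 1 - (n + 1 - j + 1) = j - 1" "n + 1 - (n + 1 - j - 1) = j + 1"
    using assms by auto
  ultimately show ?thesis using c by (simp add: chain_rel_def flip_def inv_mult_group int_pow_inv m_assoc)
qed

text \<open>Relators \<open>i\<close> and \<open>i + 1\<close> of the glued chain are \<open>y \<cdot> inv y\<close> and \<open>z \<cdot> inv z\<close>. The two halves have to
  exchange \<open>z\<close> and \<open>y\<close>: the fibre of one piece is a section of the neighbouring one.\<close>

lemma half_chains_glue:
  assumes l: "half_chain G p q i c z y" and r: "half_chain G (flip n p) (flip n q) (n - i) c' y z"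
    and i: "1 \<le> i" "i < n"
  obtains d where "range d \<subseteq> carrier G" "\<And>j. \<lbrakk>1 \<le> j; j \<le> n\<rbrakk> \<Longrightarrow> chain_rel G p q d j = \<one>"
    "\<And>j. j \<le> i \<Longrightarrow> d j = c j"
proof
  let ?d = "\<lambda>j. if j \<le> i then c j else inv (flip n c' j)"
  have c: "c j \<in> carrier G" and c': "c' j \<in> carrier G" for j using l r by (auto simp: half_chain_def)
  show "range ?d \<subseteq> carrier G" using c c' by (auto simp: flip_def)
  show "?d j = c j" if "j \<le> i" for j using that by simp
  have zy: "z \<in> carrier G" "y \<in> carrier G" using l c by (auto simp: half_chain_def)
  have z: "z = c i [^] p i" and y: "y = c (i - 1) [^] p (i - 1) \<otimes> c i [^] q i"
    using l by (auto simp: half_chain_def)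
  have y': "y = c' (n - i) [^] p (i + 1)" and z': "z = c' (n - i - 1) [^] p (i + 2) \<otimes> c' (n - i) [^] q (i + 1)"
    using r i by (auto simp: half_chain_def flip_def Suc_diff_Suc Suc_diff_le numeral_2_eq_2)
  show "chain_rel G p q ?d j = \<one>" if j: "1 \<le> j" "j \<le> n" for j
  proof -
    consider "j < i" | "j = i" | "j = i + 1" | "j > i + 1" by linarith
    then show ?thesis
    proof cases
      case 1
      then have "chain_rel G p q ?d j = chain_rel G p q c j" by (simp add: chain_rel_def less_imp_diff_less less_imp_le)
      then show ?thesis using l j 1 by (auto simp: half_chain_def)
    next
      case 2
      then have "chain_rel G p q ?d j = y \<otimes> inv (c' (n - i)) [^] p (i + 1)"
        using i by (simp add: chain_rel_def flip_def y)
      also have "\<dots> = y \<otimes> inv y" using c' by (simp add: y' int_pow_inv)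
      finally show ?thesis using zy by simp
    next
      case 3
      then have "chain_rel G p q ?d j = z \<otimes> (inv (c' (n - i)) [^] q (i + 1) \<otimes> inv (c' (n - i - 1)) [^] p (i + 2))"
        using i c c' zy by (simp add: chain_rel_def flip_def z m_assoc)
      also have "\<dots> = z \<otimes> inv z" using c' by (simp add: z' int_pow_inv inv_mult_group)
      finally show ?thesis using zy by simp
    next
      case 4
      then have "\<not> j - 1 \<le> i" "\<not> j \<le> i" "\<not> j + 1 \<le> i" by auto
      then have "chain_rel G p q ?d j = chain_rel G p q (\<lambda>j. inv (flip n c' j)) j"
        unfolding chain_rel_def by (simp only: if_False)
      also have "\<dots> = inv (chain_rel G (flip n p) (flip n q) c' (n + 1 - j))"
        using j c' by (intro chain_rel_of_flipped) auto
      also have "\<dots> = \<one>" using r 4 j by (simp add: half_chain_def)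
      finally show ?thesis .
    qed
  qed
qed

text \<open>The collapse onto \<open>\<langle>b\<rangle>\<close> can be undone in every group and for every \<open>b\<close>. This produces the
  representations that contradict triviality.\<close>

lemma solid_half_chain:
  assumes "solid p q i \<alpha> \<beta>" "b \<in> carrier G" "p 0 = 0"
  shows "\<exists>c. half_chain G p q i c (b [^] \<alpha>) (b [^] \<beta>)"
  using assms
proof (induction arbitrary: b rule: solid.induct)
  case solid_1
  then show ?case by (intro exI[of _ "\<lambda>_. b"]) (auto simp: half_chain_def)
next
  case (solid_fill i \<alpha> \<beta>)
  let ?p = "p (Suc i)" let ?q = "q (Suc i)" let ?b = "b [^] (- \<beta> * ?p)"
  obtain c where c: "half_chain G p q i c (?b [^] \<alpha>) (?b [^] \<beta>)"
    using solid_fill.IH[of ?b] solid_fill.prems by auto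
  have eq: "?b [^] \<beta> \<otimes> b [^] ?p = \<one>"
  proof -
    have "- \<beta> * ?p * \<beta> + ?p = 0" using abs_eq_1_square[OF solid_fill.hyps(2)] by (simp add: mult.commute mult.left_commute)
    then show ?thesis using solid_fill.prems by (simp only: int_pow_pow int_pow_mult[symmetric] int_pow_0)
  qed
  have "?b [^] \<alpha> \<otimes> b [^] ?q = b [^] (?q - \<beta> * ?p * \<alpha>)"
    using solid_fill.prems by (simp add: int_pow_pow int_pow_mult[symmetric] algebra_simps)
  then show ?case
    using half_chain_extend[OF c solid_fill.prems(1) eq] solid_pos[OF solid_fill.hyps(1)] by auto
next
  case (solid_regular i \<alpha> \<beta>)
  let ?p = "p (Suc i)" let ?q = "q (Suc i)" let ?d = "b [^] (- \<beta> * ?p)"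
  obtain c where c: "half_chain G p q i c (b [^] \<alpha>) (b [^] \<beta>)"
    using solid_regular.IH[of b] solid_regular.prems by auto
  have z: "?d [^] ?p = b [^] (- \<beta>)"
    using solid_regular.prems abs_eq_1_square[OF solid_regular.hyps(2)]
    by (simp add: int_pow_pow mult.assoc)
  have eq: "b [^] \<beta> \<otimes> ?d [^] ?p = \<one>"
    using solid_regular.prems unfolding z by (simp add: int_pow_mult[symmetric])
  have "b [^] \<alpha> \<otimes> ?d [^] ?q = b [^] (\<alpha> - \<beta> * ?q * ?p)"
    using solid_regular.prems by (simp add: int_pow_pow int_pow_mult[symmetric] algebra_simps)
  then show ?case
    using half_chain_extend[OF c _ eq] solid_regular.prems(1) solid_pos[OF solid_regular.hyps(1)] z by auto
qed

lemma solve_sign_power: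
  fixes e :: int
  assumes "x \<in> carrier G" "d \<in> carrier G" "\<bar>e\<bar> = 1" "x \<otimes> d [^] e = \<one>"
  shows "d = x [^] (- e)"
proof -
  have "d [^] e = inv x" using assms by (metis int_pow_closed inv_equality inv_comm)
  then have "(d [^] e) [^] e = x [^] (- e)" using assms(1) by (simp add: int_pow_inv int_pow_neg)
  then show ?thesis using assms abs_eq_1_square[of e] by (simp add: int_pow_pow)
qed

lemma AC_mset_sign_power:
  fixes e :: int
  assumes "\<bar>e\<bar> = 1" "x \<in> carrier G" "set_mset M \<subseteq> carrier G"
  shows "AC_mset G (add_mset (x [^] e) M) (add_mset x M)"
proof -
  have "e = 1 \<or> e = -1" using assms(1) by auto
  then show ?thesis
    using AC_mset.AC_mset_invert[of x G M] assms AC_mset_refl AC_mset_sym by (auto simp: int_pow_neg)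
qed

lemma chain_rel_closed:
  assumes "range c \<subseteq> carrier G"
  shows "chain_rel G p q c j \<in> carrier G"
proof -
  have "c j \<in> carrier G" for j using assms by auto
  then show ?thesis by (simp add: chain_rel_def)
qed

end

definition rel_mset ::
    "('b, 'c) monoid_scheme \<Rightarrow> (nat \<Rightarrow> int) \<Rightarrow> (nat \<Rightarrow> int) \<Rightarrow> (nat \<Rightarrow> 'b) \<Rightarrow> nat \<Rightarrow> nat \<Rightarrow> 'b multiset" where
  "rel_mset F p q c i j = image_mset (chain_rel F p q c) (mset_set {i..<j})"

text \<open>What a solid half chain means for Andrews-Curtis moves: its relators together with the core
  \<open>b\<close> can be turned into its generators, and the relators force \<open>z = b^\<alpha>\<close> and \<open>y = b^\<beta>\<close>. The groups
  \<open>K\<close> range over the type that contains all quotients of \<open>F\<close>, as in \<open>AC_mset_replace\<close>.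

  The conclusion about \<open>K\<close> has a bound variable \<open>\<phi>\<close> as its head symbol. Used as a rewrite rule it
  would match every term, so the definition is only accessed through the next two lemmas.\<close>

definition is_core ::
    "('b, 'c) monoid_scheme \<Rightarrow> (nat \<Rightarrow> int) \<Rightarrow> (nat \<Rightarrow> int) \<Rightarrow> (nat \<Rightarrow> 'b) \<Rightarrow> nat \<Rightarrow> int \<Rightarrow> int \<Rightarrow> 'b \<Rightarrow> bool" where
  "is_core F p q c i \<alpha> \<beta> b \<longleftrightarrow> b \<in> carrier F \<and>
    AC_mset F (add_mset b (rel_mset F p q c 1 i)) (image_mset c (mset_set {1..<Suc i})) \<and>
    (\<forall>(K :: 'b set monoid) \<phi>. group_hom F K \<phi> \<longrightarrow> (\<forall>j. 1 \<le> j \<longrightarrow> j < i \<longrightarrow> \<phi> (chain_rel F p q c j) = \<one>\<^bsub>K\<^esub>) \<longrightarrow>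
      \<phi> (c i [^]\<^bsub>F\<^esub> p i) = \<phi> b [^]\<^bsub>K\<^esub> \<alpha> \<and>
      \<phi> (c (i - 1) [^]\<^bsub>F\<^esub> p (i - 1) \<otimes>\<^bsub>F\<^esub> c i [^]\<^bsub>F\<^esub> q i) = \<phi> b [^]\<^bsub>K\<^esub> \<beta>)"

lemma is_coreI:
  assumes "b \<in> carrier F"
    and "AC_mset F (add_mset b (rel_mset F p q c 1 i)) (image_mset c (mset_set {1..<Suc i}))"
    and "\<And>(K :: 'b set monoid) \<phi>. \<lbrakk>group_hom F K \<phi>; \<And>j. 1 \<le> j \<Longrightarrow> j < i \<Longrightarrow> \<phi> (chain_rel F p q c j) = \<one>\<^bsub>K\<^esub>\<rbrakk> \<Longrightarrow>
      \<phi> (c i [^]\<^bsub>F\<^esub> p i) = \<phi> b [^]\<^bsub>K\<^esub> \<alpha> \<and>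
      \<phi> (c (i - 1) [^]\<^bsub>F\<^esub> p (i - 1) \<otimes>\<^bsub>F\<^esub> c i [^]\<^bsub>F\<^esub> q i) = \<phi> b [^]\<^bsub>K\<^esub> \<beta>"
  shows "is_core F p q c i \<alpha> \<beta> (b :: 'b)"
  unfolding is_core_def
  by (intro conjI allI impI; (rule assms(1) | rule assms(2) | rule assms(3)[THEN conjunct1] | rule assms(3)[THEN conjunct2]); simp)

lemma is_coreD:
  fixes b :: 'b
  assumes "is_core F p q c i \<alpha> \<beta> b"
  shows "b \<in> carrier F"
    and "AC_mset F (add_mset b (rel_mset F p q c 1 i)) (image_mset c (mset_set {1..<Suc i}))"
    and "\<And>(K :: 'b set monoid) \<phi>. \<lbrakk>group_hom F K \<phi>; \<And>j. 1 \<le> j \<Longrightarrow> j < i \<Longrightarrow> \<phi> (chain_rel F p q c j) = \<one>\<^bsub>K\<^esub>\<rbrakk> \<Longrightarrow>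
      \<phi> (c i [^]\<^bsub>F\<^esub> p i) = \<phi> b [^]\<^bsub>K\<^esub> \<alpha> \<and>
      \<phi> (c (i - 1) [^]\<^bsub>F\<^esub> p (i - 1) \<otimes>\<^bsub>F\<^esub> c i [^]\<^bsub>F\<^esub> q i) = \<phi> b [^]\<^bsub>K\<^esub> \<beta>"
proof -
  note * = assms[unfolded is_core_def]
  show "b \<in> carrier F" by (rule *[THEN conjunct1])
  show "AC_mset F (add_mset b (rel_mset F p q c 1 i)) (image_mset c (mset_set {1..<Suc i}))"
    by (rule *[THEN conjunct2, THEN conjunct1])
  fix K :: "'b set monoid" and \<phi>
  assume a: "group_hom F K \<phi>" "\<And>j. 1 \<le> j \<Longrightarrow> j < i \<Longrightarrow> \<phi> (chain_rel F p q c j) = \<one>\<^bsub>K\<^esub>"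
  show "\<phi> (c i [^]\<^bsub>F\<^esub> p i) = \<phi> b [^]\<^bsub>K\<^esub> \<alpha> \<and>
      \<phi> (c (i - 1) [^]\<^bsub>F\<^esub> p (i - 1) \<otimes>\<^bsub>F\<^esub> c i [^]\<^bsub>F\<^esub> q i) = \<phi> b [^]\<^bsub>K\<^esub> \<beta>"
    using a(2) by (intro *[THEN conjunct2, THEN conjunct2, rule_format, OF a(1)]) simp
qed

context group begin

declare AC_mset_trans [trans]

lemma rel_mset_Suc:
  "i \<le> j \<Longrightarrow> rel_mset G p q c i (Suc j) = add_mset (chain_rel G p q c j) (rel_mset G p q c i j)"
  by (simp add: rel_mset_def atLeastLessThanSuc)

lemma rel_mset_closed: "range c \<subseteq> carrier G \<Longrightarrow> set_mset (rel_mset G p q c i j) \<subseteq> carrier G"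
  by (auto simp: rel_mset_def chain_rel_closed)

text \<open>With \<open>c (i + 1)\<close> among the relators, relator \<open>i\<close> becomes \<open>y\<close>, then \<open>b^\<beta>\<close>, then \<open>b\<close>; the previous
  core is thereby recovered.\<close>

lemma is_core_fill:
  assumes core: "is_core G p q c i \<alpha> \<beta> b" and c: "range c \<subseteq> carrier G" and i: "1 \<le> i" and \<beta>: "\<bar>\<beta>\<bar> = 1"
  shows "is_core G p q c (Suc i) (p (Suc i)) (q (Suc i) - \<beta> * p (Suc i) * \<alpha>) (c (Suc i))"
proof -
  let ?p = "p (Suc i)" let ?q = "q (Suc i)"
  let ?M = "rel_mset G p q c 1 i" let ?d = "c (Suc i)" let ?S = "chain_rel G p q c i"
  let ?y = "c (i - 1) [^] p (i - 1) \<otimes> c i [^] q i" let ?z = "c i [^] p i"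
  have c': "c j \<in> carrier G" for j using c by auto
  have y: "?y \<in> carrier G" using c' by simp
  note b = is_coreD(1)[OF core]
  have M: "set_mset ?M \<subseteq> carrier G" using c by (rule rel_mset_closed)
  have Sc: "?S \<in> carrier G" using c by (rule chain_rel_closed)
  have S: "?S = ?y \<otimes> ?d [^] ?p" by (simp add: chain_rel_def)
  have B: "\<phi> ?z = \<phi> b [^]\<^bsub>K\<^esub> \<alpha> \<and> \<phi> ?y = \<phi> b [^]\<^bsub>K\<^esub> \<beta>"
    if "group_hom G K \<phi>" "\<And>j. 1 \<le> j \<Longrightarrow> j < i \<Longrightarrow> \<phi> (chain_rel G p q c j) = \<one>\<^bsub>K\<^esub>"
    for K :: "'a set monoid" and \<phi>
    using is_coreD(3)[OF core that] .
  have "AC_mset G (add_mset ?S (add_mset ?d ?M)) (add_mset ?y (add_mset ?d ?M))"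
  proof (rule AC_mset_replace)
    fix K :: "'a set monoid" and \<phi>
    assume h: "group_hom G K \<phi>" and k: "\<And>r. r \<in># add_mset ?d ?M \<Longrightarrow> \<phi> r = \<one>\<^bsub>K\<^esub>"
    interpret h: group_hom G K \<phi> by fact
    show "\<phi> ?S = \<phi> ?y"
      unfolding S using k[of ?d] c' y by (simp add: h.hom_int_pow)
  qed (use c' y M Sc in auto)
  also have "AC_mset G (add_mset ?y (add_mset ?d ?M)) (add_mset (b [^] \<beta>) (add_mset ?d ?M))"
  proof (rule AC_mset_replace)
    fix K :: "'a set monoid" and \<phi>
    assume h: "group_hom G K \<phi>" and k: "\<And>r. r \<in># add_mset ?d ?M \<Longrightarrow> \<phi> r = \<one>\<^bsub>K\<^esub>"
    interpret h: group_hom G K \<phi> by fact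
    show "\<phi> ?y = \<phi> (b [^] \<beta>)"
      using B[OF h] k b by (simp add: h.hom_int_pow rel_mset_def)
  qed (use c' y M b in auto)
  also have "AC_mset G (add_mset (b [^] \<beta>) (add_mset ?d ?M)) (add_mset b (add_mset ?d ?M))"
    using b c' M \<beta> by (intro AC_mset_sign_power) auto
  also have "AC_mset G (add_mset b (add_mset ?d ?M)) (add_mset ?d (image_mset c (mset_set {1..<Suc i})))"
    unfolding add_mset_commute[of b ?d]
    by (rule AC_mset_add_mset[OF is_coreD(2)[OF core] c'])
  finally have A: "AC_mset G (add_mset ?d (rel_mset G p q c 1 (Suc i))) (image_mset c (mset_set {1..<Suc (Suc i)}))"
    using i by (simp add: rel_mset_Suc add_mset_commute atLeastLessThanSuc)
  have hom: "\<phi> (?d [^] ?p) = \<phi> ?d [^]\<^bsub>K\<^esub> ?p \<and> \<phi> (?z \<otimes> ?d [^] ?q) = \<phi> ?d [^]\<^bsub>K\<^esub> (?q - \<beta> * ?p * \<alpha>)"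
    if h: "group_hom G K \<phi>" and k: "\<And>j. 1 \<le> j \<Longrightarrow> j < Suc i \<Longrightarrow> \<phi> (chain_rel G p q c j) = \<one>\<^bsub>K\<^esub>"
    for K :: "'a set monoid" and \<phi>
  proof -
    interpret h: group_hom G K \<phi> by fact
    have *: "\<phi> ?z = \<phi> b [^]\<^bsub>K\<^esub> \<alpha>" "\<phi> ?y = \<phi> b [^]\<^bsub>K\<^esub> \<beta>" using B[OF h] k by auto
    have "\<phi> b [^]\<^bsub>K\<^esub> \<beta> \<otimes>\<^bsub>K\<^esub> \<phi> ?d [^]\<^bsub>K\<^esub> ?p = \<one>\<^bsub>K\<^esub>"
    proof -
      have "\<phi> ?S = \<phi> ?y \<otimes>\<^bsub>K\<^esub> \<phi> ?d [^]\<^bsub>K\<^esub> ?p"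
        unfolding S using c' y by (simp only: h.hom_mult h.hom_int_pow int_pow_closed)
      then show ?thesis using k[of i] i *(2) by simp
    qed
    then have "\<phi> ?d [^]\<^bsub>K\<^esub> ?p \<otimes>\<^bsub>K\<^esub> \<phi> b [^]\<^bsub>K\<^esub> \<beta> = \<one>\<^bsub>K\<^esub>"
      using b c' h.H.inv_comm by simp
    then have "\<phi> b = (\<phi> ?d [^]\<^bsub>K\<^esub> ?p) [^]\<^bsub>K\<^esub> (- \<beta>)"
      using b c' \<beta> h.H.solve_sign_power by simp
    then have "\<phi> ?z = \<phi> ?d [^]\<^bsub>K\<^esub> (- \<beta> * ?p * \<alpha>)"
      using c' by (simp add: *(1) h.H.int_pow_pow mult_ac)
    then show ?thesis
      using c' by (simp add: h.hom_int_pow h.H.int_pow_mult[symmetric])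
  qed
  show ?thesis
  proof (rule is_coreI[OF _ A])
    fix K :: "'a set monoid" and \<phi>
    assume "group_hom G K \<phi>" "\<And>j. 1 \<le> j \<Longrightarrow> j < Suc i \<Longrightarrow> \<phi> (chain_rel G p q c j) = \<one>\<^bsub>K\<^esub>"
    from hom[OF this] show "\<phi> (?d [^] ?p) = \<phi> ?d [^]\<^bsub>K\<^esub> ?p \<and>
      \<phi> (c (Suc i - 1) [^] p (Suc i - 1) \<otimes> ?d [^] ?q) = \<phi> ?d [^]\<^bsub>K\<^esub> (?q - \<beta> * ?p * \<alpha>)"
      by (simp only: diff_Suc_1)
  qed (fact c')
qed

text \<open>With \<open>b\<close> among the relators, \<open>y\<close> is trivial and relator \<open>i\<close> becomes \<open>c (i + 1)^p (i + 1)\<close>.\<close>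

lemma is_core_regular:
  assumes core: "is_core G p q c i \<alpha> \<beta> b" and c: "range c \<subseteq> carrier G" and i: "1 \<le> i" and p: "\<bar>p (Suc i)\<bar> = 1"
  shows "is_core G p q c (Suc i) (- \<beta>) (\<alpha> - \<beta> * q (Suc i) * p (Suc i)) b"
proof -
  let ?p = "p (Suc i)" let ?q = "q (Suc i)"
  let ?M = "rel_mset G p q c 1 i" let ?d = "c (Suc i)" let ?S = "chain_rel G p q c i"
  let ?y = "c (i - 1) [^] p (i - 1) \<otimes> c i [^] q i" let ?z = "c i [^] p i"
  have c': "c j \<in> carrier G" for j using c by auto
  have y: "?y \<in> carrier G" using c' by simp
  note b = is_coreD(1)[OF core]
  have M: "set_mset ?M \<subseteq> carrier G" using c by (rule rel_mset_closed)
  have Sc: "?S \<in> carrier G" using c by (rule chain_rel_closed)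
  have S: "?S = ?y \<otimes> ?d [^] ?p" by (simp add: chain_rel_def)
  have B: "\<phi> ?z = \<phi> b [^]\<^bsub>K\<^esub> \<alpha> \<and> \<phi> ?y = \<phi> b [^]\<^bsub>K\<^esub> \<beta>"
    if "group_hom G K \<phi>" "\<And>j. 1 \<le> j \<Longrightarrow> j < i \<Longrightarrow> \<phi> (chain_rel G p q c j) = \<one>\<^bsub>K\<^esub>"
    for K :: "'a set monoid" and \<phi>
    using is_coreD(3)[OF core that] .
  have "AC_mset G (add_mset ?S (add_mset b ?M)) (add_mset (?d [^] ?p) (add_mset b ?M))"
  proof (rule AC_mset_replace)
    fix K :: "'a set monoid" and \<phi>
    assume h: "group_hom G K \<phi>" and k: "\<And>r. r \<in># add_mset b ?M \<Longrightarrow> \<phi> r = \<one>\<^bsub>K\<^esub>"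
    interpret h: group_hom G K \<phi> by fact
    have "\<phi> ?y = \<one>\<^bsub>K\<^esub>" using B[OF h] k by (simp add: rel_mset_def)
    then show "\<phi> ?S = \<phi> (?d [^] ?p)"
      unfolding S using c' y by simp
  qed (use c' b M Sc in auto)
  also have "AC_mset G (add_mset (?d [^] ?p) (add_mset b ?M)) (add_mset ?d (add_mset b ?M))"
    using b c' M p by (intro AC_mset_sign_power) auto
  also have "AC_mset G (add_mset ?d (add_mset b ?M)) (add_mset ?d (image_mset c (mset_set {1..<Suc i})))"
    by (rule AC_mset_add_mset[OF is_coreD(2)[OF core] c'])
  finally have A: "AC_mset G (add_mset b (rel_mset G p q c 1 (Suc i))) (image_mset c (mset_set {1..<Suc (Suc i)}))"
    using i by (simp add: rel_mset_Suc add_mset_commute atLeastLessThanSuc)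
  have hom: "\<phi> (?d [^] ?p) = \<phi> b [^]\<^bsub>K\<^esub> (- \<beta>) \<and> \<phi> (?z \<otimes> ?d [^] ?q) = \<phi> b [^]\<^bsub>K\<^esub> (\<alpha> - \<beta> * ?q * ?p)"
    if h: "group_hom G K \<phi>" and k: "\<And>j. 1 \<le> j \<Longrightarrow> j < Suc i \<Longrightarrow> \<phi> (chain_rel G p q c j) = \<one>\<^bsub>K\<^esub>"
    for K :: "'a set monoid" and \<phi>
  proof -
    interpret h: group_hom G K \<phi> by fact
    have *: "\<phi> ?z = \<phi> b [^]\<^bsub>K\<^esub> \<alpha>" "\<phi> ?y = \<phi> b [^]\<^bsub>K\<^esub> \<beta>" using B[OF h] k by auto
    have "\<phi> b [^]\<^bsub>K\<^esub> \<beta> \<otimes>\<^bsub>K\<^esub> \<phi> ?d [^]\<^bsub>K\<^esub> ?p = \<one>\<^bsub>K\<^esub>"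
    proof -
      have "\<phi> ?S = \<phi> ?y \<otimes>\<^bsub>K\<^esub> \<phi> ?d [^]\<^bsub>K\<^esub> ?p"
        unfolding S using c' y by (simp only: h.hom_mult h.hom_int_pow int_pow_closed)
      then show ?thesis using k[of i] i *(2) by simp
    qed
    then have d: "\<phi> ?d = (\<phi> b [^]\<^bsub>K\<^esub> \<beta>) [^]\<^bsub>K\<^esub> (- ?p)"
      using b c' p h.H.solve_sign_power by simp
    have e: "\<beta> * (- ?p) * ?p = - \<beta>" using abs_eq_1_square[OF p] by (simp add: mult.assoc)
    have "\<alpha> + \<beta> * (- ?p) * ?q = \<alpha> - \<beta> * ?q * ?p" by simp
    then show ?thesis
      using b c' *(1) e by (simp add: h.hom_int_pow d h.H.int_pow_pow h.H.int_pow_mult[symmetric] del: mult_minus_left mult_minus_right)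
  qed
  show ?thesis
  proof (rule is_coreI[OF _ A])
    fix K :: "'a set monoid" and \<phi>
    assume "group_hom G K \<phi>" "\<And>j. 1 \<le> j \<Longrightarrow> j < Suc i \<Longrightarrow> \<phi> (chain_rel G p q c j) = \<one>\<^bsub>K\<^esub>"
    from hom[OF this] show "\<phi> (?d [^] ?p) = \<phi> b [^]\<^bsub>K\<^esub> (- \<beta>) \<and>
      \<phi> (c (Suc i - 1) [^] p (Suc i - 1) \<otimes> ?d [^] ?q) = \<phi> b [^]\<^bsub>K\<^esub> (\<alpha> - \<beta> * ?q * ?p)"
      by (simp only: diff_Suc_1)
  qed (fact b)
qed

lemma solid_core:
  assumes "solid p q i \<alpha> \<beta>" "range c \<subseteq> carrier G" "p 0 = 0"
  shows "\<exists>b. is_core G p q c i \<alpha> \<beta> b"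
  using assms(1)
proof (induction rule: solid.induct)
  case solid_1
  have c: "c j \<in> carrier G" for j using assms by auto
  have "is_core G p q c 1 (p 1) (q 1) (c 1)"
  proof (rule is_coreI)
    fix K :: "'a set monoid" and \<phi>
    assume "group_hom G K \<phi>"
    then interpret h: group_hom G K \<phi> .
    show "\<phi> (c 1 [^] p 1) = \<phi> (c 1) [^]\<^bsub>K\<^esub> p 1 \<and>
      \<phi> (c (1 - 1) [^] p (1 - 1) \<otimes> c 1 [^] q 1) = \<phi> (c 1) [^]\<^bsub>K\<^esub> q 1"
      using c by (simp add: h.hom_int_pow assms(3))
  qed (use c in \<open>simp_all add: rel_mset_def AC_mset_refl\<close>)
  then show ?case ..
next
  case (solid_fill i \<alpha> \<beta>)
  then show ?case using is_core_fill[OF _ assms(2)] solid_pos by blast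
next
  case (solid_regular i \<alpha> \<beta>)
  then show ?case using is_core_regular[OF _ assms(2)] solid_pos by blast
qed

end

section \<open>Free grid actions by permutations\<close>

definition perm_group :: "('x \<Rightarrow> 'x) monoid" where
  "perm_group = \<lparr>carrier = {f. bij f}, monoid.mult = (\<circ>), one = id\<rparr>"

lemma perm_group_simps [simp]:
  "carrier perm_group = {f. bij f}" "f \<otimes>\<^bsub>perm_group\<^esub> g = f \<circ> g" "\<one>\<^bsub>perm_group\<^esub> = id"
  by (simp_all add: perm_group_def)

lemma group_perm_group: "group perm_group"
proof (rule groupI)
  fix f :: "'x \<Rightarrow> 'x"
  assume "f \<in> carrier perm_group"
  then show "\<exists>g \<in> carrier perm_group. g \<otimes>\<^bsub>perm_group\<^esub> f = \<one>\<^bsub>perm_group\<^esub>"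
    by (intro bexI[of _ "inv_into UNIV f"]) (simp_all add: bij_imp_bij_inv bij_is_inj)
qed (auto simp: bij_comp comp_assoc)

interpretation perm: group "perm_group :: ('x \<Rightarrow> 'x) monoid"
  by (rule group_perm_group)

lemma (in group) commute_inv:
  assumes "x \<in> carrier G" "y \<in> carrier G" "x \<otimes> y = y \<otimes> x"
  shows "inv x \<otimes> y = y \<otimes> inv x"
proof -
  have "inv x \<otimes> y = inv x \<otimes> (y \<otimes> x) \<otimes> inv x" using assms(1,2) by (simp add: m_assoc)
  also have "\<dots> = y \<otimes> inv x" using assms by (simp flip: assms(3) add: m_assoc[symmetric])
  finally show ?thesis .
qed

lemma (in group) commute_int_pow:
  fixes m n :: int
  assumes "x \<in> carrier G" "y \<in> carrier G" "x \<otimes> y = y \<otimes> x"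
  shows "x [^] m \<otimes> y [^] n = y [^] n \<otimes> x [^] m"
proof -
  have 1: "a [^] k \<otimes> b = b \<otimes> a [^] k" if "a \<in> carrier G" "b \<in> carrier G" "a \<otimes> b = b \<otimes> a" for a b and k :: int
  proof (cases k rule: int_cases2)
    case (nonneg n)
    then show ?thesis using group_commutes_pow[of a b n] that by (simp add: int_pow_int)
  next
    case (nonpos n)
    then show ?thesis
      using commute_inv[of "a [^] n" b] group_commutes_pow[of a b n] that by (simp add: int_pow_neg int_pow_int)
  qed
  show ?thesis using 1[of y "x [^] m" n] 1[of x y m] assms by simp
qed

text \<open>Powers of an explicit permutation are read off from a flow that extends it.\<close>

lemma (in group) int_pow_flow:
  fixes t :: "int \<Rightarrow> 'a" and k :: int
  assumes "\<And>i. t i \<in> carrier G" "\<And>i j. t (i + j) = t i \<otimes> t j"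
  shows "t 1 [^] k = t k"
proof -
  have nat: "t 1 [^] n = t (int n)" for n :: nat
  proof (induction n)
    case 0
    have "t 0 \<otimes> t 0 = t 0" using assms(2)[of 0 0] by simp
    then show ?case using assms(1)[of 0] by simp
  next
    case (Suc n)
    then show ?case using assms(2)[of "int n" 1] by (simp add: add.commute)
  qed
  show ?thesis
  proof (cases k rule: int_cases2)
    case (nonneg n)
    then show ?thesis using nat by (simp add: int_pow_int)
  next
    case (nonpos n)
    have "t k \<otimes> t (int n) = \<one>" using assms(2)[of k "int n"] nat[of 0] nonpos by simp
    then have "inv (t (int n)) = t k" using assms(1) by (intro inv_equality) auto
    then show ?thesis using nat assms(1) nonpos by (simp add: int_pow_neg int_pow_int)
  qed
qed

text \<open>Two commuting permutations through which the lattice of rank two acts freely.\<close>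

definition free_pair :: "('x \<Rightarrow> 'x) \<Rightarrow> ('x \<Rightarrow> 'x) \<Rightarrow> bool" where
  "free_pair u v \<longleftrightarrow> bij u \<and> bij v \<and> u \<circ> v = v \<circ> u \<and>
    (\<forall>(m :: int) (n :: int) x. (u [^]\<^bsub>perm_group\<^esub> m) ((v [^]\<^bsub>perm_group\<^esub> n) x) = x \<longrightarrow> m = 0 \<and> n = 0)"

text \<open>The standard free action of the rank two lattice with countably many orbits; the third
  coordinate numbers the orbits.\<close>

type_synonym grid = "int \<times> int \<times> nat"

definition shift_fst :: "grid \<Rightarrow> grid" where "shift_fst = (\<lambda>(a, b, n). (a + 1, b, n))"
definition shift_snd :: "grid \<Rightarrow> grid" where "shift_snd = (\<lambda>(a, b, n). (a, b + 1, n))"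

lemma bij_pow: "bij u \<Longrightarrow> bij (u [^]\<^bsub>perm_group\<^esub> (m :: int))"
  using perm.int_pow_closed[of u m] by simp

text \<open>All free actions look alike once each orbit has been repeated infinitely often. Here \<open>h\<close> moves
  the chosen representative of an orbit by the group element with the given coordinates. The
  orbits, paired with the copies, are countably infinite in number whether or not there were
  infinitely many orbits at first.\<close>

lemma free_pair_coordinates:
  fixes u v :: "'x :: countable \<Rightarrow> 'x"
  assumes free: "free_pair u v"
  obtains h :: "grid \<Rightarrow> 'x \<times> nat" where "bij h"
    "h \<circ> shift_fst = map_prod u id \<circ> h" "h \<circ> shift_snd = map_prod v id \<circ> h"
proof -
  define act where "act m n = u [^]\<^bsub>perm_group\<^esub> (m :: int) \<circ> v [^]\<^bsub>perm_group\<^esub> (n :: int)" for m n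
  have u: "bij u" and v: "bij v" and comm: "u \<circ> v = v \<circ> u" using free by (auto simp: free_pair_def)
  have pow_comm: "u [^]\<^bsub>perm_group\<^esub> m \<circ> v [^]\<^bsub>perm_group\<^esub> n = v [^]\<^bsub>perm_group\<^esub> n \<circ> u [^]\<^bsub>perm_group\<^esub> m" for m n :: int
    using perm.commute_int_pow[of u v m n] u v comm unfolding perm_group_simps by blast
  have act_add: "act m n \<circ> act m' n' = act (m + m') (n + n')" for m n m' n'
  proof -
    have "act m n \<circ> act m' n' = u [^]\<^bsub>perm_group\<^esub> m \<circ> (v [^]\<^bsub>perm_group\<^esub> n \<circ> u [^]\<^bsub>perm_group\<^esub> m') \<circ> v [^]\<^bsub>perm_group\<^esub> n'"
      by (simp add: act_def comp_assoc)
    also have "\<dots> = (u [^]\<^bsub>perm_group\<^esub> m \<circ> u [^]\<^bsub>perm_group\<^esub> m') \<circ> (v [^]\<^bsub>perm_group\<^esub> n \<circ> v [^]\<^bsub>perm_group\<^esub> n')"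
      unfolding pow_comm[symmetric] by (simp add: comp_assoc)
    also have "\<dots> = act (m + m') (n + n')"
      using perm.int_pow_mult[of u m m'] perm.int_pow_mult[of v n n'] u v by (simp add: act_def)
    finally show ?thesis .
  qed
  have act_0: "act 0 0 = id" by (simp add: act_def)
  have act_free: "act m n x = x \<Longrightarrow> m = 0 \<and> n = 0" for m n x
    using free by (auto simp: free_pair_def act_def)
  have act_u: "act 1 0 = u" and act_v: "act 0 1 = v"
    using perm.int_pow_1[of u] perm.int_pow_1[of v] u v by (simp_all add: act_def)
  define R where "R = {(x, y). \<exists>m n. y = act m n x}"
  have act_act: "act m n (act m' n' x) = act (m + m') (n + n') x" for m n m' n' x
    using fun_cong[OF act_add[of m n m' n'], of x] by (simp only: comp_apply)
  have "equiv UNIV R"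
  proof (rule equivI)
    show "refl R" using act_0 by (auto simp: refl_on_def R_def intro!: exI[of _ 0])
    show "sym R"
    proof (rule symI)
      fix x y assume "(x, y) \<in> R"
      then obtain m n where "y = act m n x" by (auto simp: R_def)
      then have "x = act (- m) (- n) y" by (simp add: act_act act_0)
      then show "(y, x) \<in> R" by (auto simp: R_def)
    qed
    show "trans R"
    proof (rule transI)
      fix x y z assume "(x, y) \<in> R" "(y, z) \<in> R"
      then obtain m n m' n' where "y = act m n x" "z = act m' n' y" by (auto simp: R_def)
      then have "z = act (m' + m) (n' + n) x" by (simp only: act_act)
      then show "(x, z) \<in> R" unfolding R_def by blast
    qed
  qed auto
  define rep where "rep x = (SOME y. (x, y) \<in> R)" for x
  have rep: "(x, rep x) \<in> R" for x
    unfolding rep_def by (rule someI[of _ x]) (use \<open>equiv UNIV R\<close> in \<open>auto simp: equiv_def refl_on_def\<close>)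
  have rep_eq: "rep x = rep y" if "(x, y) \<in> R" for x y
  proof -
    have "(x, z) \<in> R \<longleftrightarrow> (y, z) \<in> R" for z
      using that \<open>equiv UNIV R\<close> by (meson equiv_def symD transD)
    then show ?thesis by (simp add: rep_def)
  qed
  let ?O = "range rep \<times> (UNIV :: nat set)"
  have "infinite ?O" by (auto simp: finite_cartesian_product_iff)
  then have e: "bij_betw (from_nat_into ?O) UNIV ?O"
    by (intro bij_betw_from_nat_into) auto
  \<comment> \<open>An enumeration of all pairs of an orbit representative and a copy number.\<close>
  define e where "e = from_nat_into ?O"
  define h where "h = (\<lambda>(m, n, k). (act m n (fst (e k)), snd (e k)))"
  have e_rep: "fst (e k) \<in> range rep" for k
    using e unfolding e_def bij_betw_def by (metis mem_Times_iff rangeI)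
  have rep_rep: "rep z = z" if "z \<in> range rep" for z
    using that rep rep_eq by (metis rangeE)
  have rep_act: "rep (act m n z) = rep z" for m n z
    by (rule rep_eq[symmetric]) (auto simp: R_def)
  have "inj h"
  proof (rule injI)
    fix s t assume eq: "h s = h t"
    obtain m n k m' n' k' where s: "s = (m, n, k)" and t: "t = (m', n', k')" by (metis prod_cases3)
    have 1: "act m n (fst (e k)) = act m' n' (fst (e k'))" and 2: "snd (e k) = snd (e k')"
      using eq by (simp_all add: h_def s t)
    have 3: "fst (e k) = fst (e k')" using arg_cong[OF 1, of rep] by (simp only: rep_act rep_rep[OF e_rep])
    then have "e k = e k'" using 2 by (simp add: prod_eq_iff)
    then have "k = k'" using e unfolding e_def[symmetric] bij_betw_def by (auto dest: inj_onD)
    have "act (m - m') (n - n') (fst (e k)) = act (- m') (- n') (act m n (fst (e k)))"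
      by (simp add: act_act)
    also have "\<dots> = fst (e k)" unfolding 1 3[symmetric] by (simp add: act_act act_0)
    finally show "s = t" using act_free \<open>k = k'\<close> s t by force
  qed
  moreover have "surj h"
  proof -
    have "\<exists>s. y = h s" for y
    proof -
      obtain z k where y: "y = (z, k)" by (cases y)
      obtain m n where mn: "rep z = act m n z" using rep[of z] by (auto simp: R_def)
      have "(rep z, k) \<in> range e" using e by (auto simp: bij_betw_def e_def)
      then obtain i where i: "e i = (rep z, k)" by (metis rangeE)
      have "h (- m, - n, i) = y" by (simp add: h_def i y mn act_act act_0)
      then show ?thesis by blast
    qed
    then show ?thesis by (simp add: surj_def)
  qed
  ultimately have "bij h" by (simp add: bij_def)
  moreover have "h \<circ> shift_fst = map_prod u id \<circ> h"
    using act_act[of 1 0] by (auto simp: fun_eq_iff h_def shift_fst_def act_u add.commute)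
  moreover have "h \<circ> shift_snd = map_prod v id \<circ> h"
    using act_act[of 0 1] by (auto simp: fun_eq_iff h_def shift_snd_def act_v add.commute)
  ultimately show ?thesis using that by blast
qed

text \<open>This is the substitute for the normal form theorem of amalgamated products: representations
  whose peripheral pairs act freely can be transported to the same permutations of the grid,
  where they agree on the peripheral pair and can be combined.\<close>

lemma free_pair_grid:
  fixes u v :: "'x :: countable \<Rightarrow> 'x"
  assumes free: "free_pair u v"
  obtains \<Phi> :: "('x \<Rightarrow> 'x) \<Rightarrow> (grid \<Rightarrow> grid)" where
    "group_hom perm_group perm_group \<Phi>" "\<Phi> u = shift_fst" "\<Phi> v = shift_snd"
    "\<And>a b. free_pair a b \<Longrightarrow> free_pair (\<Phi> a) (\<Phi> b)"
proof -
  obtain h :: "grid \<Rightarrow> 'x \<times> nat" where h: "bij h"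
    "h \<circ> shift_fst = map_prod u id \<circ> h" "h \<circ> shift_snd = map_prod v id \<circ> h"
    using free_pair_coordinates[OF free] .
  define \<Phi> :: "('x \<Rightarrow> 'x) \<Rightarrow> grid \<Rightarrow> grid" where "\<Phi> f = inv_into UNIV h \<circ> map_prod f id \<circ> h" for f
  have hi: "h (inv_into UNIV h y) = y" "inv_into UNIV h (h x) = x" for x y
    using h(1) by (simp_all add: bij_is_surj surj_f_inv_f bij_is_inj)
  have "bij (map_prod f (id :: nat \<Rightarrow> nat))" if "bij f" for f :: "'x \<Rightarrow> 'x"
  proof (rule o_bij[of "map_prod (inv_into UNIV f) id"])
    show "map_prod (inv_into UNIV f) id \<circ> map_prod f id = id"
      using that by (simp add: map_prod_compose[symmetric] bij_is_inj map_prod.id)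
    show "map_prod f id \<circ> map_prod (inv_into UNIV f) id = id"
      using that by (auto simp: fun_eq_iff bij_is_surj surj_f_inv_f)
  qed
  then have bij: "bij (\<Phi> f)" if "bij f" for f
    using that h(1) unfolding \<Phi>_def by (intro bij_comp bij_imp_bij_inv)
  have hom: "\<Phi> (f \<circ> g) = \<Phi> f \<circ> \<Phi> g" for f g
    by (auto simp: \<Phi>_def fun_eq_iff hi map_prod_def split: prod.splits)
  have "\<Phi> \<in> Group.hom perm_group perm_group"
    by (rule homI) (auto simp: bij hom)
  then interpret \<Phi>: group_hom perm_group perm_group \<Phi>
    by (intro group_hom.intro group_hom_axioms.intro group_perm_group)
  show ?thesis
  proof
    show "group_hom perm_group perm_group \<Phi>" by unfold_locales
    show "\<Phi> u = shift_fst" "\<Phi> v = shift_snd"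
      unfolding \<Phi>_def comp_assoc h(2,3)[symmetric] by (simp_all add: fun_eq_iff hi)
    fix a b :: "'x \<Rightarrow> 'x" assume ab: "free_pair a b"
    then have "bij a" "bij b" by (auto simp: free_pair_def)
    have "m = 0 \<and> n = 0"
      if "(\<Phi> a [^]\<^bsub>perm_group\<^esub> m) ((\<Phi> b [^]\<^bsub>perm_group\<^esub> n) x) = x" for m n :: int and x
    proof -
      have "\<Phi> (a [^]\<^bsub>perm_group\<^esub> m \<circ> b [^]\<^bsub>perm_group\<^esub> n) x = x"
        using that \<open>bij a\<close> \<open>bij b\<close> \<Phi>.hom_int_pow[of a m] \<Phi>.hom_int_pow[of b n] by (simp add: hom)
      then have "h (\<Phi> (a [^]\<^bsub>perm_group\<^esub> m \<circ> b [^]\<^bsub>perm_group\<^esub> n) x) = h x" by simp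
      then have "(a [^]\<^bsub>perm_group\<^esub> m) ((b [^]\<^bsub>perm_group\<^esub> n) (fst (h x))) = fst (h x)"
        by (auto simp: \<Phi>_def hi map_prod_def split: prod.splits)
      then show ?thesis using ab by (auto simp: free_pair_def)
    qed
    then show "free_pair (\<Phi> a) (\<Phi> b)"
      using ab bij hom unfolding free_pair_def by metis
  qed
qed

text \<open>Permutations of \<open>int \<times> 'x\<close> that commute with translations of the first factor. A Seifert piece
  is represented in this form: its fibre translates the first factor, its base orbifold group
  acts on the second.\<close>

definition twist :: "int \<Rightarrow> ('x \<Rightarrow> 'x) \<Rightarrow> int \<times> 'x \<Rightarrow> int \<times> 'x" where
  "twist l f = (\<lambda>(a, x). (a + l, f x))"

lemma twist_comp: "twist k f \<circ> twist l g = twist (k + l) (f \<circ> g)"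
  by (auto simp: twist_def fun_eq_iff)

lemma twist_id: "twist 0 id = id"
  by (auto simp: twist_def fun_eq_iff)

lemma bij_twist: "bij f \<Longrightarrow> bij (twist l f)"
  by (rule o_bij[of "twist (- l) (inv_into UNIV f)"])
    (auto simp: twist_def fun_eq_iff bij_is_inj bij_is_surj surj_f_inv_f)

lemma twist_pow:
  assumes "bij f"
  shows "twist l f [^]\<^bsub>perm_group\<^esub> (k :: int) = twist (k * l) (f [^]\<^bsub>perm_group\<^esub> k)"
proof -
  define t where "t i = twist (i * l) (f [^]\<^bsub>perm_group\<^esub> (i :: int))" for i
  have "t i \<in> carrier perm_group" for i
    using assms by (simp add: t_def bij_twist bij_pow)
  moreover have "t (i + j) = t i \<otimes>\<^bsub>perm_group\<^esub> t j" for i j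
  proof -
    have "f [^]\<^bsub>perm_group\<^esub> (i + j) = f [^]\<^bsub>perm_group\<^esub> i \<circ> f [^]\<^bsub>perm_group\<^esub> j"
      using perm.int_pow_mult[of f i j] assms by simp
    then show ?thesis by (simp add: t_def twist_comp distrib_right)
  qed
  ultimately have "t 1 [^]\<^bsub>perm_group\<^esub> k = t k" by (rule perm.int_pow_flow)
  then show ?thesis using assms perm.int_pow_1[of f] by (simp add: t_def)
qed

definition aperiodic :: "('x \<Rightarrow> 'x) \<Rightarrow> bool" where
  "aperiodic f \<longleftrightarrow> bij f \<and> (\<forall>(n :: int) x. (f [^]\<^bsub>perm_group\<^esub> n) x = x \<longrightarrow> n = 0)"

lemma funpow_perm: "f [^]\<^bsub>perm_group\<^esub> (n :: nat) = f ^^ n"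
  by (induction n) (simp_all add: funpow_Suc_right del: funpow.simps(2))

text \<open>The hypotheses say that every orbit is strictly monotone, increasing or decreasing.\<close>

lemma aperiodic_monotone:
  fixes f :: "int \<Rightarrow> int"
  assumes "bij f" "\<And>x. f x \<noteq> x" "\<And>x. x < f x \<Longrightarrow> f x < f (f x)" "\<And>x. f x < x \<Longrightarrow> f (f x) < f x"
  shows "aperiodic f"
proof -
  have up: "x < (f ^^ Suc n) x \<and> (f ^^ Suc n) x < (f ^^ Suc (Suc n)) x" if "x < f x" for n x
    using that by (induction n) (use assms(3) in \<open>auto intro: less_trans\<close>)
  have down: "(f ^^ Suc n) x < x \<and> (f ^^ Suc (Suc n)) x < (f ^^ Suc n) x" if "f x < x" for n x
    using that by (induction n) (use assms(4) in \<open>auto intro: less_trans\<close>)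
  have nat: "n = 0" if "(f ^^ n) x = x" for n x
  proof (rule ccontr)
    assume "n \<noteq> 0"
    then obtain m where "n = Suc m" by (cases n) auto
    then show False using that up[of x m] down[of x m] assms(2)[of x] by (metis less_irrefl linorder_neqE)
  qed
  have "n = 0" if "(f [^]\<^bsub>perm_group\<^esub> n) x = x" for n :: int and x
  proof (cases n rule: int_cases2)
    case (nonneg m)
    then show ?thesis using that nat by (simp add: int_pow_int funpow_perm)
  next
    case (nonpos m)
    have "f [^]\<^bsub>perm_group\<^esub> int m \<circ> f [^]\<^bsub>perm_group\<^esub> n = id"
      using perm.int_pow_mult[of f "int m" n] assms(1) nonpos by simp
    then have "(f ^^ m) x = x" using that by (metis comp_apply funpow_perm id_apply int_pow_int)
    then show ?thesis using nat nonpos by simp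
  qed
  then show ?thesis using assms(1) by (simp add: aperiodic_def)
qed

lemma free_pair_twist:
  fixes f :: "'x \<Rightarrow> 'x"
  assumes "k \<noteq> 0" "aperiodic f"
  shows "free_pair (twist k id) (twist l f)" "free_pair (twist l f) (twist k id)"
proof -
  have f: "bij f" using assms by (simp add: aperiodic_def)
  have id_pow: "(id :: 'x \<Rightarrow> 'x) [^]\<^bsub>perm_group\<^esub> (n :: int) = id" for n
    using perm.int_pow_one by simp
  have pow: "twist k id [^]\<^bsub>perm_group\<^esub> m = twist (m * k) (id :: 'x \<Rightarrow> 'x)"
    "twist l f [^]\<^bsub>perm_group\<^esub> m = twist (m * l) (f [^]\<^bsub>perm_group\<^esub> m)" for m :: int
    using twist_pow[of "id :: 'x \<Rightarrow> 'x" k m] twist_pow[OF f, of l m] by (simp_all add: id_pow)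
  have free: "n = 0 \<and> m = 0" if "n * l + m * k = 0" "(f [^]\<^bsub>perm_group\<^esub> n) x = x" for m n x
  proof -
    have "n = 0" using that(2) assms(2) unfolding aperiodic_def by blast
    then show ?thesis using that(1) assms(1) by simp
  qed
  show "free_pair (twist k id) (twist l f)"
    unfolding free_pair_def pow
  proof (intro conjI allI impI)
    fix m n :: int and z :: "int \<times> 'x"
    assume "twist (m * k) id (twist (n * l) (f [^]\<^bsub>perm_group\<^esub> n) z) = z"
    then have "n = 0 \<and> m = 0" by (intro free[of n m "snd z"]) (auto simp: twist_def split: prod.splits)
    then show "m = 0" "n = 0" by simp_all
  qed (simp_all add: bij_twist f twist_comp add.commute)
  show "free_pair (twist l f) (twist k id)"
    unfolding free_pair_def pow
  proof (intro conjI allI impI)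
    fix m n :: int and z :: "int \<times> 'x"
    assume "twist (m * l) (f [^]\<^bsub>perm_group\<^esub> m) (twist (n * k) id z) = z"
    then have "m = 0 \<and> n = 0" by (intro free[of m n "snd z"]) (auto simp: twist_def split: prod.splits)
    then show "m = 0" "n = 0" by simp_all
  qed (simp_all add: bij_twist f twist_comp add.commute)
qed

section \<open>Incompressible and degenerate half chains\<close>

text \<open>In each block of \<open>P\<close> consecutive integers the first \<open>m\<close> are permuted cyclically, by \<open>k\<close> steps.\<close>

definition rot :: "int \<Rightarrow> int \<Rightarrow> int \<Rightarrow> int \<Rightarrow> int" where
  "rot m P k x = (if x mod P < m then x - x mod P + (x mod P + k) mod m else x)"

lemma mod_of_block: "\<lbrakk>0 \<le> r; r < P\<rbrakk> \<Longrightarrow> (x - x mod P + r) mod P = (r :: int)"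
proof -
  assume "0 \<le> r" "r < P"
  moreover have "(x - x mod P + r) mod P = r mod P"
    by (simp add: minus_mod_eq_mult_div)
  ultimately show ?thesis by simp
qed

lemma rot_comp:
  assumes "1 \<le> m" "m \<le> P"
  shows "rot m P i \<circ> rot m P j = rot m P (i + j)"
proof
  fix x
  show "(rot m P i \<circ> rot m P j) x = rot m P (i + j) x"
  proof (cases "x mod P < m")
    case True
    let ?r = "(x mod P + j) mod m"
    have r: "0 \<le> ?r" "?r < m" using assms by simp_all
    have e: "(x - x mod P + ?r) mod P = ?r" using r assms by (intro mod_of_block; linarith)
    have "rot m P i (x - x mod P + ?r) = x - x mod P + (?r + i) mod m"
      unfolding rot_def e using r(2) by simp
    moreover have "(?r + i) mod m = (x mod P + (i + j)) mod m"
      using mod_add_left_eq[of "x mod P + j" m i] by (simp only: add_ac)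
    moreover have "rot m P j x = x - x mod P + ?r" using True by (simp add: rot_def)
    moreover have "rot m P (i + j) x = x - x mod P + (x mod P + (i + j)) mod m" using True by (simp add: rot_def)
    ultimately show ?thesis by simp
  qed (simp add: rot_def)
qed

lemma rot_mod:
  assumes "k mod m = k' mod m"
  shows "rot m P k = rot m P k'"
proof -
  have "(a + k) mod m = (a + k') mod m" for a using assms by (rule mod_add_cong[OF refl])
  then show ?thesis by (intro ext) (simp only: rot_def)
qed

lemma rot_0: "\<lbrakk>1 \<le> m; m \<le> P\<rbrakk> \<Longrightarrow> rot m P 0 = id"
  by (auto simp: rot_def fun_eq_iff)

lemma bij_rot: "\<lbrakk>1 \<le> m; m \<le> P\<rbrakk> \<Longrightarrow> bij (rot m P k)"
  by (rule o_bij[of "rot m P (- k)"]) (simp_all add: rot_comp rot_0)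

lemma rot_pow:
  assumes "1 \<le> m" "m \<le> P"
  shows "rot m P k [^]\<^bsub>perm_group\<^esub> (n :: int) = rot m P (k * n)"
  using perm.int_pow_flow[of "\<lambda>n. rot m P (k * n)" n] assms
  by (simp add: bij_rot rot_comp distrib_left)

text \<open>A rotation of order \<open>|p|\<close> is the \<open>q\<close>-th power of a rotation of the same kind.\<close>

lemma rot_bezout:
  fixes p q :: int
  assumes "coprime p q"
  shows "\<exists>u. (\<forall>P. rot \<bar>p\<bar> P (u * q) = rot \<bar>p\<bar> P 1) \<and> (\<forall>P. rot \<bar>p\<bar> P (u * p) = rot \<bar>p\<bar> P 0)"
proof -
  obtain u v where "u * q + v * p = 1" using bezout_int[of q p] assms by (auto simp: coprime_commute)
  then have "u * q = 1 + (- v) * p" by simp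
  then have "(u * q) mod \<bar>p\<bar> = 1 mod \<bar>p\<bar>"
    by (metis dvd_abs_iff dvd_refl dvd_mult mod_eq_dvd_iff add_diff_cancel_left' abs_dvd_iff)
  moreover have "(u * p) mod \<bar>p\<bar> = 0 mod \<bar>p\<bar>" by simp
  ultimately show ?thesis using rot_mod by metis
qed

lemma aperiodic_increasing:
  fixes f :: "int \<Rightarrow> int"
  assumes "bij f" "\<And>x. x < f x"
  shows "aperiodic f"
proof (rule aperiodic_monotone[OF assms(1)])
  fix x
  show "f x \<noteq> x" using assms(2)[of x] by simp
  show "f x < f (f x)" using assms(2) .
  show "f (f x) < f x" if "f x < x" using that assms(2)[of x] by simp
qed

lemma bij_add: "bij (\<lambda>x :: int. x + k)"
  by (rule o_bij[of "\<lambda>x. x - k"]) auto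

text \<open>The peripheral pair is represented by the two standard translations of the grid.\<close>

definition incompressible :: "(nat \<Rightarrow> int) \<Rightarrow> (nat \<Rightarrow> int) \<Rightarrow> nat \<Rightarrow> bool" where
  "incompressible p q i \<longleftrightarrow> (\<exists>c. half_chain perm_group p q i c shift_fst shift_snd)"

text \<open>The new piece is represented on \<open>int \<times> int\<close>. Its generator \<open>c\<close> has \<open>c^p\<close> equal to a translation of
  the first factor, \<open>s\<close> is the fibre of the previous piece, and both pairs \<open>(s, c^-p)\<close> and
  \<open>(c^p, s c^q)\<close> act freely. The first pair is identified with the old peripheral pair, so that the
  half chain can be extended; the second is the new peripheral pair.\<close>

lemma incompressible_Suc:
  assumes inc: "incompressible p q i" and i: "1 \<le> i"
    and p: "p (Suc i) \<noteq> 0" and cop: "coprime (p (Suc i)) (q (Suc i))"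
  shows "incompressible p q (Suc i)"
proof -
  let ?p = "p (Suc i)" let ?q = "q (Suc i)" let ?m = "\<bar>p (Suc i)\<bar>"
  have m: "1 \<le> ?m" using p by linarith
  obtain u where u0: "\<And>P. rot ?m P (u * ?q) = rot ?m P 1" "\<And>P. rot ?m P (u * ?p) = rot ?m P 0"
    using rot_bezout[OF cop] by blast
  have u: "rot ?m ?m (u * ?q) = rot ?m ?m 1" "rot ?m ?m (u * ?p) = id"
    using u0 rot_0[OF m] by simp_all
  \<comment> \<open>The fibre of the previous piece; shifting by \<open>|p|\<close> outweighs the rotation, so \<open>s c^q\<close> increases the second coordinate.\<close>
  define s where "s = twist 0 (\<lambda>x. x + ?m)"
  define c where "c = twist 1 (rot ?m ?m u)"
  note bij = bij_rot[OF m order_refl]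
  have c_pow: "c [^]\<^bsub>perm_group\<^esub> n = twist n (rot ?m ?m (u * n))" for n
    using m by (simp add: c_def twist_pow bij rot_pow)
  have cp: "c [^]\<^bsub>perm_group\<^esub> ?p = twist ?p id" by (simp add: c_pow u)
  have cq: "s \<circ> c [^]\<^bsub>perm_group\<^esub> ?q = twist ?q ((\<lambda>x. x + ?m) \<circ> rot ?m ?m 1)"
    by (simp add: c_pow u s_def twist_comp)
  have bc: "bij c" and bs: "bij s" using bij bij_add by (auto simp: c_def s_def intro: bij_twist)
  have cmp: "c [^]\<^bsub>perm_group\<^esub> (- ?p) = twist (- ?p) id"
    using u(2) rot_comp[of ?m ?m "u * ?p" "- (u * ?p)"] rot_0[OF m order_refl] m by (simp add: c_pow)
  have "aperiodic (\<lambda>x. x + ?m)" using p by (intro aperiodic_increasing bij_add) auto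
  then have free1: "free_pair s (c [^]\<^bsub>perm_group\<^esub> (- ?p))"
    unfolding s_def cmp using p by (intro free_pair_twist) auto
  have "aperiodic ((\<lambda>x. x + ?m) \<circ> rot ?m ?m 1)"
  proof (intro aperiodic_increasing bij_comp bij_add bij)
    fix x
    have "x mod ?m < ?m" "0 \<le> (x mod ?m + 1) mod ?m" using m by simp_all
    then show "x < ((\<lambda>x. x + ?m) \<circ> rot ?m ?m 1) x" unfolding rot_def comp_def by auto
  qed
  then have free2: "free_pair (c [^]\<^bsub>perm_group\<^esub> ?p) (s \<circ> c [^]\<^bsub>perm_group\<^esub> ?q)"
    unfolding cp cq using p by (intro free_pair_twist) auto
  obtain \<Phi> :: "(int \<times> int \<Rightarrow> int \<times> int) \<Rightarrow> grid \<Rightarrow> grid" where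
    h: "group_hom perm_group perm_group \<Phi>" and \<Phi>: "\<Phi> s = shift_fst" "\<Phi> (c [^]\<^bsub>perm_group\<^esub> (- ?p)) = shift_snd"
    and free: "\<And>a b. free_pair a b \<Longrightarrow> free_pair (\<Phi> a) (\<Phi> b)"
    using free_pair_grid[OF free1] by metis
  interpret h: group_hom perm_group perm_group \<Phi> by fact
  obtain d where d: "half_chain perm_group p q i d shift_fst shift_snd"
    using inc by (auto simp: incompressible_def)
  have cc: "c \<in> carrier perm_group" "s \<in> carrier perm_group" using bc bs by simp_all
  have "shift_snd \<otimes>\<^bsub>perm_group\<^esub> \<Phi> c [^]\<^bsub>perm_group\<^esub> ?p = \<Phi> (c [^]\<^bsub>perm_group\<^esub> (- ?p) \<otimes>\<^bsub>perm_group\<^esub> c [^]\<^bsub>perm_group\<^esub> ?p)"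
    using h.hom_mult[OF perm.int_pow_closed[OF cc(1), of "- ?p"] perm.int_pow_closed[OF cc(1), of ?p]]
    by (simp only: \<Phi> h.hom_int_pow[OF cc(1), of ?p])
  also have "\<dots> = \<one>\<^bsub>perm_group\<^esub>"
    using h.hom_one perm.int_pow_mult[OF cc(1), of "- ?p" ?p] by simp
  finally have "\<exists>d'. half_chain perm_group p q (Suc i) d' (\<Phi> c [^]\<^bsub>perm_group\<^esub> ?p) (shift_fst \<otimes>\<^bsub>perm_group\<^esub> \<Phi> c [^]\<^bsub>perm_group\<^esub> ?q)"
    using perm.half_chain_extend[OF d h.hom_closed[OF cc(1)] _ i] by blast
  also have "\<Phi> c [^]\<^bsub>perm_group\<^esub> ?p = \<Phi> (c [^]\<^bsub>perm_group\<^esub> ?p)"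
    using cc by (simp only: h.hom_int_pow)
  also have "shift_fst \<otimes>\<^bsub>perm_group\<^esub> \<Phi> c [^]\<^bsub>perm_group\<^esub> ?q = \<Phi> (s \<circ> c [^]\<^bsub>perm_group\<^esub> ?q)"
    using h.hom_mult[OF cc(2) perm.int_pow_closed[OF cc(1), of ?q]]
    by (simp only: \<Phi> h.hom_int_pow[OF cc(1), of ?q] perm_group_simps)
  finally obtain d' where d': "half_chain perm_group p q (Suc i) d' (\<Phi> (c [^]\<^bsub>perm_group\<^esub> ?p)) (\<Phi> (s \<circ> c [^]\<^bsub>perm_group\<^esub> ?q))"
    by blast
  obtain \<Psi> :: "(grid \<Rightarrow> grid) \<Rightarrow> grid \<Rightarrow> grid" where
    "group_hom perm_group perm_group \<Psi>" "\<Psi> (\<Phi> (c [^]\<^bsub>perm_group\<^esub> ?p)) = shift_fst"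
    "\<Psi> (\<Phi> (s \<circ> c [^]\<^bsub>perm_group\<^esub> ?q)) = shift_snd"
    using free_pair_grid[OF free[OF free2]] by metis
  then show ?thesis using half_chain_map[OF _ d'] unfolding incompressible_def by metis
qed

definition rot_shifted :: "int \<Rightarrow> int \<Rightarrow> int \<Rightarrow> int \<Rightarrow> int \<Rightarrow> int" where
  "rot_shifted s m P k x = rot m P k (x - s) + s"

lemma rot_shifted_conv: "rot_shifted s m P k = (\<lambda>x. x + s) \<circ> rot m P k \<circ> (\<lambda>x. x + (- s))"
  by (simp add: rot_shifted_def fun_eq_iff)

lemma rot_shifted_comp:
  assumes "1 \<le> m" "m \<le> P"
  shows "rot_shifted s m P i \<circ> rot_shifted s m P j = rot_shifted s m P (i + j)"
  using fun_cong[OF rot_comp[OF assms]] by (simp add: rot_shifted_def fun_eq_iff)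

lemma bij_rot_shifted: "\<lbrakk>1 \<le> m; m \<le> P\<rbrakk> \<Longrightarrow> bij (rot_shifted s m P k)"
  unfolding rot_shifted_conv by (intro bij_comp bij_add bij_rot)

lemma rot_shifted_pow:
  assumes "1 \<le> m" "m \<le> P"
  shows "rot_shifted s m P k [^]\<^bsub>perm_group\<^esub> (n :: int) = rot_shifted s m P (k * n)"
  using perm.int_pow_flow[of "\<lambda>n. rot_shifted s m P (k * n)" n] assms
  by (simp add: bij_rot_shifted rot_shifted_comp distrib_left)

text \<open>Rotations of orders \<open>l\<close> and \<open>m\<close> whose cycles are arranged in a line, consecutive ones sharing one
  point. Their product walks along this line: forwards in general, backwards through the points
  congruent to \<open>m - 1\<close>. So two elements of finite order have a product without periodic points.\<close>

lemma interlocked_rotations: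
  fixes l m :: int
  assumes "2 \<le> l" "2 \<le> m"
  defines "P \<equiv> l + m - 2"
  defines "f \<equiv> rot_shifted (m - 1) l P 1 \<circ> rot m P 1"
  shows "f x = (if x mod P = m - 1 then x - P else if x mod P = m - 2 then x + 2 else x + 1)"
proof -
  define r d where "r = x mod P" and "d = x - r"
  have Pv: "P = l + m - 2" by (simp add: P_def)
  have P: "2 \<le> P" "m \<le> P" "l \<le> P" using assms(1,2) by (auto simp: Pv)
  have r: "0 \<le> r" "r < P" using P by (simp_all add: r_def)
  have xr: "x mod P = r" by (simp add: r_def)
  have block: "(d + t) mod P = t" if "0 \<le> t" "t < P" for t
    unfolding d_def r_def using that by (rule mod_of_block)
  have block': "(d + t) mod P = t + P" if "- P \<le> t" "t < 0" for t
    using block[of "t + P"] that by (simp add: add.assoc[symmetric])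
  have tau: "rot m P 1 x = d + (if r < m - 1 then r + 1 else if r = m - 1 then 0 else r)"
    using r assms(1,2) by (cases "r = m - 1") (auto simp: rot_def xr d_def)
  have sigma: "rot_shifted (m - 1) l P 1 (d + t) =
      d + (if t = 0 then - (l - 1) else if t < m - 1 then t else t + 1)" if t: "0 \<le> t" "t < P" for t
  proof (cases "t < m - 1")
    case True
    have e: "(d + t - (m - 1)) mod P = t - (m - 1) + P"
      using block'[of "t - (m - 1)"] True t P by (simp add: add_diff_eq)
    show ?thesis
      unfolding rot_shifted_def rot_def e using True t assms(1,2) by (auto simp: Pv)
  next
    case False
    have e: "(d + t - (m - 1)) mod P = t - (m - 1)"
      using block[of "t - (m - 1)"] False t assms(1,2) by (simp add: add_diff_eq)
    have "t - (m - 1) + 1 < l" using t by (simp add: Pv)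
    then have "(t - (m - 1) + 1) mod l = t - (m - 1) + 1" using False by simp
    then show ?thesis
      unfolding rot_shifted_def rot_def e using False t assms(1,2) by (auto simp: Pv)
  qed
  have "f x = rot_shifted (m - 1) l P 1 (d + (if r < m - 1 then r + 1 else if r = m - 1 then 0 else r))"
    by (simp only: f_def comp_apply tau)
  also have "\<dots> = d + (if (if r < m - 1 then r + 1 else if r = m - 1 then 0 else r) = 0 then - (l - 1)
      else if (if r < m - 1 then r + 1 else if r = m - 1 then 0 else r) < m - 1
      then (if r < m - 1 then r + 1 else if r = m - 1 then 0 else r)
      else (if r < m - 1 then r + 1 else if r = m - 1 then 0 else r) + 1)"
    by (rule sigma) (use r P in auto)
  also have "\<dots> = (if r = m - 1 then x - P else if r = m - 2 then x + 2 else x + 1)"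
    using r assms(1,2) P by (auto simp: d_def Pv)
  finally show ?thesis by (simp only: xr)
qed

lemma aperiodic_interlocked:
  fixes l m :: int
  assumes "2 \<le> l" "2 \<le> m"
  shows "aperiodic (rot_shifted (m - 1) l (l + m - 2) 1 \<circ> rot m (l + m - 2) 1)" (is "aperiodic ?f")
proof (rule aperiodic_monotone)
  let ?P = "l + m - 2"
  note f = interlocked_rotations[OF assms]
  show "bij ?f" using assms by (intro bij_comp bij_rot bij_rot_shifted) auto
  show "?f x \<noteq> x" for x using f[of x] assms by auto
  have P: "2 \<le> ?P" "m \<le> ?P" using assms by auto
  show "?f x < ?f (?f x)" if "x < ?f x" for x
  proof -
    define r d where "r = x mod ?P" and "d = x - r"
    have r: "0 \<le> r" "r < ?P" using P by (simp_all add: r_def)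
    have block: "(d + t) mod ?P = t" if "0 \<le> t" "t < ?P" for t
      unfolding d_def r_def using that by (rule mod_of_block)
    have P0: "(d + ?P) mod ?P = 0" using block[of 0] P by (metis add.right_neutral less_le_trans mod_add_self2 order_refl zero_less_numeral)
    have ne: "r \<noteq> m - 1" using that f[of x] P by (auto simp: r_def)
    have "?f x = d + (if r = m - 2 then m else r + 1)" using f[of x] ne by (auto simp: r_def d_def)
    then have "(?f x) mod ?P \<noteq> m - 1"
      using block[of m] block[of "r + 1"] P0 r ne P assms
      by (cases "m = ?P"; cases "r + 1 = ?P") (auto split: if_splits)
    then show ?thesis using f[of "?f x"] by auto
  qed
  show "?f (?f x) < ?f x" if "?f x < x" for x
  proof -
    have "x mod ?P = m - 1" using f[of x] that by (auto split: if_splits)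
    then have "?f x = x - ?P" and "(?f x) mod ?P = m - 1" using f[of x] by simp_all
    then show ?thesis using f[of "?f x"] P by simp
  qed
qed

text \<open>A solid torus with core \<open>b\<close> is glued to a piece with an exceptional fibre \<open>c\<close>; the relator is
  \<open>b^\<beta> \<cdot> c^p\<close>. Modulo the central element \<open>c^p\<close> this is the free product of cyclic groups of orders
  \<open>|\<beta>|\<close> and \<open>|p|\<close>, represented by interlocked rotations. The amounts of translation are chosen such
  that \<open>b^\<beta>\<close> and \<open>c^p\<close> cancel.\<close>

lemma incompressible_start:
  assumes sol: "solid p q i \<alpha> \<beta>" and p0: "p 0 = 0" and \<beta>: "2 \<le> \<bar>\<beta>\<bar>" and p: "2 \<le> \<bar>p (Suc i)\<bar>"
    and cop: "coprime \<alpha> \<beta>" "coprime (p (Suc i)) (q (Suc i))"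
  shows "incompressible p q (Suc i)"
proof -
  let ?p = "p (Suc i)" let ?q = "q (Suc i)" let ?m = "\<bar>p (Suc i)\<bar>" let ?l = "\<bar>\<beta>\<bar>" let ?P = "?l + ?m - 2"
  have i: "1 \<le> i" using solid_pos[OF sol] .
  have m: "1 \<le> ?m" "?m \<le> ?P" and l: "1 \<le> ?l" "?l \<le> ?P" using \<beta> p by auto
  obtain u where u0: "\<And>P. rot ?m P (u * ?q) = rot ?m P 1" "\<And>P. rot ?m P (u * ?p) = rot ?m P 0"
    using rot_bezout[OF cop(2)] by blast
  have u: "rot ?m ?P (u * ?q) = rot ?m ?P 1" "rot ?m ?P (u * ?p) = id"
    using u0 rot_0[OF m] by simp_all
  obtain v where v0: "\<And>P. rot ?l P (v * \<alpha>) = rot ?l P 1" "\<And>P. rot ?l P (v * \<beta>) = rot ?l P 0"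
    using rot_bezout[of \<beta> \<alpha>] cop(1) coprime_commute by blast
  have v: "rot_shifted (?m - 1) ?l ?P (v * \<alpha>) = rot_shifted (?m - 1) ?l ?P 1"
    "rot_shifted (?m - 1) ?l ?P (v * \<beta>) = id"
    using v0 rot_0[OF l] by (simp_all add: rot_shifted_def fun_eq_iff)
  define b where "b = twist (- ?p) (rot_shifted (?m - 1) ?l ?P v)"
  define c where "c = twist \<beta> (rot ?m ?P u)"
  have b_pow: "b [^]\<^bsub>perm_group\<^esub> n = twist (n * - ?p) (rot_shifted (?m - 1) ?l ?P (v * n))" for n
    using l by (simp add: b_def twist_pow bij_rot_shifted rot_shifted_pow)
  have c_pow: "c [^]\<^bsub>perm_group\<^esub> n = twist (n * \<beta>) (rot ?m ?P (u * n))" for n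
    using m by (simp add: c_def twist_pow bij_rot rot_pow)
  have bc: "b \<in> carrier perm_group" "c \<in> carrier perm_group"
    using m l by (simp_all add: b_def c_def bij_twist bij_rot bij_rot_shifted)
  have cp: "c [^]\<^bsub>perm_group\<^esub> ?p = twist (?p * \<beta>) id" by (simp add: c_pow u)
  have y: "b [^]\<^bsub>perm_group\<^esub> \<alpha> \<otimes>\<^bsub>perm_group\<^esub> c [^]\<^bsub>perm_group\<^esub> ?q =
      twist (\<alpha> * - ?p + ?q * \<beta>) (rot_shifted (?m - 1) ?l ?P 1 \<circ> rot ?m ?P 1)"
    by (simp add: b_pow c_pow u v twist_comp)
  have eq: "b [^]\<^bsub>perm_group\<^esub> \<beta> \<otimes>\<^bsub>perm_group\<^esub> c [^]\<^bsub>perm_group\<^esub> ?p = \<one>\<^bsub>perm_group\<^esub>"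
    by (simp add: b_pow c_pow u v twist_comp twist_id)
  obtain d where d: "half_chain perm_group p q i d (b [^]\<^bsub>perm_group\<^esub> \<alpha>) (b [^]\<^bsub>perm_group\<^esub> \<beta>)"
    using perm.solid_half_chain[OF sol bc(1) p0] by blast
  then obtain d' where d': "half_chain perm_group p q (Suc i) d' (c [^]\<^bsub>perm_group\<^esub> ?p)
      (b [^]\<^bsub>perm_group\<^esub> \<alpha> \<otimes>\<^bsub>perm_group\<^esub> c [^]\<^bsub>perm_group\<^esub> ?q)"
    using perm.half_chain_extend[OF d bc(2) eq i] by blast
  have "free_pair (c [^]\<^bsub>perm_group\<^esub> ?p) (b [^]\<^bsub>perm_group\<^esub> \<alpha> \<otimes>\<^bsub>perm_group\<^esub> c [^]\<^bsub>perm_group\<^esub> ?q)"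
    unfolding cp y using \<beta> p by (intro free_pair_twist aperiodic_interlocked) auto
  then obtain \<Phi> :: "(int \<times> int \<Rightarrow> int \<times> int) \<Rightarrow> grid \<Rightarrow> grid" where
    "group_hom perm_group perm_group \<Phi>" "\<Phi> (c [^]\<^bsub>perm_group\<^esub> ?p) = shift_fst"
    "\<Phi> (b [^]\<^bsub>perm_group\<^esub> \<alpha> \<otimes>\<^bsub>perm_group\<^esub> c [^]\<^bsub>perm_group\<^esub> ?q) = shift_snd"
    using free_pair_grid by metis
  then show ?thesis using half_chain_map[OF _ d'] unfolding incompressible_def by metis
qed

text \<open>Neutral peripheral elements can be continued by neutral generators on the other side, so a
  degenerate half chain gives every chain that contains it a non-trivial representation.\<close>

definition degenerate :: "(nat \<Rightarrow> int) \<Rightarrow> (nat \<Rightarrow> int) \<Rightarrow> nat \<Rightarrow> bool" where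
  "degenerate p q i \<longleftrightarrow> (\<exists>n c. half_chain (integer_mod_group n) p q i c 0 0 \<and> (\<exists>j. 1 \<le> j \<and> j \<le> i \<and> c j \<noteq> 0))"

lemma degenerate_Suc:
  assumes "degenerate p q i" "1 \<le> i"
  shows "degenerate p q (Suc i)"
proof -
  obtain n c j where c: "half_chain (integer_mod_group n) p q i c 0 0" and j: "1 \<le> j" "j \<le> i" "c j \<noteq> 0"
    using assms(1) by (auto simp: degenerate_def)
  have "half_chain (integer_mod_group n) p q (Suc i) (\<lambda>j. if j \<le> i then c j else 0) 0 0"
    using group.half_chain_extend[OF group_integer_mod_group c, of 0] assms(2)
    by (simp add: int_pow_integer_mod_group)
  then show ?thesis unfolding degenerate_def
    using j by (intro exI[of _ n] exI[of _ "\<lambda>j. if j \<le> i then c j else 0"] conjI exI[of _ j]) auto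
qed

text \<open>If \<open>\<beta> = 0\<close>, the relator \<open>c^p\<close> leaves a cyclic group of order \<open>|p|\<close>, while \<open>b = c^(- \<alpha> q)\<close> makes \<open>y\<close>
  neutral.\<close>

lemma degenerate_start:
  assumes sol: "solid p q i \<alpha> 0" and p0: "p 0 = 0" and p: "\<bar>p (Suc i)\<bar> \<noteq> 1" and cop: "coprime \<alpha> 0"
  shows "degenerate p q (Suc i)"
proof -
  let ?p = "p (Suc i)" let ?q = "q (Suc i)"
  let ?n = "nat \<bar>?p\<bar>" let ?K = "integer_mod_group ?n"
  interpret K: group ?K by simp
  have n: "?n \<noteq> 1" using p by linarith
  have d: "1 \<in> carrier ?K" using n integer_mod_group_1 by blast
  have \<alpha>: "\<alpha> * \<alpha> = 1" using cop abs_eq_1_square by simp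
  have i: "1 \<le> i" using solid_pos[OF sol] .
  let ?b = "1 [^]\<^bsub>?K\<^esub> (- \<alpha> * ?q)"
  have "?b \<in> carrier ?K" using d by simp
  then obtain c where "half_chain ?K p q i c (?b [^]\<^bsub>?K\<^esub> \<alpha>) (?b [^]\<^bsub>?K\<^esub> (0 :: int))"
    using K.solid_half_chain[OF sol _ p0] by blast
  moreover have "?b [^]\<^bsub>?K\<^esub> \<alpha> = 1 [^]\<^bsub>?K\<^esub> (- ?q)"
  proof -
    have "- \<alpha> * ?q * \<alpha> = - ?q * (\<alpha> * \<alpha>)" by (simp add: algebra_simps)
    then show ?thesis using \<alpha> by (simp only: K.int_pow_pow[OF d] mult_1_right)
  qed
  moreover have "?b [^]\<^bsub>?K\<^esub> (0 :: int) = 0" by (simp only: int_pow_0 one_integer_mod_group)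
  ultimately have c: "half_chain ?K p q i c (1 [^]\<^bsub>?K\<^esub> (- ?q)) 0" by (simp only:)
  have p_pow: "1 [^]\<^bsub>?K\<^esub> ?p = 0" by (simp add: int_pow_integer_mod_group)
  have z: "1 [^]\<^bsub>?K\<^esub> (- ?q) \<otimes>\<^bsub>?K\<^esub> 1 [^]\<^bsub>?K\<^esub> ?q = 0"
    using K.int_pow_mult[OF d, of "- ?q" ?q] by (simp only: add.left_inverse int_pow_0 one_integer_mod_group)
  have y: "0 \<otimes>\<^bsub>?K\<^esub> 1 [^]\<^bsub>?K\<^esub> ?p = \<one>\<^bsub>?K\<^esub>"
    unfolding p_pow by simp
  have "half_chain ?K p q (Suc i) (\<lambda>j. if j \<le> i then c j else 1) 0 0"
    using K.half_chain_extend[OF c d y i] unfolding p_pow z .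
  then show ?thesis unfolding degenerate_def
    by (intro exI[of _ ?n] exI[of _ "\<lambda>j. if j \<le> i then c j else 1"] conjI exI[of _ "Suc i"]) auto
qed

text \<open>Adding a generator to a solid half chain fails to be solid only if neither \<open>\<beta>\<close> nor \<open>p\<close> is a unit.
  It is then degenerate for \<open>\<beta> = 0\<close> and incompressible otherwise. These two kinds are inherited by
  longer half chains.\<close>

lemma half_trichotomy:
  assumes p0: "p 0 = 0" and "1 \<le> i"
    and "\<And>j. \<lbrakk>1 \<le> j; j \<le> i\<rbrakk> \<Longrightarrow> coprime (p j) (q j)" "\<And>j. \<lbrakk>2 \<le> j; j \<le> i\<rbrakk> \<Longrightarrow> p j \<noteq> 0"
  shows "(\<exists>\<alpha> \<beta>. solid p q i \<alpha> \<beta>) \<or> incompressible p q i \<or> degenerate p q i"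
  using assms(2-)
proof (induction i rule: dec_induct)
  case base
  then show ?case using solid_1 by blast
next
  case (step i)
  have cop: "coprime (p (Suc i)) (q (Suc i))" and p: "p (Suc i) \<noteq> 0" using step by auto
  consider \<alpha> \<beta> where "solid p q i \<alpha> \<beta>" | "incompressible p q i" | "degenerate p q i"
    using step.IH step.prems by (metis le_SucI)
  then show ?case
  proof cases
    case (1 \<alpha> \<beta>)
    have \<alpha>\<beta>: "coprime \<alpha> \<beta>" using solid_coprime[OF 1] step.prems by simp
    consider "\<bar>\<beta>\<bar> = 1" | "\<bar>p (Suc i)\<bar> = 1" | "\<beta> = 0" "\<bar>p (Suc i)\<bar> \<noteq> 1" | "2 \<le> \<bar>\<beta>\<bar>" "2 \<le> \<bar>p (Suc i)\<bar>"
      using p by linarith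
    then show ?thesis
    proof cases
      case 1
      then show ?thesis using solid_fill[OF \<open>solid p q i \<alpha> \<beta>\<close>] by blast
    next
      case 2
      then show ?thesis using solid_regular[OF \<open>solid p q i \<alpha> \<beta>\<close>] by blast
    next
      case 3
      have "degenerate p q (Suc i)"
        by (rule degenerate_start[of p q i \<alpha>]) (use p0 3 \<open>solid p q i \<alpha> \<beta>\<close> \<alpha>\<beta> in simp_all)
      then show ?thesis by blast
    next
      case 4
      then show ?thesis using incompressible_start[OF 1 p0 _ _ \<alpha>\<beta> cop] by blast
    qed
  next
    case 2
    then show ?thesis using incompressible_Suc[of p q i] step.hyps(1) p cop by blast
  next
    case 3
    then show ?thesis using degenerate_Suc step.hyps by blast
  qed
qed

section \<open>Representations of triangle groups\<close>

definition neg :: "complex \<times> complex \<Rightarrow> complex \<times> complex" where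
  "neg v = (- fst v, - snd v)"

text \<open>The solution is \<open>sin \<theta> \<cdot> s n = sin (n \<theta>) \<cdot> s 1 - sin ((n - 1) \<theta>) \<cdot> s 0\<close> with \<open>\<theta> = pi / l\<close>.\<close>

lemma recurrence_half_period:
  fixes s :: "nat \<Rightarrow> complex"
  assumes rec: "\<And>n. s (n + 2) = of_real (2 * cos (pi / l)) * s (n + 1) - s n" and l: "2 \<le> (l :: nat)"
  shows "s l = - s 0"
proof -
  define \<theta> where "\<theta> = pi / l"
  have \<theta>: "0 < \<theta>" "\<theta> < pi" using l by (auto simp: \<theta>_def field_simps)
  have step: "sin ((n + 2) * \<theta>) = 2 * cos \<theta> * sin ((n + 1) * \<theta>) - sin (n * \<theta>)" for n :: real
  proof -
    have "sin ((n + 1) * \<theta> + \<theta>) + sin ((n + 1) * \<theta> - \<theta>) = 2 * cos \<theta> * sin ((n + 1) * \<theta>)"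
      by (simp add: sin_add sin_diff)
    then show ?thesis by (simp add: algebra_simps)
  qed
  have "of_real (sin \<theta>) * s (n + 1) = of_real (sin ((n + 1) * \<theta>)) * s 1 - of_real (sin (n * \<theta>)) * s 0 \<and>
      of_real (sin \<theta>) * s (n + 2) = of_real (sin ((n + 2) * \<theta>)) * s 1 - of_real (sin ((n + 1) * \<theta>)) * s 0" for n :: nat
  proof (induction n)
    case 0
    have e: "s 2 = of_real (2 * cos \<theta>) * s 1 - s 0"
      using rec[of 0] by (simp add: \<theta>_def numeral_2_eq_2)
    have "of_real (sin \<theta>) * s 2 = of_real (2 * cos \<theta> * sin \<theta>) * s 1 - of_real (sin \<theta>) * s 0"
      unfolding e by (simp add: algebra_simps)
    then show ?case using step[of 0] by (simp add: numeral_2_eq_2)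
  next
    case (Suc n)
    let ?a = "of_real (sin \<theta>) :: complex" let ?c = "of_real (2 * cos \<theta>) :: complex"
    have e: "s (n + 3) = ?c * s (n + 2) - s (n + 1)"
      using rec[of "n + 1"] by (simp add: \<theta>_def numeral_3_eq_3)
    have "?a * s (n + 3) = ?c * (?a * s (n + 2)) - ?a * s (n + 1)"
      unfolding e by (simp add: algebra_simps)
    also have "\<dots> = of_real (2 * cos \<theta> * sin ((n + 2) * \<theta>) - sin ((n + 1) * \<theta>)) * s 1
        - of_real (2 * cos \<theta> * sin ((n + 1) * \<theta>) - sin (n * \<theta>)) * s 0"
    proof -
      have I: "?a * s (n + 1) = of_real (sin ((n + 1) * \<theta>)) * s 1 - of_real (sin (n * \<theta>)) * s 0"
        "?a * s (n + 2) = of_real (sin ((n + 2) * \<theta>)) * s 1 - of_real (sin ((n + 1) * \<theta>)) * s 0"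
        using Suc by auto
      show ?thesis unfolding I by (simp add: algebra_simps)
    qed
    also have "\<dots> = of_real (sin ((n + 3) * \<theta>)) * s 1 - of_real (sin ((n + 2) * \<theta>)) * s 0"
    proof -
      have e1: "sin ((n + 3) * \<theta>) = 2 * cos \<theta> * sin ((n + 2) * \<theta>) - sin ((n + 1) * \<theta>)"
        using step[of "real n + 1"] by (simp add: algebra_simps)
      have e2: "2 * cos \<theta> * sin ((n + 1) * \<theta>) - sin (n * \<theta>) = sin ((n + 2) * \<theta>)"
        using step[of "real n"] by (simp add: algebra_simps)
      show ?thesis by (simp only: e1 e2)
    qed
    finally show ?case using Suc by (simp add: algebra_simps numeral_3_eq_3)
  qed
  from this[of "l - 1"] have "of_real (sin \<theta>) * s l = of_real (sin (l * \<theta>)) * s 1 - of_real (sin ((real l - 1) * \<theta>)) * s 0"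
    using l by (simp add: of_nat_diff)
  moreover have "real l * \<theta> = pi" using l by (simp add: \<theta>_def)
  moreover have "sin ((real l - 1) * \<theta>) = sin \<theta>"
  proof -
    have "(real l - 1) * \<theta> = pi - \<theta>" using \<open>real l * \<theta> = pi\<close> by (simp add: algebra_simps)
    then show ?thesis by simp
  qed
  ultimately have "of_real (sin \<theta>) * s l = of_real (sin \<theta>) * - s 0" by simp
  moreover have "sin \<theta> \<noteq> 0" using sin_gt_zero[OF \<theta>] by simp
  ultimately show ?thesis by (simp only: mult_cancel_left of_real_eq_0_iff) simp
qed

text \<open>A matrix of determinant one and trace \<open>2 cos (pi / l)\<close> satisfies the hypotheses by the theorem of
  Cayley and Hamilton. Its \<open>l\<close>-th power is minus the identity.\<close>

lemma elliptic_pow: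
  fixes f :: "complex \<times> complex \<Rightarrow> complex \<times> complex"
  assumes l: "2 \<le> (l :: nat)" and f: "\<And>v. fst (f (f v)) = of_real (2 * cos (pi / l)) * fst (f v) - fst v"
    "\<And>v. snd (f (f v)) = of_real (2 * cos (pi / l)) * snd (f v) - snd v"
  shows "f ^^ l = neg"
proof
  fix v
  have "fst ((f ^^ l) v) = - fst ((f ^^ 0) v)" "snd ((f ^^ l) v) = - snd ((f ^^ 0) v)"
    by (rule recurrence_half_period[OF _ l]; simp only: f add_2_eq_Suc' Suc_eq_plus1[symmetric] funpow.simps comp_apply)+
  then show "(f ^^ l) v = neg v" by (simp add: neg_def prod_eq_iff)
qed

text \<open>A matrix and its negative have the same effect on the sets that are invariant under \<open>v \<mapsto> - v\<close>, so
  minus the identity becomes neutral. The other sets are fixed, to obtain a permutation of a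
  whole type.\<close>

definition act_sym :: "(complex \<times> complex \<Rightarrow> complex \<times> complex) \<Rightarrow> (complex \<times> complex) set \<Rightarrow> (complex \<times> complex) set" where
  "act_sym f S = (if neg ` S = S then f ` S else S)"

lemma act_sym_comp:
  assumes "g \<circ> neg = neg \<circ> g"
  shows "act_sym f \<circ> act_sym g = act_sym (f \<circ> g)"
proof
  fix S
  have "neg ` g ` S = g ` neg ` S" using assms by (metis image_comp)
  then show "(act_sym f \<circ> act_sym g) S = act_sym (f \<circ> g) S"
    by (cases "neg ` S = S") (simp_all add: act_sym_def image_comp)
qed

lemma act_sym_id: "act_sym id = id" and act_sym_neg: "act_sym neg = id"
  by (auto simp: act_sym_def fun_eq_iff)

lemma act_sym_funpow:
  assumes "f \<circ> neg = neg \<circ> f"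
  shows "act_sym f ^^ n = act_sym (f ^^ n)"
proof (induction n)
  case (Suc n)
  have "(f ^^ n) \<circ> neg = neg \<circ> (f ^^ n)"
    using assms by (induction n) (simp_all add: fun_eq_iff del: split_paired_All)
  then have "act_sym f \<circ> act_sym (f ^^ n) = act_sym (f \<circ> f ^^ n)" by (rule act_sym_comp)
  then show ?case using Suc by (simp only: funpow.simps)
qed (simp add: act_sym_id flip: id_def)

lemma bij_act_sym:
  assumes "f \<circ> neg = neg \<circ> f" "f ^^ l = neg" "1 \<le> l"
  shows "bij (act_sym f)"
proof (rule o_bij[of "act_sym f ^^ (l - 1)"])
  have "act_sym f ^^ l = id" using act_sym_funpow[OF assms(1), of l] assms(2) act_sym_neg by simp
  moreover have "act_sym f ^^ Suc (l - 1) = act_sym f ^^ l" using assms(3) by simp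
  ultimately show "act_sym f ^^ (l - 1) \<circ> act_sym f = id" "act_sym f \<circ> act_sym f ^^ (l - 1) = id"
    using funpow_Suc_right[of "l - 1" "act_sym f"] by simp_all
qed

text \<open>Two matrices of determinant one whose traces and whose product's trace are
  \<open>2 cos (pi / l)\<close>, \<open>2 cos (pi / m)\<close> and \<open>2 cos (pi / n)\<close>. The product is triangular with
  diagonal entries \<open>1 / b\<close> and \<open>b\<close>, hence the choice of \<open>b\<close> as a root of unity.\<close>

lemma triangle_rep:
  fixes l m n :: nat
  assumes "2 \<le> l" "2 \<le> m" "2 \<le> n"
  obtains x y :: "(complex \<times> complex) set \<Rightarrow> (complex \<times> complex) set" where
    "bij x" "bij y" "x ^^ l = id" "y ^^ m = id" "(x \<circ> y) ^^ n = id" "x \<noteq> id"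
proof -
  let ?t = "\<lambda>l :: nat. of_real (2 * cos (pi / l)) :: complex"
  define b where "b = cis (pi / n)"
  have b: "b \<noteq> 0" by (simp add: b_def)
  have "b + 1 / b = ?t n" by (simp add: b_def cis_inverse divide_inverse complex_eq_iff)
  then have bt: "?t n = b + 1 / b" ..
  define f where "f v = (- snd v, fst v + ?t l * snd v)" for v :: "complex \<times> complex"
  define h where "h v = (?t m * fst v + b * snd v, - fst v / b)" for v :: "complex \<times> complex"
  have neg: "f \<circ> neg = neg \<circ> f" "h \<circ> neg = neg \<circ> h"
    by (auto simp: f_def h_def neg_def fun_eq_iff)
  then have neg': "(f \<circ> h) \<circ> neg = neg \<circ> (f \<circ> h)" by (metis comp_assoc)
  have f: "f ^^ l = neg"
    by (rule elliptic_pow[OF assms(1)]) (auto simp: f_def algebra_simps split: prod.splits)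
  have h: "h ^^ m = neg"
    by (rule elliptic_pow[OF assms(2)]) (use b in \<open>auto simp: h_def field_simps split: prod.splits\<close>)
  have fh: "(f \<circ> h) ^^ n = neg"
    by (rule elliptic_pow[OF assms(3)], unfold bt)
      (use b in \<open>auto simp: f_def h_def field_simps split: prod.splits\<close>)
  have "act_sym f \<noteq> id"
  proof
    assume "act_sym f = id"
    moreover have "neg ` {(1, 0), (- 1, 0)} = {(1, 0), (- 1, 0)}" by (auto simp: neg_def)
    ultimately have "f ` {(1, 0), (- 1, 0)} = {(1, 0), (- 1, 0)}" by (metis act_sym_def id_apply)
    then have "f (1, 0) \<in> {(1, 0), (- 1, 0)}" by blast
    then show False by (simp add: f_def)
  qed
  moreover have "act_sym f \<circ> act_sym h = act_sym (f \<circ> h)" using neg by (simp add: act_sym_comp)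
  ultimately show ?thesis
    using assms bij_act_sym[OF neg(1) f] bij_act_sym[OF neg(2) h]
      act_sym_funpow[OF neg(1), of l] act_sym_funpow[OF neg(2), of m] act_sym_funpow[OF neg', of n]
    by (intro that[of "act_sym f" "act_sym h"]) (simp_all add: f h fh act_sym_neg)
qed

section \<open>Chains that present the trivial group\<close>

definition only_trivial_rep :: "('b, 'c) monoid_scheme \<Rightarrow> (nat \<Rightarrow> int) \<Rightarrow> (nat \<Rightarrow> int) \<Rightarrow> nat \<Rightarrow> bool" where
  "only_trivial_rep K p q n \<longleftrightarrow> (\<forall>d. range d \<subseteq> carrier K \<longrightarrow>
    (\<forall>j. 1 \<le> j \<longrightarrow> j \<le> n \<longrightarrow> chain_rel K p q d j = \<one>\<^bsub>K\<^esub>) \<longrightarrow> (\<forall>j. 1 \<le> j \<longrightarrow> j \<le> n \<longrightarrow> d j = \<one>\<^bsub>K\<^esub>))"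

lemma only_trivial_repD:
  assumes "only_trivial_rep K p q n" "range d \<subseteq> carrier K"
    "\<And>j. \<lbrakk>1 \<le> j; j \<le> n\<rbrakk> \<Longrightarrow> chain_rel K p q d j = \<one>\<^bsub>K\<^esub>" "1 \<le> j" "j \<le> n"
  shows "d j = \<one>\<^bsub>K\<^esub>"
  using assms(1)[unfolded only_trivial_rep_def, rule_format, OF assms(2) _ assms(4,5)] assms(3) by simp

text \<open>The three types of groups in which the obstructions to triviality are realised.\<close>

definition rigid :: "(nat \<Rightarrow> int) \<Rightarrow> (nat \<Rightarrow> int) \<Rightarrow> nat \<Rightarrow> bool" where
  "rigid p q n \<longleftrightarrow> only_trivial_rep (perm_group :: (grid \<Rightarrow> grid) monoid) p q n \<and>
    only_trivial_rep (perm_group :: ((complex \<times> complex) set \<Rightarrow> (complex \<times> complex) set) monoid) p q n \<and>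
    (\<forall>m. only_trivial_rep (integer_mod_group m) p q n)"

context group begin

lemma flipped_chain_rel:
  assumes "range c \<subseteq> carrier G" "1 \<le> j" "j \<le> n"
  shows "chain_rel G (flip n p) (flip n q) (\<lambda>j. inv (flip n c j)) j = inv (chain_rel G p q c (n + 1 - j))"
proof -
  have c: "c j \<in> carrier G" for j using assms by auto
  have "n + 1 - (j - 1) = n + 1 - j + 1" "n + 1 - (j + 1) = n + 1 - j - 1" using assms by auto
  then show ?thesis using c by (simp add: chain_rel_def flip_def inv_mult_group int_pow_inv m_assoc)
qed

lemma only_trivial_rep_flip:
  assumes "only_trivial_rep G p q n"
  shows "only_trivial_rep G (flip n p) (flip n q) n"
  unfolding only_trivial_rep_def
proof (intro allI impI)
  fix d j
  assume d: "range d \<subseteq> carrier G" and rel: "\<forall>j. 1 \<le> j \<longrightarrow> j \<le> n \<longrightarrow> chain_rel G (flip n p) (flip n q) d j = \<one>"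
    and j: "1 \<le> j" "j \<le> n"
  let ?d = "\<lambda>j. inv (flip n d j)"
  have "range ?d \<subseteq> carrier G" using d by (auto simp: flip_def)
  moreover have "chain_rel G p q ?d i = \<one>" if "1 \<le> i" "i \<le> n" for i
    using chain_rel_of_flipped[OF d that, of p q] rel that by simp
  ultimately have "?d (n + 1 - j) = \<one>"
    by (rule only_trivial_repD[OF assms]) (use j in auto)
  then have "inv (d j) = \<one>" using j by (simp add: flip_def)
  moreover have "d j \<in> carrier G" using d by auto
  ultimately show "d j = \<one>" by simp
qed

lemma half_chain_trivial:
  assumes "half_chain G p q i c z y" "p 0 = 0" "\<And>j. \<lbrakk>1 \<le> j; j \<le> i\<rbrakk> \<Longrightarrow> c j = \<one>" "1 \<le> i"
  shows "z = \<one>" "y = \<one>"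
proof -
  have zy: "z = c i [^] p i" "y = c (i - 1) [^] p (i - 1) \<otimes> c i [^] q i"
    using assms(1) by (simp_all only: half_chain_def)
  have 1: "c i = \<one>" using assms(3,4) by blast
  then show "z = \<one>" using zy(1) by simp
  have "c (i - 1) [^] p (i - 1) = \<one>"
  proof (cases "i = 1")
    case False
    then have "c (i - 1) = \<one>" using assms(4) by (intro assms(3)) simp_all
    then show ?thesis by simp
  qed (simp add: assms(2))
  then show "y = \<one>" using zy(2) 1 by simp
qed

lemma only_trivial_rep_half_chain:
  assumes triv: "only_trivial_rep G p q n" and p: "p 0 = 0" "p (n + 1) = 0"
    and h: "half_chain G p q i c \<one> \<one>" and i: "1 \<le> i" "i \<le> n" and j: "1 \<le> j" "j \<le> i"
  shows "c j = \<one>"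
proof (cases "i = n")
  case True
  have "chain_rel G p q c t = \<one>" if "1 \<le> t" "t \<le> n" for t
  proof (cases "t = n")
    case True
    have "\<one> = c (n - 1) [^] p (n - 1) \<otimes> c n [^] q n"
      using h unfolding half_chain_def \<open>i = n\<close> by blast
    then have "chain_rel G p q c t = \<one> \<otimes> c (n + 1) [^] p (n + 1)"
      by (simp only: chain_rel_def True)
    then show ?thesis using p by simp
  next
    case False
    then show ?thesis using h that \<open>i = n\<close> unfolding half_chain_def by simp
  qed
  moreover have "range c \<subseteq> carrier G" using h unfolding half_chain_def by blast
  ultimately show ?thesis using only_trivial_repD[OF triv, of c j] i j by auto
next
  case False
  have "half_chain G (flip n p) (flip n q) (n - i) (\<lambda>_. \<one>) \<one> \<one>"
    by (auto simp: half_chain_def chain_rel_def)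
  moreover have "i < n" using i False by simp
  ultimately obtain d where d: "range d \<subseteq> carrier G" "\<And>j. \<lbrakk>1 \<le> j; j \<le> n\<rbrakk> \<Longrightarrow> chain_rel G p q d j = \<one>"
    "\<And>j. j \<le> i \<Longrightarrow> d j = c j"
    using half_chains_glue[OF h _ i(1)] by blast
  have "d j = \<one>" by (rule only_trivial_repD[OF triv d(1,2)]) (use i j in auto)
  then show ?thesis using d(3) j by simp
qed

lemma only_trivial_rep_glue:
  assumes triv: "only_trivial_rep G p q n" and p: "p 0 = 0" and i: "1 \<le> i" "i < n"
    and l: "half_chain G p q i c z y" and r: "half_chain G (flip n p) (flip n q) (n - i) c' y z"
  shows "z = \<one>" "y = \<one>"
proof -
  obtain d where d: "range d \<subseteq> carrier G" "\<And>j. \<lbrakk>1 \<le> j; j \<le> n\<rbrakk> \<Longrightarrow> chain_rel G p q d j = \<one>"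
    "\<And>j. j \<le> i \<Longrightarrow> d j = c j"
    using half_chains_glue[OF l r i] by blast
  have "c j = \<one>" if "1 \<le> j" "j \<le> i" for j
    using only_trivial_repD[OF triv d(1,2), of j] d(3)[of j] i that by simp
  then show "z = \<one>" "y = \<one>" using half_chain_trivial[OF l p] i by simp_all
qed

text \<open>Take a power \<open>u\<close> of \<open>x\<close> with \<open>u \<alpha> + v \<beta> = 1\<close>.\<close>

lemma torsion_root:
  fixes \<alpha> \<beta> :: int
  assumes "x \<in> carrier G" "x [^] \<beta> = \<one>" "coprime \<alpha> \<beta>"
  obtains b where "b \<in> carrier G" "b [^] \<alpha> = x" "b [^] \<beta> = \<one>"
proof -
  obtain u v where uv: "u * \<alpha> + v * \<beta> = 1" using bezout_int[of \<alpha> \<beta>] assms(3) by auto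
  have "(x [^] u) [^] \<beta> = \<one>"
    using assms by (simp add: int_pow_pow mult.commute[of u] flip: int_pow_pow[OF assms(1), of \<beta>])
  moreover have "(x [^] u) [^] \<alpha> = x"
  proof -
    have "x [^] (u * \<alpha> + v * \<beta>) = x [^] (u * \<alpha>) \<otimes> (x [^] \<beta>) [^] v"
      using assms(1) by (simp add: int_pow_mult int_pow_pow mult.commute)
    then show ?thesis using assms uv by (simp add: int_pow_pow)
  qed
  ultimately show ?thesis using that[of "x [^] u"] assms(1) by simp
qed

lemma int_pow_eq_oneI:
  assumes "x \<in> carrier G" "x [^] nat \<bar>k\<bar> = \<one>"
  shows "x [^] (k :: int) = \<one>"
proof (cases k rule: int_cases2)
  case (nonneg n)
  then show ?thesis using assms(2) by (simp add: int_pow_int)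
next
  case (nonpos n)
  then show ?thesis using assms by (simp add: int_pow_neg int_pow_int)
qed

end

lemma rigid_flip: "rigid p q n \<Longrightarrow> rigid (flip n p) (flip n q) n"
  unfolding rigid_def
  by (simp add: group.only_trivial_rep_flip[OF group_perm_group] group.only_trivial_rep_flip[OF group_integer_mod_group])

lemma rigid_not_degenerate:
  assumes "rigid p q n" "p 0 = 0" "p (n + 1) = 0" "1 \<le> i" "i \<le> n"
  shows "\<not> degenerate p q i"
proof
  assume "degenerate p q i"
  then obtain m c j where "half_chain (integer_mod_group m) p q i c 0 0" "1 \<le> j" "j \<le> i" "c j \<noteq> 0"
    by (auto simp: degenerate_def)
  then show False
    using group.only_trivial_rep_half_chain[OF group_integer_mod_group, of m p q n i c j] assms
    by (simp add: rigid_def)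
qed

text \<open>The two halves have to exchange the roles of \<open>z\<close> and \<open>y\<close> (\<open>half_chains_glue\<close>), which conjugation
  by the swap of the first two coordinates achieves.\<close>

lemma rigid_not_incompressible:
  assumes rig: "rigid p q n" and p0: "p 0 = 0" and i: "1 \<le> i" "i < n"
    and inc: "incompressible p q i" "incompressible (flip n p) (flip n q) (n - i)"
  shows False
proof -
  define sw :: "grid \<Rightarrow> grid" where "sw = (\<lambda>(a, b, n). (b, a, n))"
  have sw: "sw (sw x) = x" for x by (auto simp: sw_def split: prod.splits)
  have bsw: "bij sw" by (rule o_bij[of sw]) (auto simp: fun_eq_iff sw)
  define \<Phi> where "\<Phi> f = sw \<circ> f \<circ> sw" for f
  have "\<Phi> \<in> Group.hom perm_group perm_group"
    by (rule homI) (auto simp: \<Phi>_def fun_eq_iff sw intro: bij_comp bsw)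
  then have hom: "group_hom perm_group perm_group \<Phi>"
    by (intro group_hom.intro group_hom_axioms.intro group_perm_group)
  have \<Phi>: "\<Phi> shift_fst = shift_snd" "\<Phi> shift_snd = shift_fst"
    by (auto simp: \<Phi>_def sw_def shift_fst_def shift_snd_def)
  obtain c c' where c: "half_chain perm_group p q i c shift_fst shift_snd"
    and c': "half_chain perm_group (flip n p) (flip n q) (n - i) c' shift_fst shift_snd"
    using inc unfolding incompressible_def by blast
  have triv: "only_trivial_rep (perm_group :: (grid \<Rightarrow> grid) monoid) p q n" using rig by (simp add: rigid_def)
  have "shift_fst = \<one>\<^bsub>perm_group\<^esub>"
    by (rule perm.only_trivial_rep_glue(1)[where p = p and q = q, OF triv _ i c half_chain_map[OF hom c', unfolded \<Phi>]])
      (rule p0)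
  then have "shift_fst (0, 0, 0) = (0, 0, 0)" by simp
  then show False by (simp add: shift_fst_def)
qed

text \<open>All peripheral elements \<open>b^\<beta>\<close>, \<open>c^p\<close>, \<open>d^\<delta>\<close> are made neutral. The relation that is left,
  \<open>b^\<alpha> c^q = d^\<gamma>\<close>, is that of the triangle group with \<open>x = b^\<alpha>\<close> and \<open>y = c^q\<close>.\<close>

lemma rigid_no_triangle:
  assumes rig: "rigid p q n" and p0: "p 0 = 0" "p (n + 1) = 0" and i: "1 \<le> i" "i + 1 < n"
    and l: "solid p q i \<alpha> \<beta>" and r: "solid (flip n p) (flip n q) (n - (i + 1)) \<gamma> \<delta>"
    and cop: "coprime \<alpha> \<beta>" "coprime \<gamma> \<delta>" "coprime (p (i + 1)) (q (i + 1))"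
    and big: "2 \<le> \<bar>\<beta>\<bar>" "2 \<le> \<bar>p (i + 1)\<bar>" "2 \<le> \<bar>\<delta>\<bar>"
  shows False
proof -
  let ?K = "perm_group :: ((complex \<times> complex) set \<Rightarrow> (complex \<times> complex) set) monoid"
  obtain x y :: "(complex \<times> complex) set \<Rightarrow> (complex \<times> complex) set" where xy: "bij x" "bij y"
    and pow: "x ^^ nat \<bar>\<beta>\<bar> = id" "y ^^ nat \<bar>p (i + 1)\<bar> = id" "(x \<circ> y) ^^ nat \<bar>\<delta>\<bar> = id" and ne: "x \<noteq> id"
  proof (rule triangle_rep[of "nat \<bar>\<beta>\<bar>" "nat \<bar>p (i + 1)\<bar>" "nat \<bar>\<delta>\<bar>"])
    show "2 \<le> nat \<bar>\<beta>\<bar>" "2 \<le> nat \<bar>p (i + 1)\<bar>" "2 \<le> nat \<bar>\<delta>\<bar>" using big by linarith+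
  qed (rule that)
  have car: "x \<in> carrier ?K" "y \<in> carrier ?K" "x \<otimes>\<^bsub>?K\<^esub> y \<in> carrier ?K" using xy by (simp_all add: bij_comp)
  have "x [^]\<^bsub>?K\<^esub> \<beta> = \<one>\<^bsub>?K\<^esub>" "y [^]\<^bsub>?K\<^esub> p (i + 1) = \<one>\<^bsub>?K\<^esub>" "(x \<otimes>\<^bsub>?K\<^esub> y) [^]\<^bsub>?K\<^esub> \<delta> = \<one>\<^bsub>?K\<^esub>"
    using pow by (intro perm.int_pow_eq_oneI car; simp add: funpow_perm)+
  note ord = this
  obtain b where b: "b \<in> carrier ?K" "b [^]\<^bsub>?K\<^esub> \<alpha> = x" "b [^]\<^bsub>?K\<^esub> \<beta> = \<one>\<^bsub>?K\<^esub>"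
    using perm.torsion_root[OF car(1) ord(1) cop(1)] by blast
  obtain c where c: "c \<in> carrier ?K" "c [^]\<^bsub>?K\<^esub> q (i + 1) = y" "c [^]\<^bsub>?K\<^esub> p (i + 1) = \<one>\<^bsub>?K\<^esub>"
    using perm.torsion_root[OF car(2) ord(2), of "q (i + 1)"] cop(3) coprime_commute by blast
  obtain d where d: "d \<in> carrier ?K" "d [^]\<^bsub>?K\<^esub> \<gamma> = x \<otimes>\<^bsub>?K\<^esub> y" "d [^]\<^bsub>?K\<^esub> \<delta> = \<one>\<^bsub>?K\<^esub>"
    using perm.torsion_root[OF car(3) ord(3) cop(2)] by blast
  obtain cl where cl: "half_chain ?K p q i cl x \<one>\<^bsub>?K\<^esub>"
    using perm.solid_half_chain[OF l b(1) p0(1)] unfolding b by blast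
  have eq: "\<one>\<^bsub>?K\<^esub> \<otimes>\<^bsub>?K\<^esub> c [^]\<^bsub>?K\<^esub> p (Suc i) = \<one>\<^bsub>?K\<^esub>" using c(3) by simp
  obtain cl' where cl': "half_chain ?K p q (i + 1) cl' \<one>\<^bsub>?K\<^esub> (x \<otimes>\<^bsub>?K\<^esub> y)"
    and cl'_cl: "\<And>j. j \<le> i \<Longrightarrow> cl' j = cl j"
    using perm.half_chain_extend[OF cl c(1) eq i(1)] c by auto
  have "flip n p 0 = 0" using p0 by (simp add: flip_def)
  then obtain cr where cr: "half_chain ?K (flip n p) (flip n q) (n - (i + 1)) cr (x \<otimes>\<^bsub>?K\<^esub> y) \<one>\<^bsub>?K\<^esub>"
    using perm.solid_half_chain[OF r d(1)] unfolding d by blast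
  obtain e where e: "range e \<subseteq> carrier ?K" "\<And>j. \<lbrakk>1 \<le> j; j \<le> n\<rbrakk> \<Longrightarrow> chain_rel ?K p q e j = \<one>\<^bsub>?K\<^esub>"
    "\<And>j. j \<le> i + 1 \<Longrightarrow> e j = cl' j"
    using perm.half_chains_glue[OF cl' cr _ i(2)] by auto
  have "only_trivial_rep ?K p q n" using rig by (simp add: rigid_def)
  from only_trivial_repD[OF this e(1,2), of i] have "e i = \<one>\<^bsub>?K\<^esub>" using i by simp
  then have "cl i = \<one>\<^bsub>?K\<^esub>" using e(3)[of i] cl'_cl[of i] by simp
  moreover have "x = cl i [^]\<^bsub>?K\<^esub> p i" using cl unfolding half_chain_def by blast
  ultimately have "x = \<one>\<^bsub>?K\<^esub>" by (simp only: perm.int_pow_one)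
  then show False using ne by simp
qed

text \<open>If there is no such splitting, all left halves are solid, by induction: at a first failure the
  left half becomes incompressible, and each of the three kinds of the right half beyond the new
  piece is excluded.\<close>

lemma rigid_chain_splits:
  assumes rig: "rigid p q n" and p0: "p 0 = 0" "p (n + 1) = 0" and n: "1 \<le> n"
    and cop: "\<And>j. \<lbrakk>1 \<le> j; j \<le> n\<rbrakk> \<Longrightarrow> coprime (p j) (q j)" and nz: "\<And>j. \<lbrakk>2 \<le> j; j \<le> n\<rbrakk> \<Longrightarrow> p j \<noteq> 0"
  shows "(\<exists>\<alpha> \<beta>. solid p q n \<alpha> \<beta>) \<or>
    (\<exists>i \<alpha> \<beta> \<gamma> \<delta>. 1 \<le> i \<and> i < n \<and> solid p q i \<alpha> \<beta> \<and> solid (flip n p) (flip n q) (n - i) \<gamma> \<delta>)"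
proof (rule ccontr)
  assume neg: "\<not> ?thesis"
  let ?p = "flip n p" let ?q = "flip n q"
  have fp: "?p 0 = 0" "?p (n + 1) = 0" using p0 by (simp_all add: flip_def)
  have "\<exists>\<alpha> \<beta>. solid p q i \<alpha> \<beta>" if "1 \<le> i" "i \<le> n" for i
    using that
  proof (induction i rule: dec_induct)
    case base
    then show ?case using solid_1 by blast
  next
    case (step i)
    then obtain \<alpha> \<beta> where l: "solid p q i \<alpha> \<beta>" by auto
    have i: "1 \<le> i" "i < n" using step by auto
    have \<alpha>\<beta>: "coprime \<alpha> \<beta>" using solid_coprime[OF l] cop i by simp
    have cp: "coprime (p (Suc i)) (q (Suc i))" and pi: "p (Suc i) \<noteq> 0" using cop nz i by auto
    show ?case
    proof (rule ccontr)
      assume no: "\<nexists>\<alpha> \<beta>. solid p q (Suc i) \<alpha> \<beta>"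
      have \<beta>1: "\<bar>\<beta>\<bar> \<noteq> 1" and p1: "\<bar>p (Suc i)\<bar> \<noteq> 1"
        using no solid_fill[OF l] solid_regular[OF l] by blast+
      have "\<not> degenerate p q (Suc i)" using rigid_not_degenerate[OF rig p0] i by simp
      then have "\<beta> \<noteq> 0" using degenerate_start[of p q i \<alpha>] l p0 p1 \<alpha>\<beta> by auto
      then have \<beta>2: "2 \<le> \<bar>\<beta>\<bar>" and p2: "2 \<le> \<bar>p (Suc i)\<bar>" using \<beta>1 p1 pi by linarith+
      show False
      proof (cases "Suc i = n")
        case True
        then have "solid ?p ?q (n - i) (?p 1) (?q 1)" using solid_1[of ?p ?q] by (metis Suc_diff_Suc cancel_comm_monoid_add_class.diff_cancel i(2) One_nat_def)
        then show False using neg l i by blast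
      next
        case False
        let ?j = "n - (i + 1)"
        have j: "1 \<le> ?j" "n - i = Suc ?j" using False i by auto
        have "?p (Suc ?j) = p (Suc i)" "?q (Suc ?j) = q (Suc i)" using i by (simp_all add: flip_def)
        note flip_i = this
        have fc: "coprime (?p t) (?q t)" if "1 \<le> t" "t \<le> n" for t
          using cop[of "n + 1 - t"] that by (simp add: flip_def)
        have "?p t \<noteq> 0" if "2 \<le> t" "t \<le> ?j" for t
          using nz[of "n + 1 - t"] that by (simp add: flip_def)
        then consider \<gamma> \<delta> where "solid ?p ?q ?j \<gamma> \<delta>" | "incompressible ?p ?q ?j" | "degenerate ?p ?q ?j"
          using half_trichotomy[of ?p ?j ?q] fp(1) j(1) fc by auto
        then show False
        proof cases
          case (1 \<gamma> \<delta>)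
          have \<gamma>\<delta>: "coprime \<gamma> \<delta>" using solid_coprime[OF 1] fc by simp
          have "\<nexists>\<gamma> \<delta>. solid ?p ?q (Suc ?j) \<gamma> \<delta>" using neg l i j by metis
          then have "\<bar>\<delta>\<bar> \<noteq> 1" using solid_fill[OF 1] by blast
          moreover have "\<not> degenerate ?p ?q (Suc ?j)"
            using rigid_not_degenerate[OF rigid_flip[OF rig] fp] i by simp
          then have "\<delta> \<noteq> 0" using degenerate_start[of ?p ?q ?j \<gamma>] 1 fp p1 flip_i \<gamma>\<delta> by auto
          ultimately have "2 \<le> \<bar>\<delta>\<bar>" by linarith
          then show False
            using rigid_no_triangle[OF rig p0 i(1) _ l 1 \<alpha>\<beta> \<gamma>\<delta>] cp \<beta>2 p2 False i by simp
        next
          case 2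
          have "incompressible p q (i + 1)" using incompressible_start[OF l p0(1) \<beta>2 p2 \<alpha>\<beta> cp] by simp
          then show False using rigid_not_incompressible[OF rig p0(1) _ _ _ 2] False i by simp
        next
          case 3
          then show False using rigid_not_degenerate[OF rigid_flip[OF rig] fp j(1)] i by simp
        qed
      qed
    qed
  qed
  then show False using neg n by blast
qed

section \<open>Andrews-Curtis reduction of a chain\<close>

context group begin

text \<open>Modulo \<open>b^x' d^y'\<close> one has \<open>b^(- t x') = d^(t y')\<close>. Inserting this between \<open>b^x\<close> and \<open>d^y\<close> subtracts
  a multiple of the second row of exponents from the first, although \<open>b\<close> and \<open>d\<close> do not commute.\<close>

lemma AC_mset_row_step:
  fixes x y x' y' t :: int
  assumes "b \<in> carrier G" "d \<in> carrier G"
  shows "AC_mset G {#b [^] x \<otimes> d [^] y, b [^] x' \<otimes> d [^] y'#}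
    {#b [^] (x - t * x') \<otimes> d [^] (y - t * y'), b [^] x' \<otimes> d [^] y'#}"
proof (rule AC_mset_replace)
  fix K :: "'a set monoid" and \<phi>
  assume "group_hom G K \<phi>" and k: "\<And>r. r \<in># {#b [^] x' \<otimes> d [^] y'#} \<Longrightarrow> \<phi> r = \<one>\<^bsub>K\<^esub>"
  then interpret h: group_hom G K \<phi> by simp
  let ?b = "\<phi> b" let ?d = "\<phi> d"
  have bd: "?b \<in> carrier K" "?d \<in> carrier K" using assms by auto
  have "\<phi> (b [^] x' \<otimes> d [^] y') = \<one>\<^bsub>K\<^esub>" by (rule k) simp
  then have "?b [^]\<^bsub>K\<^esub> x' \<otimes>\<^bsub>K\<^esub> ?d [^]\<^bsub>K\<^esub> y' = \<one>\<^bsub>K\<^esub>"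
    using assms by (simp add: h.hom_int_pow)
  then have "?b [^]\<^bsub>K\<^esub> x' = inv\<^bsub>K\<^esub> (?d [^]\<^bsub>K\<^esub> y')"
    using bd h.H.inv_equality[of "?b [^]\<^bsub>K\<^esub> x'" "?d [^]\<^bsub>K\<^esub> y'"] by simp
  \<comment> \<open>The second relator, solved for its power of \<open>b\<close>.\<close>
  then have e: "?b [^]\<^bsub>K\<^esub> x' = ?d [^]\<^bsub>K\<^esub> (- y')" using bd by (simp add: h.H.int_pow_neg)
  have "?b [^]\<^bsub>K\<^esub> (- t * x') = (?b [^]\<^bsub>K\<^esub> x') [^]\<^bsub>K\<^esub> (- t)"
    using bd by (simp add: h.H.int_pow_pow mult.commute)
  also have "\<dots> = ?d [^]\<^bsub>K\<^esub> (t * y')"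
    unfolding e using bd by (simp add: h.H.int_pow_pow mult.commute)
  finally have e': "?b [^]\<^bsub>K\<^esub> (- t * x') = ?d [^]\<^bsub>K\<^esub> (t * y')" .
  have "?b [^]\<^bsub>K\<^esub> (x - t * x') \<otimes>\<^bsub>K\<^esub> ?d [^]\<^bsub>K\<^esub> (y - t * y')
      = ?b [^]\<^bsub>K\<^esub> x \<otimes>\<^bsub>K\<^esub> (?b [^]\<^bsub>K\<^esub> (- t * x') \<otimes>\<^bsub>K\<^esub> ?d [^]\<^bsub>K\<^esub> (y - t * y'))"
    using bd h.H.int_pow_mult[of ?b x "- t * x'"] by (simp add: h.H.m_assoc)
  also have "?b [^]\<^bsub>K\<^esub> (- t * x') \<otimes>\<^bsub>K\<^esub> ?d [^]\<^bsub>K\<^esub> (y - t * y') = ?d [^]\<^bsub>K\<^esub> y"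
    unfolding e' using bd h.H.int_pow_mult[of ?d "t * y'" "y - t * y'"] by simp
  finally show "\<phi> (b [^] x \<otimes> d [^] y) = \<phi> (b [^] (x - t * x') \<otimes> d [^] (y - t * y'))"
    using assms by (simp add: h.hom_int_pow)
qed (use assms in auto)

lemma AC_mset_swap_pair:
  "AC_mset G {#u, v#} M \<Longrightarrow> AC_mset G {#v, u#} M"
  by (simp add: add_mset_commute)

text \<open>Euclid's algorithm on the second column of the exponent matrix.\<close>

lemma AC_mset_unimodular:
  fixes x y x' y' :: int
  assumes bd: "b \<in> carrier G" "d \<in> carrier G" and det: "\<bar>x * y' - x' * y\<bar> = 1"
  shows "AC_mset G {#b [^] x \<otimes> d [^] y, b [^] x' \<otimes> d [^] y'#} {#b, d#}"
  using det
proof (induction "nat (\<bar>y\<bar> + \<bar>y'\<bar>)" arbitrary: x y x' y' rule: less_induct)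
  case less
  have base: "AC_mset G {#b [^] x, b [^] x' \<otimes> d [^] y'#} {#b, d#}" if "\<bar>x\<bar> = 1" "\<bar>y'\<bar> = 1" for x x' y' :: int
  proof -
    have "AC_mset G {#b [^] x, b [^] x' \<otimes> d [^] y'#} {#b, b [^] x' \<otimes> d [^] y'#}"
      using that bd by (intro AC_mset_sign_power) auto
    also have "{#b, b [^] x' \<otimes> d [^] y'#} = {#b [^] x' \<otimes> d [^] y', b#}" by simp
    also have "AC_mset G {#b [^] x' \<otimes> d [^] y', b#} {#d [^] y', b#}"
    proof (rule AC_mset_replace)
      fix K :: "'a set monoid" and \<phi>
      assume "group_hom G K \<phi>" and k: "\<And>r. r \<in># {#b#} \<Longrightarrow> \<phi> r = \<one>\<^bsub>K\<^esub>"
      then interpret h: group_hom G K \<phi> by simp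
      have "\<phi> b = \<one>\<^bsub>K\<^esub>" by (rule k) simp
      then show "\<phi> (b [^] x' \<otimes> d [^] y') = \<phi> (d [^] y')" using bd by (simp add: h.hom_int_pow)
    qed (use bd in auto)
    also have "AC_mset G {#d [^] y', b#} {#d, b#}"
      using that bd by (intro AC_mset_sign_power) auto
    also have "{#d, b#} = {#b, d#}" by simp
    finally show ?thesis .
  qed
  consider "y = 0" | "y' = 0" | "y \<noteq> 0" "y' \<noteq> 0" "\<bar>y'\<bar> \<le> \<bar>y\<bar>" | "y \<noteq> 0" "y' \<noteq> 0" "\<bar>y\<bar> \<le> \<bar>y'\<bar>"
    by linarith
  then show ?case
  proof cases
    case 1
    then have "\<bar>x\<bar> = 1" "\<bar>y'\<bar> = 1" using less.prems abs_mult_self_eq by (auto simp: abs_mult zmult_eq_1_iff)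
    then show ?thesis using base 1 bd by simp
  next
    case 2
    then have "\<bar>x'\<bar> = 1" "\<bar>y\<bar> = 1" using less.prems by (auto simp: abs_mult zmult_eq_1_iff)
    then show ?thesis using base[of x' y x] 2 bd by (simp add: add_mset_commute)
  next
    case 3
    \<comment> \<open>The sign for which subtracting the row diminishes \<open>|y|\<close>.\<close>
    define t where "t = sgn y * sgn y'"
    have "\<bar>y - t * y'\<bar> < \<bar>y\<bar>" using 3 by (auto simp: t_def sgn_if abs_if)
    then have "AC_mset G {#b [^] (x - t * x') \<otimes> d [^] (y - t * y'), b [^] x' \<otimes> d [^] y'#} {#b, d#}"
      using less.prems by (intro less.hyps) (auto simp: algebra_simps)
    then show ?thesis using AC_mset_row_step[OF bd] AC_mset_trans by blast
  next
    case 4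
    define t where "t = sgn y * sgn y'"
    have "\<bar>y' - t * y\<bar> < \<bar>y'\<bar>" using 4 by (auto simp: t_def sgn_if abs_if)
    then have "AC_mset G {#b [^] x \<otimes> d [^] y, b [^] (x' - t * x) \<otimes> d [^] (y' - t * y)#} {#b, d#}"
      using less.prems by (intro less.hyps) (auto simp: algebra_simps)
    then have "AC_mset G {#b [^] (x' - t * x) \<otimes> d [^] (y' - t * y), b [^] x \<otimes> d [^] y#} {#b, d#}"
      by (rule AC_mset_swap_pair)
    then have "AC_mset G {#b [^] x' \<otimes> d [^] y', b [^] x \<otimes> d [^] y#} {#b, d#}"
      using AC_mset_row_step[OF bd] AC_mset_trans by blast
    then show ?thesis by (rule AC_mset_swap_pair)
  qed
qed

lemma AC_mset_invert_all:
  "set_mset M \<subseteq> carrier G \<Longrightarrow> AC_mset G M (image_mset (m_inv G) M)"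
proof (induction M)
  case (add x M)
  then have "AC_mset G (add_mset x M) (add_mset x (image_mset (m_inv G) M))"
    by (intro AC_mset_add_mset) auto
  also have "AC_mset G \<dots> (add_mset (inv x) (image_mset (m_inv G) M))"
    using add by (intro AC_mset_invert) auto
  finally show ?case by simp
qed (simp add: AC_mset_refl)

end

text \<open>A cyclic group whose generator has order \<open>m\<close>; for \<open>m = 0\<close> it is infinite.\<close>

lemma integer_mod_group_order:
  obtains e where "e \<in> carrier (integer_mod_group m)"
    "\<And>t :: int. e [^]\<^bsub>integer_mod_group m\<^esub> t = \<one>\<^bsub>integer_mod_group m\<^esub> \<longleftrightarrow> int m dvd t"
proof
  show "1 mod int m \<in> carrier (integer_mod_group m)"
    by (auto simp: carrier_integer_mod_group)
  show "(1 mod int m) [^]\<^bsub>integer_mod_group m\<^esub> t = \<one>\<^bsub>integer_mod_group m\<^esub> \<longleftrightarrow> int m dvd t" for t :: int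
    by (simp add: int_pow_integer_mod_group mod_mult_right_eq dvd_eq_mod_eq_0)
qed

context group begin

text \<open>The last relator is \<open>y = b^\<beta>\<close>. Were \<open>\<beta>\<close> not a unit, the cyclic group of order \<open>|\<beta>|\<close> would be a
  quotient of the presented group.\<close>

lemma AC_mset_solid_chain:
  fixes c :: "nat \<Rightarrow> 'a"
  assumes sol: "solid p q n \<alpha> \<beta>" and rig: "rigid p q n" and p0: "p 0 = 0" "p (n + 1) = 0"
    and cop: "coprime \<alpha> \<beta>" and c: "range c \<subseteq> carrier G"
  shows "AC_mset G (rel_mset G p q c 1 (Suc n)) (image_mset c (mset_set {1..<Suc n}))"
proof -
  have n: "1 \<le> n" using solid_pos[OF sol] .
  have "\<bar>\<beta>\<bar> = 1"
  proof -
    let ?K = "integer_mod_group (nat \<bar>\<beta>\<bar>)"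
    interpret K: group ?K by simp
    obtain e where e: "e \<in> carrier ?K"
      "\<And>t :: int. e [^]\<^bsub>?K\<^esub> t = \<one>\<^bsub>?K\<^esub> \<longleftrightarrow> int (nat \<bar>\<beta>\<bar>) dvd t" using integer_mod_group_order by blast
    obtain d where d: "half_chain ?K p q n d (e [^]\<^bsub>?K\<^esub> \<alpha>) (e [^]\<^bsub>?K\<^esub> \<beta>)"
      using K.solid_half_chain[OF sol e(1) p0(1)] by blast
    have dr: "range d \<subseteq> carrier ?K" using d unfolding half_chain_def by blast
    have "chain_rel ?K p q d j = \<one>\<^bsub>?K\<^esub>" if "1 \<le> j" "j \<le> n" for j
    proof (cases "j = n")
      case True
      have "e [^]\<^bsub>?K\<^esub> \<beta> = \<one>\<^bsub>?K\<^esub>" using e(2) by simp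
      then have "d (n - 1) [^]\<^bsub>?K\<^esub> p (n - 1) \<otimes>\<^bsub>?K\<^esub> d n [^]\<^bsub>?K\<^esub> q n = \<one>\<^bsub>?K\<^esub>"
        using d unfolding half_chain_def by metis
      then have "chain_rel ?K p q d j = \<one>\<^bsub>?K\<^esub> \<otimes>\<^bsub>?K\<^esub> d (n + 1) [^]\<^bsub>?K\<^esub> p (n + 1)"
        by (simp only: chain_rel_def True)
      then show ?thesis unfolding p0 by (simp only: int_pow_0 K.l_one K.one_closed)
    next
      case False
      then show ?thesis using d that unfolding half_chain_def by simp
    qed
    then have "d j = \<one>\<^bsub>?K\<^esub>" if "1 \<le> j" "j \<le> n" for j
      using only_trivial_repD[of ?K p q n d j] rig dr that unfolding rigid_def by blast
    then have "e [^]\<^bsub>?K\<^esub> \<alpha> = \<one>\<^bsub>?K\<^esub>" using K.half_chain_trivial(1)[OF d p0(1) _ n] by blast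
    then have "\<beta> dvd \<alpha>" using e(2) by simp
    then show ?thesis using cop by (metis coprime_common_divisor dvd_refl zdvd1_eq)
  qed
  note \<beta> = this
  obtain b where core: "is_core G p q c n \<alpha> \<beta> b" using solid_core[OF sol c p0(1)] by blast
  note b = is_coreD(1)[OF core]
  let ?M = "rel_mset G p q c 1 n"
  have M: "set_mset ?M \<subseteq> carrier G" using c by (rule rel_mset_closed)
  have cc: "c j \<in> carrier G" for j using c by auto
  have S: "chain_rel G p q c n = c (n - 1) [^] p (n - 1) \<otimes> c n [^] q n"
    using cc p0 by (simp add: chain_rel_def)
  have "AC_mset G (add_mset (chain_rel G p q c n) ?M) (add_mset (b [^] \<beta>) ?M)"
  proof (rule AC_mset_replace)
    fix K :: "'a set monoid" and \<phi>
    assume h: "group_hom G K \<phi>" and k: "\<And>r. r \<in># ?M \<Longrightarrow> \<phi> r = \<one>\<^bsub>K\<^esub>"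
    then interpret h: group_hom G K \<phi> by simp
    show "\<phi> (chain_rel G p q c n) = \<phi> (b [^] \<beta>)"
      using is_coreD(3)[OF core h] k b unfolding S by (simp add: h.hom_int_pow rel_mset_def)
  qed (use cc b M S in auto)
  also have "AC_mset G (add_mset (b [^] \<beta>) ?M) (add_mset b ?M)"
    using b M \<beta> by (intro AC_mset_sign_power) auto
  also have "AC_mset G (add_mset b ?M) (image_mset c (mset_set {1..<Suc n}))"
    by (rule is_coreD(2)[OF core])
  finally show ?thesis using n by (simp add: rel_mset_Suc)
qed

text \<open>If \<open>x\<close> and \<open>y\<close> solve the linear system modulo the determinant \<open>D\<close>, then \<open>b = e^x\<close> and \<open>d = e^y\<close> define a
  representation in the cyclic group of order \<open>|D|\<close>, so \<open>D\<close> divides \<open>x\<close>. The columns of the adjugate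
  matrix are such solutions; they show that \<open>D\<close> divides the coprime numbers \<open>\<gamma>\<close> and \<open>\<delta>\<close>.\<close>

lemma rigid_unimodular:
  assumes rig: "rigid p q n" and p0: "p 0 = 0" "p (n + 1) = 0" and i: "1 \<le> i" "i < n"
    and l: "solid p q i \<alpha> \<beta>" and r: "solid (flip n p) (flip n q) (n - i) \<gamma> \<delta>"
    and cop: "coprime \<alpha> \<beta>" "coprime \<gamma> \<delta>"
  shows "\<bar>\<alpha> * \<gamma> - \<beta> * \<delta>\<bar> = 1"
proof -
  let ?D = "\<alpha> * \<gamma> - \<beta> * \<delta>"
  let ?K = "integer_mod_group (nat \<bar>?D\<bar>)"
  interpret K: group ?K by simp
  obtain e where e: "e \<in> carrier ?K" and e': "\<And>t :: int. e [^]\<^bsub>?K\<^esub> t = \<one>\<^bsub>?K\<^esub> \<longleftrightarrow> ?D dvd t"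
    using integer_mod_group_order[of "nat \<bar>?D\<bar>"] by auto
  have e_eq: "e [^]\<^bsub>?K\<^esub> s = e [^]\<^bsub>?K\<^esub> t" if "?D dvd s - t" for s t :: int
  proof -
    have "e [^]\<^bsub>?K\<^esub> (s - t + t) = \<one>\<^bsub>?K\<^esub> \<otimes>\<^bsub>?K\<^esub> e [^]\<^bsub>?K\<^esub> t"
      using K.int_pow_mult[OF e, of "s - t" t] e'[THEN iffD2, OF that] by (simp only:)
    then show ?thesis using e by (simp only: diff_add_cancel K.l_one K.int_pow_closed)
  qed
  have fp: "flip n p 0 = 0" using p0 by (simp add: flip_def)
  have dvd: "?D dvd x" if "?D dvd x * \<beta> - y * \<gamma>" "?D dvd x * \<alpha> - y * \<delta>" for x y :: int
  proof -
    let ?b = "e [^]\<^bsub>?K\<^esub> x" let ?d = "e [^]\<^bsub>?K\<^esub> y"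
    have bd: "?b \<in> carrier ?K" "?d \<in> carrier ?K" using e by (auto intro: K.int_pow_closed)
    obtain cl where cl: "half_chain ?K p q i cl (?b [^]\<^bsub>?K\<^esub> \<alpha>) (?b [^]\<^bsub>?K\<^esub> \<beta>)"
      using K.solid_half_chain[OF l bd(1) p0(1)] by blast
    obtain cr where "half_chain ?K (flip n p) (flip n q) (n - i) cr (?d [^]\<^bsub>?K\<^esub> \<gamma>) (?d [^]\<^bsub>?K\<^esub> \<delta>)"
      using K.solid_half_chain[OF r bd(2) fp] by blast
    moreover have "?d [^]\<^bsub>?K\<^esub> \<gamma> = ?b [^]\<^bsub>?K\<^esub> \<beta>" "?d [^]\<^bsub>?K\<^esub> \<delta> = ?b [^]\<^bsub>?K\<^esub> \<alpha>"
      unfolding K.int_pow_pow[OF e] using that by (auto intro!: e_eq simp: dvd_diff_commute)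
    ultimately have cr: "half_chain ?K (flip n p) (flip n q) (n - i) cr (?b [^]\<^bsub>?K\<^esub> \<beta>) (?b [^]\<^bsub>?K\<^esub> \<alpha>)"
      by (simp only:)
    have triv: "only_trivial_rep ?K p q n" using rig unfolding rigid_def by blast
    have "e [^]\<^bsub>?K\<^esub> (x * \<alpha>) = \<one>\<^bsub>?K\<^esub>" "e [^]\<^bsub>?K\<^esub> (x * \<beta>) = \<one>\<^bsub>?K\<^esub>"
      using K.only_trivial_rep_glue[OF triv p0(1) i cl cr] unfolding K.int_pow_pow[OF e] by blast+
    then have "?D dvd x * \<alpha>" "?D dvd x * \<beta>" using e' by blast+
    then have "?D dvd gcd (x * \<alpha>) (x * \<beta>)" by simp
    then show "?D dvd x" using cop(1) by (simp add: gcd_mult_distrib_int[symmetric] coprime_iff_gcd_eq_1)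
  qed
  have "?D dvd \<gamma>" by (rule dvd[of \<gamma> \<beta>]) (simp_all add: algebra_simps)
  moreover have "?D dvd \<delta>" by (rule dvd[of \<delta> \<alpha>]) (simp_all add: algebra_simps dvd_diff_commute)
  ultimately show ?thesis using cop(2) by (metis coprime_common_divisor zdvd1_eq)
qed

text \<open>Modulo the relators inside the two halves, the two relators at the cut are words in the cores.
  Euclid's algorithm turns them into the cores \<open>b\<close> and \<open>d\<close>, and each core together with the relators
  of its half is equivalent to the generators of that half.\<close>

lemma AC_mset_two_solids:
  fixes c :: "nat \<Rightarrow> 'a"
  assumes rig: "rigid p q n" and p0: "p 0 = 0" "p (n + 1) = 0" and i: "1 \<le> i" "i < n"
    and l: "solid p q i \<alpha> \<beta>" and r: "solid (flip n p) (flip n q) (n - i) \<gamma> \<delta>"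
    and cop: "coprime \<alpha> \<beta>" "coprime \<gamma> \<delta>" and c: "range c \<subseteq> carrier G"
  shows "AC_mset G (rel_mset G p q c 1 (Suc n)) (image_mset c (mset_set {1..<Suc n}))"
proof -
  let ?j = "n - i" let ?p = "flip n p" let ?q = "flip n q" let ?S = "chain_rel G p q c"
  define c' where "c' = (\<lambda>j. inv (flip n c j))"
  have cc: "c j \<in> carrier G" for j using c by auto
  have c': "range c' \<subseteq> carrier G" using cc by (auto simp: c'_def flip_def)
  have fp: "?p 0 = 0" using p0 by (simp add: flip_def)
  obtain b where bcore: "is_core G p q c i \<alpha> \<beta> b" using solid_core[OF l c p0(1)] by blast
  obtain d where dcore: "is_core G ?p ?q c' ?j \<gamma> \<delta> d" using solid_core[OF r c' fp] by blast
  note b = is_coreD(1)[OF bcore] and d = is_coreD(1)[OF dcore]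
  define L where "L = rel_mset G p q c 1 i"
  define R where "R = rel_mset G p q c (i + 2) (Suc n)"
  define R' where "R' = rel_mset G ?p ?q c' 1 ?j"
  have Sc: "?S j \<in> carrier G" for j using c by (rule chain_rel_closed)
  have LR: "set_mset L \<subseteq> carrier G" "set_mset R \<subseteq> carrier G" "set_mset R' \<subseteq> carrier G"
    unfolding L_def R_def R'_def using rel_mset_closed[OF c] rel_mset_closed[OF c'] by blast+
  have flip_image: "image_mset (\<lambda>j. f (n + 1 - j)) (mset_set {s..<t}) = image_mset f (mset_set {n + 2 - t..<n + 2 - s})"
    if "1 \<le> s" "s \<le> t" "t \<le> n + 1" for s t and f :: "nat \<Rightarrow> 'a"
  proof -
    have "(\<lambda>j. n + 1 - j) ` {s..<t} = {n + 2 - t..<n + 2 - s}"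
    proof (intro equalityI subsetI)
      fix x assume "x \<in> {n + 2 - t..<n + 2 - s}"
      then show "x \<in> (\<lambda>j. n + 1 - j) ` {s..<t}" using that by (intro image_eqI[of _ _ "n + 1 - x"]) auto
    qed (use that in auto)
    moreover have "inj_on (\<lambda>j. n + 1 - j) {s..<t}" using that by (auto simp: inj_on_def)
    ultimately have "image_mset (\<lambda>j. n + 1 - j) (mset_set {s..<t}) = mset_set {n + 2 - t..<n + 2 - s}"
      by (simp only: image_mset_mset_set)
    then show ?thesis by (metis (no_types, lifting) image_mset.compositionality image_mset_cong comp_apply)
  qed
  have "R' = image_mset (\<lambda>j. inv (?S (n + 1 - j))) (mset_set {1..<?j})"
    unfolding R'_def rel_mset_def c'_def using flipped_chain_rel[OF c] i by (intro image_mset_cong) auto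
  also have "\<dots> = image_mset (\<lambda>j. inv (?S j)) (mset_set {i + 2..<Suc n})"
    using flip_image[of 1 ?j "\<lambda>j. inv (?S j)"] i by simp
  finally have R': "R' = image_mset (m_inv G) R"
    by (simp add: R_def rel_mset_def image_mset.compositionality comp_def)
  have inv_c: "image_mset c' (mset_set {1..<Suc ?j}) = image_mset (m_inv G) (image_mset c (mset_set {Suc i..<Suc n}))"
    using flip_image[of 1 "Suc ?j" "\<lambda>j. inv (c j)"] i
    by (simp add: c'_def flip_def image_mset.compositionality comp_def)
  have split: "rel_mset G p q c 1 (Suc n) = add_mset (?S i) (add_mset (?S (i + 1)) (L + R))"
  proof -
    have "{1..<Suc n} = insert i (insert (i + 1) ({1..<i} \<union> {i + 2..<Suc n}))" using i by auto
    then have "mset_set {1..<Suc n} = add_mset i (add_mset (i + 1) (mset_set ({1..<i} \<union> {i + 2..<Suc n})))"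
      by simp
    also have "mset_set ({1..<i} \<union> {i + 2..<Suc n}) = mset_set {1..<i} + mset_set {i + 2..<Suc n}"
      by (intro mset_set_Union) auto
    finally show ?thesis by (simp add: rel_mset_def L_def R_def)
  qed
  have eqs: "\<phi> (?S i) = \<phi> (b [^] \<beta> \<otimes> d [^] (- \<gamma>)) \<and> \<phi> (?S (i + 1)) = \<phi> (b [^] \<alpha> \<otimes> d [^] (- \<delta>))"
    if h: "group_hom G K \<phi>" and kL: "\<And>r. r \<in># L \<Longrightarrow> \<phi> r = \<one>\<^bsub>K\<^esub>" and kR: "\<And>r. r \<in># R' \<Longrightarrow> \<phi> r = \<one>\<^bsub>K\<^esub>"
    for K :: "'a set monoid" and \<phi>
  proof -
    interpret h: group_hom G K \<phi> by fact
    have 1: "\<phi> (c i [^] p i) = \<phi> b [^]\<^bsub>K\<^esub> \<alpha>" "\<phi> (c (i - 1) [^] p (i - 1) \<otimes> c i [^] q i) = \<phi> b [^]\<^bsub>K\<^esub> \<beta>"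
      using is_coreD(3)[OF bcore h] kL by (simp_all add: L_def rel_mset_def)
    have 2: "\<phi> (c' ?j [^] ?p ?j) = \<phi> d [^]\<^bsub>K\<^esub> \<gamma>" "\<phi> (c' (?j - 1) [^] ?p (?j - 1) \<otimes> c' ?j [^] ?q ?j) = \<phi> d [^]\<^bsub>K\<^esub> \<delta>"
      using is_coreD(3)[OF dcore h] kR by (simp_all add: R'_def rel_mset_def)
    have j: "n + 1 - ?j = i + 1" "n + 1 - (?j - 1) = i + 2" using i by auto
    have "c (i + 1) [^] p (i + 1) = inv (c' ?j [^] ?p ?j)"
      unfolding c'_def flip_def j using cc by (simp add: int_pow_inv)
    then have 3: "\<phi> (c (i + 1) [^] p (i + 1)) = \<phi> d [^]\<^bsub>K\<^esub> (- \<gamma>)"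
      using 2(1) d c' h.hom_inv[of "c' ?j [^] ?p ?j"] by (simp add: range_subsetD h.H.int_pow_neg)
    have "c (i + 1) [^] q (i + 1) \<otimes> c (i + 2) [^] p (i + 2) = inv (c' (?j - 1) [^] ?p (?j - 1) \<otimes> c' ?j [^] ?q ?j)"
      unfolding c'_def flip_def j using cc by (simp add: int_pow_inv inv_mult_group)
    then have 4: "\<phi> (c (i + 1) [^] q (i + 1) \<otimes> c (i + 2) [^] p (i + 2)) = \<phi> d [^]\<^bsub>K\<^esub> (- \<delta>)"
      using 2(2) d c' h.hom_inv[of "c' (?j - 1) [^] ?p (?j - 1) \<otimes> c' ?j [^] ?q ?j"]
      by (simp add: range_subsetD h.H.int_pow_neg)
    have "\<phi> (?S i) = \<phi> (c (i - 1) [^] p (i - 1) \<otimes> c i [^] q i) \<otimes>\<^bsub>K\<^esub> \<phi> (c (i + 1) [^] p (i + 1))"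
      unfolding chain_rel_def using cc by (intro h.hom_mult) auto
    moreover have "\<phi> (?S (i + 1)) = \<phi> (c i [^] p i) \<otimes>\<^bsub>K\<^esub> \<phi> (c (i + 1) [^] q (i + 1) \<otimes> c (i + 2) [^] p (i + 2))"
      using cc by (subst h.hom_mult[symmetric]) (auto simp: chain_rel_def m_assoc)
    ultimately show ?thesis
      unfolding 1 3 4 using b d by (simp add: h.hom_int_pow)
  qed
  let ?u = "b [^] \<beta> \<otimes> d [^] (- \<gamma>)" let ?v = "b [^] \<alpha> \<otimes> d [^] (- \<delta>)"
  have uv: "?u \<in> carrier G" "?v \<in> carrier G" using b d by simp_all
  have "AC_mset G (rel_mset G p q c 1 (Suc n)) (add_mset (?S i) (add_mset (?S (i + 1)) (L + R')))"
  proof -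
    have "AC_mset G R R'" unfolding R' by (rule AC_mset_invert_all[OF LR(2)])
    then have "AC_mset G (R + {#?S i, ?S (i + 1)#} + L) (R' + {#?S i, ?S (i + 1)#} + L)"
      using Sc LR by (intro AC_mset_add) auto
    then show ?thesis unfolding split by (simp add: ac_simps)
  qed
  also have "AC_mset G \<dots> (add_mset ?u (add_mset (?S (i + 1)) (L + R')))"
    by (rule AC_mset_replace) (use Sc uv LR eqs in auto)
  also have "add_mset ?u (add_mset (?S (i + 1)) (L + R')) = add_mset (?S (i + 1)) (add_mset ?u (L + R'))"
    by simp
  also have "AC_mset G \<dots> (add_mset ?v (add_mset ?u (L + R')))"
    by (rule AC_mset_replace) (use Sc uv LR eqs in auto)
  also have "add_mset ?v (add_mset ?u (L + R')) = {#?u, ?v#} + (L + R')" by simp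
  also have "AC_mset G \<dots> ({#b, d#} + (L + R'))"
  proof (rule AC_mset_add)
    have "\<beta> * - \<delta> - \<alpha> * - \<gamma> = \<alpha> * \<gamma> - \<beta> * \<delta>" by simp
    then show "AC_mset G {#?u, ?v#} {#b, d#}"
      using rigid_unimodular[OF rig p0 i l r cop] b d by (intro AC_mset_unimodular) auto
  qed (use LR in auto)
  also have "{#b, d#} + (L + R') = add_mset b L + add_mset d R'" by simp
  also have "AC_mset G \<dots> (image_mset c (mset_set {1..<Suc i}) + add_mset d R')"
    using is_coreD(2)[OF bcore] LR d by (intro AC_mset_add) (auto simp: L_def)
  also have "AC_mset G \<dots> (image_mset c (mset_set {1..<Suc i}) + image_mset c' (mset_set {1..<Suc ?j}))"
    using AC_mset_add[OF is_coreD(2)[OF dcore], of "image_mset c (mset_set {1..<Suc i})"] cc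
    by (auto simp: R'_def ac_simps)
  also have "AC_mset G \<dots> (image_mset c (mset_set {1..<Suc i}) + image_mset c (mset_set {Suc i..<Suc n}))"
  proof -
    have "AC_mset G (image_mset c (mset_set {Suc i..<Suc n})) (image_mset c' (mset_set {1..<Suc ?j}))"
      unfolding inv_c using cc by (intro AC_mset_invert_all) auto
    from AC_mset_add[OF AC_mset_sym[OF this], of "image_mset c (mset_set {1..<Suc i})"] cc
    show ?thesis by (auto simp: ac_simps)
  qed
  also have "\<dots> = image_mset c (mset_set {1..<Suc n})"
  proof -
    have "{1..<Suc n} = {1..<Suc i} \<union> {Suc i..<Suc n}" using i by auto
    moreover have "mset_set ({1..<Suc i} \<union> {Suc i..<Suc n}) = mset_set {1..<Suc i} + mset_set {Suc i..<Suc n}"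
      by (intro mset_set_Union) auto
    ultimately show ?thesis by simp
  qed
  finally show ?thesis .
qed

end

section \<open>One-layer words form a chain\<close>

text \<open>The element \<open>a\<^bsub>j-1\<^esub> a\<^sub>j\<close> is the base of the power \<open>z\<^bsub>j-1\<^esub>\<close>; with \<open>a\<^sub>1\<close> they form a basis.\<close>

definition chain_gen :: "('b, 'c) monoid_scheme \<Rightarrow> (nat \<Rightarrow> 'b) \<Rightarrow> nat \<Rightarrow> 'b" where
  "chain_gen K a j = (if j = 1 then a 1 else a (j - 1) \<otimes>\<^bsub>K\<^esub> a j)"

definition chain_p :: "nat \<Rightarrow> (nat \<Rightarrow> int) \<Rightarrow> nat \<Rightarrow> int" where
  "chain_p g k j = (if 2 \<le> j \<and> j \<le> g then k (j - 1) else 0)"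

definition chain_q :: "(nat \<Rightarrow> int) \<Rightarrow> nat \<Rightarrow> int" where
  "chain_q k j = (if j = 1 then 1 else 1 + 2 * k (j - 1))"

text \<open>The one-layer words and the recursion of \<open>\<Theta>\<close> for arbitrary elements of an arbitrary group, so that
  they can be mapped along homomorphisms.\<close>

definition layer_word ::
    "('b, 'c) monoid_scheme \<Rightarrow> nat \<Rightarrow> (nat \<Rightarrow> 'b) \<Rightarrow> (nat \<Rightarrow> int) \<Rightarrow> (nat \<Rightarrow> 'b) \<Rightarrow> nat \<Rightarrow> 'b" where
  "layer_word K g a k t i = (if i = g then t g
    else t i \<otimes>\<^bsub>K\<^esub> (conj_by K (t i) (a i) \<otimes>\<^bsub>K\<^esub> a (i + 1)) [^]\<^bsub>K\<^esub> k i)"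

definition theta_seq :: "('b, 'c) monoid_scheme \<Rightarrow> nat \<Rightarrow> (nat \<Rightarrow> 'b) \<Rightarrow> (nat \<Rightarrow> int) \<Rightarrow> (nat \<Rightarrow> 'b) \<Rightarrow> bool" where
  "theta_seq K g a k t \<longleftrightarrow> range a \<subseteq> carrier K \<and> range t \<subseteq> carrier K \<and> t 1 = a 1 \<and>
    (\<forall>i. 1 \<le> i \<longrightarrow> i < g \<longrightarrow> t (i + 1) = a (i + 1) \<otimes>\<^bsub>K\<^esub> (a (i + 1) \<otimes>\<^bsub>K\<^esub> conj_by K (t i) (a i)) [^]\<^bsub>K\<^esub> k i)"

context group begin

lemma conj_int_pow:
  assumes x: "x \<in> carrier G" and g: "g \<in> carrier G"
  shows "(inv g \<otimes> x \<otimes> g) [^] (n :: int) = inv g \<otimes> x [^] n \<otimes> g"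
proof -
  have "(\<lambda>x. inv g \<otimes> x \<otimes> g) \<in> hom G G"
  proof (rule homI)
    fix x y assume "x \<in> carrier G" "y \<in> carrier G"
    then show "inv g \<otimes> (x \<otimes> y) \<otimes> g = inv g \<otimes> x \<otimes> g \<otimes> (inv g \<otimes> y \<otimes> g)"
      using g by (simp add: m_assoc) (simp add: m_assoc[symmetric])
  qed (use g in simp)
  then interpret h: group_hom G G "\<lambda>x. inv g \<otimes> x \<otimes> g"
    by (intro group_hom.intro group_hom_axioms.intro is_group)
  show ?thesis using h.hom_int_pow[OF x, of n] by simp
qed

lemma conj_by_commute:
  assumes "x \<in> carrier G" "t \<in> carrier G" "t \<otimes> x = x \<otimes> t"
  shows "conj_by G t x = x"
  using assms by (metis conj_by_def inv_closed l_inv l_one m_assoc)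

lemma commute_mult_self:
  "\<lbrakk>x \<in> carrier G; z \<in> carrier G; x \<otimes> z = z \<otimes> x\<rbrakk> \<Longrightarrow> x \<otimes> z \<otimes> x = x \<otimes> (x \<otimes> z)"
  by (metis m_assoc)

text \<open>By induction \<open>\<Theta>\<^sub>m\<close> commutes with \<open>a\<^sub>m\<close>, so \<open>P\<^sub>m = a\<^sub>m\<close>, and the relation \<open>Y\<^sub>m = 1\<close> reads
  \<open>z\<^sub>m = inv \<Theta>\<^sub>m\<close>. Thus \<open>z\<^sub>m\<close> commutes with \<open>a\<^sub>m\<close>; being a power of \<open>a\<^sub>m a\<^bsub>m+1\<^esub>\<close> it also commutes with
  \<open>a\<^bsub>m+1\<^esub>\<close>. Conjugation by \<open>a\<^sub>m\<close> turns \<open>z\<^sub>m\<close> into the power of \<open>a\<^bsub>m+1\<^esub> a\<^sub>m\<close> in \<open>\<Theta>\<^bsub>m+1\<^esub>\<close>.\<close>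

lemma theta_collapse:
  fixes k :: "nat \<Rightarrow> int"
  assumes seq: "theta_seq G g a k t" and m: "1 \<le> m" "m \<le> g"
    and triv: "\<And>j. \<lbrakk>1 \<le> j; j < m\<rbrakk> \<Longrightarrow> layer_word G g a k t j = \<one>"
  defines "z \<equiv> \<lambda>j. if j = 0 then \<one> else (a j \<otimes> a (j + 1)) [^] k j"
  shows "t m = a m \<otimes> z (m - 1) \<and> a m \<otimes> z (m - 1) = z (m - 1) \<otimes> a m"
  using m triv
proof (induction m rule: dec_induct)
  case base
  have "a 1 \<in> carrier G" "t 1 = a 1" using seq by (auto simp: theta_seq_def)
  then show ?case by (simp add: z_def)
next
  case (step m)
  have a: "a j \<in> carrier G" and tc: "t j \<in> carrier G" for j using seq by (auto simp: theta_seq_def)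
  have zc: "z j \<in> carrier G" for j using a by (simp add: z_def)
  let ?x = "a m" let ?y = "a (Suc m)" let ?z = "z m"
  have m: "1 \<le> m" "m < g" using step by auto
  have IH: "t m = ?x \<otimes> z (m - 1)" "?x \<otimes> z (m - 1) = z (m - 1) \<otimes> ?x" using step by auto
  have comm: "t m \<otimes> ?x = ?x \<otimes> t m"
    unfolding IH(1) by (rule commute_mult_self[OF a zc IH(2)])
  have P: "conj_by G (t m) ?x = ?x" using a tc comm by (intro conj_by_commute) auto
  have z: "?z = (?x \<otimes> ?y) [^] k m" using m by (simp add: z_def)
  have "layer_word G g a k t m = \<one>" using step m by simp
  then have "t m \<otimes> ?z = \<one>" using m P by (simp add: layer_word_def z)
  then have "inv (t m) = ?z" using inv_equality[OF inv_comm[OF _ tc zc] tc zc] by simp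
  then have xz: "?z \<otimes> ?x = ?x \<otimes> ?z" using commute_inv[OF tc a comm] by simp
  have cz: "?z \<otimes> (?x \<otimes> ?y) = (?x \<otimes> ?y) \<otimes> ?z"
    using commute_int_pow[of "?x \<otimes> ?y" "?x \<otimes> ?y" "k m" 1] a by (simp add: z)
  have "inv ?x \<otimes> ?z = ?z \<otimes> inv ?x" using commute_inv[of ?x ?z] xz a zc by simp
  then have "?z \<otimes> ?y = ?y \<otimes> ?z"
  proof -
    have "?z \<otimes> ?y = ?z \<otimes> inv ?x \<otimes> (?x \<otimes> ?y)" using a zc by (simp add: m_assoc) (simp add: m_assoc[symmetric])
    also have "\<dots> = inv ?x \<otimes> (?z \<otimes> (?x \<otimes> ?y))"
      using \<open>inv ?x \<otimes> ?z = ?z \<otimes> inv ?x\<close>[symmetric] a zc by (simp add: m_assoc)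
    also have "\<dots> = ?y \<otimes> ?z" unfolding cz using a zc by (simp add: m_assoc[symmetric])
    finally show ?thesis .
  qed
  moreover have "t (Suc m) = ?y \<otimes> ?z"
  proof -
    have "?y \<otimes> ?x = inv ?x \<otimes> (?x \<otimes> ?y) \<otimes> ?x" using a by (simp add: m_assoc[symmetric])
    then have "(?y \<otimes> ?x) [^] k m = inv ?x \<otimes> ?z \<otimes> ?x"
      unfolding z using conj_int_pow[of "?x \<otimes> ?y" ?x "k m"] a by (simp only: m_closed)
    also have "\<dots> = ?z" using xz a zc by (simp add: m_assoc) (simp add: m_assoc[symmetric])
    finally show ?thesis using seq m P by (simp add: theta_seq_def)
  qed
  ultimately show ?case by simp
qed

text \<open>With \<open>m = i - 1\<close> the chain relator is \<open>z\<^bsub>m-1\<^esub> a\<^sub>m a\<^sub>i z\<^sub>m z\<^sub>m w\<close>, and \<open>z\<^bsub>m-1\<^esub> a\<^sub>m\<close> cancels one \<open>z\<^sub>m\<close> by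
  the relation \<open>Y\<^sub>m = 1\<close>. What remains, \<open>a\<^sub>i z\<^sub>m w\<close>, is \<open>Y\<^sub>i\<close>.\<close>

lemma chain_rel_layer_word:
  fixes k :: "nat \<Rightarrow> int"
  assumes seq: "theta_seq G g a k t" and i: "1 \<le> i" "i \<le> g"
    and triv: "\<And>j. \<lbrakk>1 \<le> j; j < i\<rbrakk> \<Longrightarrow> layer_word G g a k t j = \<one>"
  shows "chain_rel G (chain_p g k) (chain_q k) (chain_gen G a) i = layer_word G g a k t i"
proof -
  have a: "a j \<in> carrier G" and tc: "t j \<in> carrier G" for j using seq by (auto simp: theta_seq_def)
  define z where "z = (\<lambda>j. if j = 0 then \<one> else (a j \<otimes> a (j + 1)) [^] k j)"
  have zc: "z j \<in> carrier G" for j using a by (simp add: z_def)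
  have collapse: "t m = a m \<otimes> z (m - 1)" "a m \<otimes> z (m - 1) = z (m - 1) \<otimes> a m" if "1 \<le> m" "m \<le> i" for m
    using theta_collapse[OF seq that(1)] that i triv unfolding z_def by simp_all
  have P: "conj_by G (t m) (a m) = a m" if "1 \<le> m" "m \<le> i" for m
  proof (rule conj_by_commute[OF a tc])
    show "t m \<otimes> a m = a m \<otimes> t m"
      unfolding collapse(1)[OF that] by (rule commute_mult_self[OF a zc collapse(2)[OF that]])
  qed
  define w where "w = (if i = g then \<one> else z i)"
  have wc: "w \<in> carrier G" using zc by (simp add: w_def)
  have Y: "layer_word G g a k t i = t i \<otimes> w"
    using i P[of i] tc by (simp add: layer_word_def w_def z_def)
  have last: "chain_gen G a (i + 1) [^] chain_p g k (i + 1) = w"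
    using i a by (auto simp: chain_gen_def chain_p_def w_def z_def)
  show ?thesis
  proof (cases "i = 1")
    case True
    have "chain_rel G (chain_p g k) (chain_q k) (chain_gen G a) i = a 1 \<otimes> w"
      using last True a wc by (simp add: chain_rel_def chain_p_def chain_q_def chain_gen_def)
    then show ?thesis using Y collapse(1)[of 1] True a by (simp add: z_def)
  next
    case False
    define m where "m = i - 1"
    have m: "i = m + 1" "1 \<le> m" "m < i" using False i by (auto simp: m_def)
    have first: "chain_gen G a (i - 1) [^] chain_p g k (i - 1) = z (m - 1)"
      using m i a by (auto simp: chain_gen_def chain_p_def z_def)
    have z: "(a m \<otimes> a i) [^] k m = z m" using m by (simp add: z_def)
    have "chain_gen G a i [^] chain_q k i = (a m \<otimes> a i) [^] (1 + k m + k m)"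
      using m by (simp add: chain_gen_def chain_q_def add.commute)
    then have mid: "chain_gen G a i [^] chain_q k i = a m \<otimes> a i \<otimes> z m \<otimes> z m"
      using a by (simp only: int_pow_mult int_pow_1 m_closed z)
    have "layer_word G g a k t m = \<one>" using triv m by simp
    then have "t m \<otimes> z m = \<one>" using m i P[of m] z by (simp add: layer_word_def)
    then have "z m \<otimes> t m = \<one>" using tc zc inv_comm by blast
    then have rel: "z m \<otimes> (z (m - 1) \<otimes> a m) = \<one>" using collapse[of m] m by simp
    have comm: "a i \<otimes> z m = z m \<otimes> a i" using collapse(2)[of i] m by simp
    have "z (m - 1) \<otimes> (a m \<otimes> a i \<otimes> z m \<otimes> z m) \<otimes> w = (z (m - 1) \<otimes> a m \<otimes> z m) \<otimes> a i \<otimes> z m \<otimes> w"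
      using a zc wc comm by (simp add: m_assoc)
    also have "z (m - 1) \<otimes> a m \<otimes> z m = \<one>"
      by (rule inv_comm[OF rel]) (use a zc in auto)
    finally have "z (m - 1) \<otimes> (a m \<otimes> a i \<otimes> z m \<otimes> z m) \<otimes> w = a i \<otimes> z m \<otimes> w"
      using a by simp
    then have "chain_rel G (chain_p g k) (chain_q k) (chain_gen G a) i = a i \<otimes> z m \<otimes> w"
      unfolding chain_rel_def first mid last .
    then show ?thesis using Y collapse(1)[of i] m by simp
  qed
qed

end

context group_hom begin

lemma hom_conj_by:
  "\<lbrakk>t \<in> carrier G; x \<in> carrier G\<rbrakk> \<Longrightarrow> h (conj_by G t x) = conj_by H (h t) (h x)"
  by (simp add: conj_by_def)

lemma hom_chain_gen:
  assumes "range a \<subseteq> carrier G"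
  shows "h (chain_gen G a j) = chain_gen H (h \<circ> a) j"
proof -
  have "a j \<in> carrier G" for j using assms by auto
  then show ?thesis by (simp add: chain_gen_def)
qed

lemma hom_chain_rel:
  assumes "range c \<subseteq> carrier G"
  shows "h (chain_rel G p q c j) = chain_rel H p q (h \<circ> c) j"
proof -
  have "c j \<in> carrier G" for j using assms by auto
  then show ?thesis by (simp add: chain_rel_def hom_int_pow)
qed

lemma hom_theta_seq:
  assumes "theta_seq G g a k t"
  shows "theta_seq H g (h \<circ> a) k (h \<circ> t)"
proof -
  have c: "a j \<in> carrier G" "t j \<in> carrier G" for j using assms by (auto simp: theta_seq_def)
  then have "conj_by G (t j) (a j) \<in> carrier G" for j by (simp add: conj_by_def)
  then show ?thesis using assms c by (auto simp: theta_seq_def hom_conj_by hom_int_pow)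
qed

lemma hom_layer_word:
  assumes "theta_seq G g a k t"
  shows "h (layer_word G g a k t i) = layer_word H g (h \<circ> a) k (h \<circ> t) i"
proof -
  have c: "a j \<in> carrier G" "t j \<in> carrier G" for j using assms by (auto simp: theta_seq_def)
  then have "conj_by G (t j) (a j) \<in> carrier G" for j by (simp add: conj_by_def)
  then show ?thesis using c by (simp add: layer_word_def hom_conj_by hom_int_pow)
qed

end

context group begin

lemma chain_gen_closed: "range a \<subseteq> carrier G \<Longrightarrow> range (chain_gen G a) \<subseteq> carrier G"
  by (auto simp: chain_gen_def)

lemma layer_word_closed:
  assumes "theta_seq G g a k t"
  shows "layer_word G g a k t i \<in> carrier G"
proof -
  have c: "a j \<in> carrier G" "t j \<in> carrier G" for j using assms by (auto simp: theta_seq_def)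
  then show ?thesis by (simp add: layer_word_def conj_by_def)
qed

text \<open>The relators are replaced from the last one downwards, since the equality of the two \<open>i\<close>-th
  relators uses the words \<open>Y\<^sub>j\<close> with \<open>j < i\<close>.\<close>

lemma AC_mset_layer_words:
  fixes k :: "nat \<Rightarrow> int"
  assumes seq: "theta_seq G g a k t" and i: "i \<le> g"
  shows "AC_mset G (image_mset (layer_word G g a k t) (mset_set {1..<Suc i}))
    (rel_mset G (chain_p g k) (chain_q k) (chain_gen G a) 1 (Suc i))"
  using i
proof (induction i)
  case 0
  then show ?case by (simp add: rel_mset_def AC_mset_refl)
next
  case (Suc i)
  let ?Y = "layer_word G g a k t" let ?S = "chain_rel G (chain_p g k) (chain_q k) (chain_gen G a)"
  let ?M = "image_mset ?Y (mset_set {1..<Suc i})"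
  have ac: "range a \<subseteq> carrier G" using seq by (simp add: theta_seq_def)
  have S: "?S j \<in> carrier G" for j using ac by (intro chain_rel_closed chain_gen_closed)
  have "AC_mset G (add_mset (?Y (Suc i)) ?M) (add_mset (?S (Suc i)) ?M)"
  proof (rule AC_mset_replace)
    fix K :: "'a set monoid" and \<phi>
    assume h: "group_hom G K \<phi>" and k: "\<And>r. r \<in># ?M \<Longrightarrow> \<phi> r = \<one>\<^bsub>K\<^esub>"
    interpret h: group_hom G K \<phi> by fact
    have "layer_word K g (\<phi> \<circ> a) k (\<phi> \<circ> t) j = \<one>\<^bsub>K\<^esub>" if "1 \<le> j" "j < Suc i" for j
      using k[of "?Y j"] that by (simp add: h.hom_layer_word[OF seq])
    then have "chain_rel K (chain_p g k) (chain_q k) (chain_gen K (\<phi> \<circ> a)) (Suc i) = layer_word K g (\<phi> \<circ> a) k (\<phi> \<circ> t) (Suc i)"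
      using Suc.prems by (intro h.H.chain_rel_layer_word[OF h.hom_theta_seq[OF seq]]) auto
    moreover have "\<phi> \<circ> chain_gen G a = chain_gen K (\<phi> \<circ> a)"
      using h.hom_chain_gen[OF ac] by (auto simp: fun_eq_iff)
    ultimately show "\<phi> (?Y (Suc i)) = \<phi> (?S (Suc i))"
      using h.hom_layer_word[OF seq] h.hom_chain_rel[OF chain_gen_closed[OF ac]] by simp
  qed (use layer_word_closed[OF seq] S in auto)
  also have "AC_mset G (add_mset (?S (Suc i)) ?M)
      (add_mset (?S (Suc i)) (rel_mset G (chain_p g k) (chain_q k) (chain_gen G a) 1 (Suc i)))"
    using Suc S by (intro AC_mset_add_mset) auto
  finally show ?case by (simp add: rel_mset_Suc atLeastLessThanSuc)
qed

lemma AC_mset_chain_gens: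
  assumes a: "range a \<subseteq> carrier G"
  shows "AC_mset G (image_mset (chain_gen G a) (mset_set {1..<Suc i})) (image_mset a (mset_set {1..<Suc i}))"
proof (induction i)
  case (Suc i)
  have ac: "a j \<in> carrier G" for j using a by auto
  have cc: "chain_gen G a j \<in> carrier G" for j using chain_gen_closed[OF a] by auto
  let ?M = "image_mset a (mset_set {1..<Suc i})"
  have "AC_mset G (add_mset (chain_gen G a (Suc i)) (image_mset (chain_gen G a) (mset_set {1..<Suc i})))
      (add_mset (chain_gen G a (Suc i)) ?M)"
    using Suc cc by (intro AC_mset_add_mset) auto
  also have "AC_mset G (add_mset (chain_gen G a (Suc i)) ?M) (add_mset (a (Suc i)) ?M)"
  proof (rule AC_mset_replace)
    fix K :: "'a set monoid" and \<phi>
    assume "group_hom G K \<phi>" and k: "\<And>r. r \<in># ?M \<Longrightarrow> \<phi> r = \<one>\<^bsub>K\<^esub>"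
    then interpret h: group_hom G K \<phi> by simp
    have "\<phi> (a i) = \<one>\<^bsub>K\<^esub>" if "i \<noteq> 0" using that by (intro k) auto
    then show "\<phi> (chain_gen G a (Suc i)) = \<phi> (a (Suc i))"
      using ac by (auto simp: chain_gen_def)
  qed (use ac cc in auto)
  finally show ?case by (simp add: atLeastLessThanSuc)
qed (simp add: AC_mset_refl)

end

section \<open>The equivalence with a free basis\<close>

text \<open>The index set is written \<open>{1..g}\<close> throughout; rewriting \<open>1\<close> would hide it from the group axioms.\<close>

declare One_nat_def [simp del]

text \<open>Total functions with values in the free group; outside \<open>{1..g}\<close> the values are dummies.\<close>

definition gens :: "nat \<Rightarrow> nat \<Rightarrow> nat word" where
  "gens g j = (if 1 \<le> j \<and> j \<le> g then gen j else \<one>\<^bsub>free_group {1..g}\<^esub>)"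

definition thetas :: "nat \<Rightarrow> (nat \<Rightarrow> int) \<Rightarrow> nat \<Rightarrow> nat word" where
  "thetas g k j = (if 1 \<le> j \<and> j \<le> g then Theta g k j else \<one>\<^bsub>free_group {1..g}\<^esub>)"

lemma gens_closed: "range (gens g) \<subseteq> carrier (free_group {1..g})"
proof -
  interpret F: group "free_group {1..g}" by (rule group_free_group)
  show ?thesis using gen_in_free_group[of _ "{1..g}"] by (auto simp: gens_def)
qed

lemma Theta_1 [simp]: "Theta g k 1 = gen 1"
  by (simp add: One_nat_def)

lemma Theta_closed:
  assumes "1 \<le> j" "j \<le> g"
  shows "Theta g k j \<in> carrier (free_group {1..g})"
  using assms
proof (induction j rule: dec_induct)
  case base
  then show ?case using gen_in_free_group[of 1 "{1..g}"] by simp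
next
  case (step j)
  interpret F: group "free_group {1..g}" by (rule group_free_group)
  have "Theta g k j \<in> carrier (free_group {1..g})" using step by simp
  moreover have "gen j \<in> carrier (free_group {1..g})" "gen (j + 1) \<in> carrier (free_group {1..g})"
    using step by (auto intro!: gen_in_free_group)
  ultimately have "Theta g k (j + 1) \<in> carrier (free_group {1..g})"
    unfolding Theta_Suc[OF step(1)] P_word_def conj_by_def
    by (intro F.m_closed F.int_pow_closed F.inv_closed)
  then show ?case by (simp only: Suc_eq_plus1)
qed

lemma theta_seq_thetas:
  assumes "1 \<le> g"
  shows "theta_seq (free_group {1..g}) g (gens g) k (thetas g k)"
proof -
  interpret F: group "free_group {1..g}" by (rule group_free_group)
  have "range (thetas g k) \<subseteq> carrier (free_group {1..g})"
    using Theta_closed by (auto simp: thetas_def)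
  moreover have "thetas g k (i + 1) = gens g (i + 1) \<otimes>\<^bsub>free_group {1..g}\<^esub> (gens g (i + 1) \<otimes>\<^bsub>free_group {1..g}\<^esub>
      conj_by (free_group {1..g}) (thetas g k i) (gens g i)) [^]\<^bsub>free_group {1..g}\<^esub> k i" if "1 \<le> i" "i < g" for i
    using that Theta_Suc[OF that(1), of g k] by (simp add: thetas_def gens_def P_word_def)
  ultimately show ?thesis using gens_closed assms by (auto simp: theta_seq_def thetas_def gens_def)
qed

lemma Y_word_layer_word:
  assumes "1 \<le> i" "i \<le> g"
  shows "Y_word g k i = layer_word (free_group {1..g}) g (gens g) k (thetas g k) i"
  using assms by (auto simp: Y_word_def layer_word_def thetas_def gens_def P_word_def Let_def)

lemma hom_trivial_of_trivial_presentation: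
  assumes triv: "trivial_group (presented_group A R)" and R: "R \<subseteq> carrier (free_group A)"
    and h: "group_hom (free_group A) K \<phi>" and k: "\<And>r. r \<in> R \<Longrightarrow> \<phi> r = \<one>\<^bsub>K\<^esub>"
    and x: "x \<in> carrier (free_group A)"
  shows "\<phi> x = \<one>\<^bsub>K\<^esub>"
proof -
  let ?F = "free_group A" let ?N = "normal_closure ?F R"
  interpret h: group_hom ?F K \<phi> by fact
  interpret N: normal ?N ?F using h.G.normal_closure_normal[OF R] .
  have "?N #>\<^bsub>?F\<^esub> x \<in> carrier (?F Mod ?N)" using x by (auto simp: FactGroup_def RCOSETS_def)
  then have "?N #>\<^bsub>?F\<^esub> x = ?N" using triv by (auto simp: presented_group_def trivial_group_def)
  then have "x \<in> ?N" using h.G.rcos_self[OF x N.subgroup_axioms] by simp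
  moreover have "?N \<subseteq> kernel ?F K \<phi>"
    using R k by (intro h.G.normal_closure_least h.normal_kernel) (auto simp: kernel_def)
  ultimately show ?thesis by (auto simp: kernel_def)
qed

text \<open>A representation \<open>d\<close> of the chain determines \<open>a\<^sub>1 = d\<^sub>1\<close> and \<open>a\<^sub>j = inv a\<^bsub>j-1\<^esub> d\<^sub>j\<close>. The resulting
  homomorphism kills the chain relators, hence the equivalent one-layer words, hence everything.\<close>

lemma only_trivial_rep_of_trivial_presentation:
  assumes g: "1 \<le> g" and triv: "trivial_group (presented_group {1..g} (Y_word g k ` {1..g}))" and K: "group K"
  shows "only_trivial_rep K (chain_p g k) (chain_q k) g"
  unfolding only_trivial_rep_def
proof (intro allI impI)
  fix d j
  assume d: "range d \<subseteq> carrier K" and rel: "\<forall>j. 1 \<le> j \<longrightarrow> j \<le> g \<longrightarrow> chain_rel K (chain_p g k) (chain_q k) d j = \<one>\<^bsub>K\<^esub>"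
    and j: "1 \<le> j" "j \<le> g"
  let ?F = "free_group {1..g}" let ?p = "chain_p g k" let ?q = "chain_q k"
  interpret K: group K by fact
  interpret F: group ?F by (rule group_free_group)
  have dc: "d j \<in> carrier K" for j using d by auto
  define e where "e = rec_nat \<one>\<^bsub>K\<^esub> (\<lambda>j x. inv\<^bsub>K\<^esub> x \<otimes>\<^bsub>K\<^esub> d (Suc j))"
  have e0: "e 0 = \<one>\<^bsub>K\<^esub>" and e_Suc: "e (Suc j) = inv\<^bsub>K\<^esub> (e j) \<otimes>\<^bsub>K\<^esub> d (Suc j)" for j by (simp_all add: e_def)
  have ec: "e j \<in> carrier K" for j by (induction j) (simp_all add: e0 e_Suc dc)
  define \<phi> where "\<phi> = word_eval K e"
  have "\<phi> \<in> Group.hom ?F K" unfolding \<phi>_def using ec by (intro K.word_eval_hom) auto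
  then have h: "group_hom ?F K \<phi>" by (intro group_hom.intro group_hom_axioms.intro K group_free_group)
  interpret h: group_hom ?F K \<phi> by (rule h)
  have \<phi>_gen: "\<phi> (gen i) = e i" for i unfolding \<phi>_def using ec by (rule K.word_eval_gen)
  have \<phi>_gens: "\<phi> (gens g i) = e i" if "1 \<le> i" "i \<le> g" for i using that by (simp add: gens_def \<phi>_gen)
  let ?c = "chain_gen K (\<phi> \<circ> gens g)"
  have c: "?c i = d i" if "1 \<le> i" "i \<le> g" for i
  proof (cases "i = 1")
    case True
    then show ?thesis using \<phi>_gens[of 1] e_Suc[of 0] g dc by (simp add: chain_gen_def e0 One_nat_def)
  next
    case False
    define m where "m = i - 1"
    have m: "i = Suc m" "1 \<le> m" using False that by (auto simp: m_def)
    then show ?thesis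
      using that \<phi>_gens[of m] \<phi>_gens[of i] e_Suc[of m] dc ec by (simp add: chain_gen_def K.m_assoc[symmetric])
  qed
  have relc: "chain_rel K ?p ?q ?c i = \<one>\<^bsub>K\<^esub>" if "1 \<le> i" "i \<le> g" for i
  proof -
    have "?c (i - 1) [^]\<^bsub>K\<^esub> ?p (i - 1) = d (i - 1) [^]\<^bsub>K\<^esub> ?p (i - 1)"
      using c[of "i - 1"] that by (cases "i = 1") (auto simp: chain_p_def)
    moreover have "?c (i + 1) [^]\<^bsub>K\<^esub> ?p (i + 1) = d (i + 1) [^]\<^bsub>K\<^esub> ?p (i + 1)"
      using c[of "i + 1"] that by (cases "i = g") (auto simp: chain_p_def)
    ultimately have "chain_rel K ?p ?q ?c i = chain_rel K ?p ?q d i"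
      using c[OF that] by (simp only: chain_rel_def)
    then show ?thesis using rel that by simp
  qed
  have hc: "\<phi> \<circ> chain_gen ?F (gens g) = ?c"
    using h.hom_chain_gen[OF gens_closed] by (auto simp: fun_eq_iff)
  note seq = theta_seq_thetas[OF g, of k]
  let ?Y = "layer_word ?F g (gens g) k (thetas g k)"
  let ?M = "image_mset ?Y (mset_set {1..<Suc g})"
  have "\<forall>r \<in># rel_mset ?F ?p ?q (chain_gen ?F (gens g)) 1 (Suc g). \<phi> r = \<one>\<^bsub>K\<^esub>"
    using relc by (auto simp: rel_mset_def h.hom_chain_rel[OF F.chain_gen_closed[OF gens_closed]] hc)
  moreover have "set_mset ?M \<subseteq> carrier ?F" using F.layer_word_closed[OF seq] by auto
  ultimately have kill: "\<forall>r \<in># ?M. \<phi> r = \<one>\<^bsub>K\<^esub>"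
    using F.AC_mset_hom_trivial[OF F.AC_mset_layer_words[OF seq order_refl] h] by blast
  have "\<phi> (gen i) = \<one>\<^bsub>K\<^esub>" if "1 \<le> i" "i \<le> g" for i
  proof (rule hom_trivial_of_trivial_presentation[OF triv _ h])
    show "Y_word g k ` {1..g} \<subseteq> carrier ?F"
      using F.layer_word_closed[OF seq] by (auto simp: Y_word_layer_word)
    show "\<phi> r = \<one>\<^bsub>K\<^esub>" if "r \<in> Y_word g k ` {1..g}" for r
      using that kill by (auto simp: Y_word_layer_word)
    show "gen i \<in> carrier ?F" using that by (intro gen_in_free_group) auto
  qed
  then have "e i = \<one>\<^bsub>K\<^esub>" if "i \<le> g" for i using that e0 by (cases "i = 0") (auto simp: \<phi>_gen)
  then show "d j = \<one>\<^bsub>K\<^esub>" using e_Suc[of "j - 1"] j dc[of j] by simp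
qed

lemma word_eval_cong: "\<lbrakk>fst ` set w \<subseteq> A; \<And>x. x \<in> A \<Longrightarrow> f x = f' x\<rbrakk> \<Longrightarrow> word_eval G f w = word_eval G f' w"
  unfolding word_eval_def by (rule foldr_cong) auto

lemma free_basis_gens: "free_basis (free_group {1..g}) (map gen [1..<g+1])"
proof -
  let ?F = "free_group {1..g}" let ?E = "free_group {..<g}" let ?B = "map gen [1..<g+1] :: nat word list"
  interpret F: group ?F by (rule group_free_group)
  interpret E: group ?E by (rule group_free_group)
  have B: "?B ! i = gen (Suc i)" if "i < g" for i using that by (simp add: One_nat_def del: upt_Suc)
  have len: "length ?B = g" by simp
  let ?f = "word_eval ?F (\<lambda>i. ?B ! i)" let ?h = "word_eval ?E (\<lambda>j. gen (j - 1))"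
  have f: "?f \<in> Group.hom ?E ?F"
    by (rule F.word_eval_hom) (auto simp: B simp del: upt_Suc intro!: gen_in_free_group)
  have h: "?h \<in> Group.hom ?F ?E"
    by (rule E.word_eval_hom) (auto intro!: gen_in_free_group)
  have f_gen: "?f (gen i) = gen (Suc i)" if "i < g" for i
    using that F.word_eval_gen[of "\<lambda>i. ?B ! i" i] gen_in_free_group[of "Suc i" "{1..g}"] B[OF that] by auto
  have h_gen: "?h (gen j) = gen (j - 1)" if "j \<in> {1..g}" for j
    using that E.word_eval_gen[of "\<lambda>j. gen (j - 1)" j] gen_in_free_group[of "j - 1" "{..<g}"] by auto
  have hf: "?h (?f w) = w" if w: "w \<in> carrier ?E" for w
  proof -
    have "?h \<circ> ?f \<in> Group.hom ?E ?E" using f h by (rule Group.hom_compose)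
    then have "(?h \<circ> ?f) w = word_eval ?E (\<lambda>x. (?h \<circ> ?f) (gen x)) w" using w by (rule E.hom_free_group_unique)
    also have "\<dots> = word_eval ?E (\<lambda>x. id (gen x)) w"
      using w f_gen h_gen by (intro word_eval_cong[of _ "{..<g}"]) (auto simp: free_group_def)
    also have "\<dots> = id w" using w by (intro E.hom_free_group_unique[symmetric]) (auto simp: Group.hom_def)
    finally show ?thesis by simp
  qed
  have fh: "?f (?h w) = w" if w: "w \<in> carrier ?F" for w
  proof -
    have "?f \<circ> ?h \<in> Group.hom ?F ?F" using h f by (rule Group.hom_compose)
    then have "(?f \<circ> ?h) w = word_eval ?F (\<lambda>x. (?f \<circ> ?h) (gen x)) w" using w by (rule F.hom_free_group_unique)
    also have "\<dots> = word_eval ?F (\<lambda>x. id (gen x)) w"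
    proof (rule word_eval_cong[of _ "{1..g}"])
      show "(?f \<circ> ?h) (gen x) = id (gen x)" if "x \<in> {1..g}" for x
        using h_gen[OF that] f_gen[of "x - 1"] that by auto
    qed (use w in \<open>auto simp: free_group_def\<close>)
    also have "\<dots> = id w" using w by (intro F.hom_free_group_unique[symmetric]) (auto simp: Group.hom_def)
    finally show ?thesis by simp
  qed
  have "bij_betw ?f (carrier ?E) (carrier ?F)"
    using f h hf fh by (intro bij_betw_byWitness[of _ ?h]) (auto simp: Group.hom_def)
  then have "?f \<in> iso ?E ?F" using f by (simp add: iso_def)
  moreover have "set ?B \<subseteq> carrier ?F" by (auto intro!: gen_in_free_group)
  ultimately show ?thesis unfolding free_basis_def len by blast
qed

theorem theorem3p10:
  fixes g :: nat and k :: "nat \<Rightarrow> int"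
  assumes "g \<ge> 2"
    and "\<And>i. 1 \<le> i \<Longrightarrow> i < g \<Longrightarrow> k i \<noteq> 0"
    and "trivial_group (presented_group {1..g} (Y_word g k ` {1..g}))"
  shows "(\<exists>B. free_basis (free_group {1..g}) B \<and>
            AC_equivalent (free_group {1..g}) (map (Y_word g k) [1..<g+1]) B) \<and>
         AC_equivalent (free_group {1..g}) (map (Y_word g k) [1..<g+1]) (map gen [1..<g+1])"
proof -
  let ?F = "free_group {1..g}" let ?p = "chain_p g k" let ?q = "chain_q k"
  interpret F: group ?F by (rule group_free_group)
  have g: "1 \<le> g" using assms(1) by simp
  note seq = theta_seq_thetas[OF g, of k]
  let ?Y = "layer_word ?F g (gens g) k (thetas g k)" let ?c = "chain_gen ?F (gens g)"
  note c = F.chain_gen_closed[OF gens_closed]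
  have rig: "rigid ?p ?q g"
    unfolding rigid_def
    by (intro conjI allI only_trivial_rep_of_trivial_presentation[OF g assms(3)]
        group_perm_group group_integer_mod_group)
  have p0: "?p 0 = 0" "?p (g + 1) = 0" by (simp_all add: chain_p_def)
  have cop: "coprime (?p j) (?q j)" if "1 \<le> j" "j \<le> g" for j
  proof (cases "j = 1")
    case False
    have "coprime (k (j - 1)) (1 + 2 * k (j - 1))"
      using coprime_minus_mult[of "k (j - 1)" 1 "- 2"] by simp
    then show ?thesis using False that by (simp add: chain_p_def chain_q_def)
  qed (simp add: chain_p_def chain_q_def)
  have nz: "?p j \<noteq> 0" if "2 \<le> j" "j \<le> g" for j
    using assms(2)[of "j - 1"] that by (simp add: chain_p_def)
  have cop': "coprime (flip g ?p j) (flip g ?q j)" if "1 \<le> j" "j \<le> g" for j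
    using cop[of "g + 1 - j"] that by (simp add: flip_def)
  have map_upt: "mset (map f [1..<g+1]) = image_mset f (mset_set {1..<Suc g})" for f :: "nat \<Rightarrow> nat word"
    by (simp only: mset_map mset_upt Suc_eq_plus1)
  have "(\<exists>\<alpha> \<beta>. solid ?p ?q g \<alpha> \<beta>) \<or> (\<exists>i \<alpha> \<beta> \<gamma> \<delta>. 1 \<le> i \<and> i < g \<and> solid ?p ?q i \<alpha> \<beta> \<and>
      solid (flip g ?p) (flip g ?q) (g - i) \<gamma> \<delta>)"
    by (rule rigid_chain_splits[OF rig p0 g]) (use cop nz in auto)
  then have "AC_mset ?F (rel_mset ?F ?p ?q ?c 1 (Suc g)) (image_mset ?c (mset_set {1..<Suc g}))"
  proof (elim disjE exE conjE)
    fix \<alpha> \<beta> assume s: "solid ?p ?q g \<alpha> \<beta>"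
    have "coprime \<alpha> \<beta>" using solid_coprime[OF s] cop by simp
    then show ?thesis by (intro F.AC_mset_solid_chain[OF s rig p0 _ c])
  next
    fix i \<alpha> \<beta> \<gamma> \<delta>
    assume i: "1 \<le> i" "i < g" and l: "solid ?p ?q i \<alpha> \<beta>" and r: "solid (flip g ?p) (flip g ?q) (g - i) \<gamma> \<delta>"
    have "coprime \<alpha> \<beta>" using solid_coprime[OF l] cop i by simp
    moreover have "coprime \<gamma> \<delta>" using solid_coprime[OF r] cop' i by simp
    ultimately show ?thesis by (intro F.AC_mset_two_solids[OF rig p0 i l r _ _ c])
  qed
  then have "AC_mset ?F (image_mset ?Y (mset_set {1..<Suc g})) (image_mset (gens g) (mset_set {1..<Suc g}))"
    using F.AC_mset_layer_words[OF seq order_refl] F.AC_mset_chain_gens[OF gens_closed, of g] AC_mset_trans by blast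
  moreover have "mset (map (Y_word g k) [1..<g+1]) = image_mset ?Y (mset_set {1..<Suc g})"
    unfolding map_upt by (intro image_mset_cong) (auto simp: Y_word_layer_word)
  moreover have "mset (map gen [1..<g+1]) = image_mset (gens g) (mset_set {1..<Suc g})"
    unfolding map_upt by (intro image_mset_cong) (auto simp: gens_def)
  moreover have "set_mset (image_mset ?Y (mset_set {1..<Suc g})) \<subseteq> carrier ?F"
    using F.layer_word_closed[OF seq] by auto
  ultimately have "AC_equivalent ?F (map (Y_word g k) [1..<g+1]) (map gen [1..<g+1])"
    using F.AC_mset_imp_AC_equivalent by blast
  then show ?thesis using free_basis_gens by blast
qed

end
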